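(* Let $J\in\{I,J_1,J_+\}$. The homology groups $H^J_n(-)$, and likewise the homology groups $H^{(J,\times)}_n(-)$, together with their relative versions and the connecting homomorphisms of pairs, form a $(J,\times)$ homology theory of closure spaces.
   Context: A closure space $(X,c)$ is a set $X$ with a map $c:\mathcal P(X)\to\mathcal P(X)$ such that $c(\emptyset)=\emptyset$, $A\subseteq c(A)$, and $c(A\cup B)=c(A)\cup c(B)$. A subset $A\subseteq X$ carries the subspace closure $B\mapsto c(B)\cap A$. The interior is $i(A)=X\setminus c(X\setminus A)$, and $V$ is a neighborhood of $x$ if $x\in i(V)$. An interior cover of $X$ is a family $\mathcal U$ of subsets with $X=\bigcup_{U\in\mathcal U}i(U)$. A map $f:(X,c)\to(Y,d)$ is continuous if $f(c(A))\subseteq d(f(A))$ for all $A\subseteq X$. Topological spaces are closure spaces via the topological closure. The product $X\times Y$ is the set product with the closure for which the sets $U\times V$ ($U$ a neighborhood of $x$, $V$ of $y$) form a neighborhood base at $(x,y)$. Spaces: $I=[0,1]$ with the usual topology; $J_1=\{0,1\}$ with the indiscrete closure; $J_+=\{0,1\}$ with $c(\{0\})=\{0,1\}$, $c(\{1\})=\{1\}$. Singular simplices: $|\Delta^n|^{I}$ is the standard topological $n$-simplex; $|\Delta^n|^{J_1}$ is $\{0,\dots,n\}$ with the indiscrete closure; $|\Delta^n|^{J_+}$ is $\{0,\dots,n\}$ with $c(\{i\})=\{j: j\ge i\}$. $C^J_n(X)$ is the free abelian group on continuous maps $\sigma:|\Delta^n|^J\to X$, with $\partial\sigma=\sum_{i=0}^n(-1)^i\sigma\circ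 d^i$, $d^i$ the $i$-th face inclusion. Singular cubes: $J^{\times n}$ is the $n$-fold product (a point if $n=0$). Let $Q_n(X)$ be the free abelian group on continuous maps $\sigma:J^{\times n}\to X$ and $D_n(X)$ the subgroup generated by the degenerate $\sigma$, i.e. those that do not depend on their $i$-th coordinate for some $1\le i\le n$. Then $C^{(J,\times)}_n(X)=Q_n(X)/D_n(X)$, with $\partial\sigma=\sum_{i=1}^n(-1)^i(A_i\sigma-B_i\sigma)$, where $A_i\sigma$ (resp. $B_i\sigma$) is $\sigma$ with $0$ (resp. $1$) inserted in the $i$-th coordinate. $H^J_n(X,A)$ and $H^{(J,\times)}_n(X,A)$ are the homology groups of $C^J_\bullet(X)/C^J_\bullet(A)$ and $C^{(J,\times)}_\bullet(X)/C^{(J,\times)}_\bullet(A)$, and the groups of $X$ are those of $(X,\emptyset)$. Maps act by post-composition. Homotopy: $f,g:X\to Y$ are one-step $(J,\times)$-homotopic if there is a continuous $H:X\times J\to Y$ with $H(x,0)=f(x)$, $H(x,1)=g(x)$; $\sim_{(J,\times)}$ is the generated equivalence relation on continuous maps $X\to Y$. A $(J,\times)$ homology theory of closure spaces consists of a sequence of functors $H_n$ from pairs $(X,A)$ (a closure space and a subspace, with continuous maps of pairs; $H_n(X):=H_n(X,\emptyset)$) to abelian groups and natural transformations $\partial:H_n(X,A)\to H_{n-1}(A)$ such that: 1) (homotopy) if $f\sim_{(J,\times)}g:X\to Y$ then $f$ and $g$ induce the same map in homology; 2) (excision) for every interior cover $\{A,B\}$ of $X$, the inclusion $(B,A\cap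 B)\to(X,A)$ induces isomorphisms $H_n(B,A\cap B)\cong H_n(X,A)$ for all $n$; 3) (dimension) if $X$ is the one-point space then $H_n(X,\emptyset)=0$ for all $n\ge1$; 4) (long exact sequence) each pair $(X,A)$ induces, via the inclusions $A\to X$ and $(X,\emptyset)\to(X,A)$ and via $\partial$, a long exact sequence $\cdots\to H_n(A)\to H_n(X)\to H_n(X,A)\to H_{n-1}(A)\to\cdots$. *)

theory Defs
  imports "HOL-Homology.Homology"
begin

section \<open>Closure spaces\<close>

text \<open>The closure operator is only meaningful on subsets of the carrier \<open>pts X\<close>; no condition
  constrains it elsewhere, and nothing below depends on it elsewhere.\<close>

record 'a cspace =
  pts :: "'a set"
  cl :: "'a set \<Rightarrow> 'a set"

definition closure_space :: "'a cspace \<Rightarrow> bool" where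
  "closure_space X \<longleftrightarrow>
     cl X {} = {} \<and>
     (\<forall>A. A \<subseteq> pts X \<longrightarrow> A \<subseteq> cl X A \<and> cl X A \<subseteq> pts X) \<and>
     (\<forall>A B. A \<subseteq> pts X \<longrightarrow> B \<subseteq> pts X \<longrightarrow> cl X (A \<union> B) = cl X A \<union> cl X B)"

definition subspace :: "'a cspace \<Rightarrow> 'a set \<Rightarrow> 'a cspace" where
  "subspace X A = \<lparr>pts = A, cl = (\<lambda>B. cl X B \<inter> A)\<rparr>"

definition cinterior :: "'a cspace \<Rightarrow> 'a set \<Rightarrow> 'a set" where
  "cinterior X A = pts X - cl X (pts X - A)"

definition nbhd :: "'a cspace \<Rightarrow> 'a \<Rightarrow> 'a set \<Rightarrow> bool" where
  "nbhd X x V \<longleftrightarrow> V \<subseteq> pts X \<and> x \<in> cinterior X V"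

definition interior_cover :: "'a cspace \<Rightarrow> 'a set set \<Rightarrow> bool" where
  "interior_cover X \<U> \<longleftrightarrow> (\<forall>U\<in>\<U>. U \<subseteq> pts X) \<and> pts X = (\<Union>U\<in>\<U>. cinterior X U)"

definition cont :: "'a cspace \<Rightarrow> 'b cspace \<Rightarrow> ('a \<Rightarrow> 'b) \<Rightarrow> bool" where
  "cont X Y f \<longleftrightarrow> f ` pts X \<subseteq> pts Y \<and> (\<forall>A. A \<subseteq> pts X \<longrightarrow> f ` cl X A \<subseteq> cl Y (f ` A))"

definition pair_map ::
  "'a cspace \<Rightarrow> 'a set \<Rightarrow> 'b cspace \<Rightarrow> 'b set \<Rightarrow> ('a \<Rightarrow> 'b) \<Rightarrow> bool" where
  "pair_map X A Y B f \<longleftrightarrow> cont X Y f \<and> f ` A \<subseteq> B"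

definition space_pair :: "'a cspace \<Rightarrow> 'a set \<Rightarrow> bool" where
  "space_pair X A \<longleftrightarrow> closure_space X \<and> A \<subseteq> pts X"

definition top_cspace :: "'a topology \<Rightarrow> 'a cspace" where
  "top_cspace T = \<lparr>pts = topspace T, cl = (\<lambda>A. T closure_of A)\<rparr>"

definition indiscrete_cspace :: "'a set \<Rightarrow> 'a cspace" where
  "indiscrete_cspace S = \<lparr>pts = S, cl = (\<lambda>A. if A = {} then {} else S)\<rparr>"

definition up_cspace :: "'a::linorder set \<Rightarrow> 'a cspace" where
  "up_cspace S = \<lparr>pts = S, cl = (\<lambda>A. {j \<in> S. \<exists>i\<in>A. i \<le> j})\<rparr>"

text \<open>In a closure space a point lies in the closure of \<open>A\<close> iff each of its neighborhoods,
  equivalently each member of a neighborhood base, meets \<open>A\<close>; the two product closures below are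
  the ones determined in this way by the bases of product neighborhoods.\<close>

definition cprod :: "'a cspace \<Rightarrow> 'b cspace \<Rightarrow> ('a \<times> 'b) cspace" where
  "cprod X Y =
     \<lparr>pts = pts X \<times> pts Y,
      cl = (\<lambda>A. {(x, y). x \<in> pts X \<and> y \<in> pts Y \<and>
                  (\<forall>U V. nbhd X x U \<longrightarrow> nbhd Y y V \<longrightarrow> (U \<times> V) \<inter> A \<noteq> {})})\<rparr>"

text \<open>The \<open>n\<close>-fold product, with coordinates indexed by \<open>1, ..., n\<close>.\<close>

definition cpower :: "'a cspace \<Rightarrow> nat \<Rightarrow> (nat \<Rightarrow> 'a) cspace" where
  "cpower J n =
     \<lparr>pts = {1..n} \<rightarrow>\<^sub>E pts J,
      cl = (\<lambda>A. {x \<in> {1..n} \<rightarrow>\<^sub>E pts J.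
                  \<forall>U. (\<forall>i\<in>{1..n}. nbhd J (x i) (U i)) \<longrightarrow> Pi\<^sub>E {1..n} U \<inter> A \<noteq> {}})\<rparr>"

definition J_I :: "real cspace" where
  "J_I = top_cspace (top_of_set {0..1})"

definition J_1 :: "real cspace" where
  "J_1 = indiscrete_cspace {0, 1}"

definition J_plus :: "real cspace" where
  "J_plus = up_cspace {0, 1}"

definition one_step_homotopic ::
  "real cspace \<Rightarrow> 'a cspace \<Rightarrow> 'b cspace \<Rightarrow> ('a \<Rightarrow> 'b) \<Rightarrow> ('a \<Rightarrow> 'b) \<Rightarrow> bool" where
  "one_step_homotopic J X Y f g \<longleftrightarrow>
     cont X Y f \<and> cont X Y g \<and>
     (\<exists>H. cont (cprod X J) Y H \<and> (\<forall>x\<in>pts X. H (x, 0) = f x \<and> H (x, 1) = g x))"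

definition homotopic ::
  "real cspace \<Rightarrow> 'a cspace \<Rightarrow> 'b cspace \<Rightarrow> ('a \<Rightarrow> 'b) \<Rightarrow> ('a \<Rightarrow> 'b) \<Rightarrow> bool" where
  "homotopic J X Y f g \<longleftrightarrow> cont X Y f \<and> cont X Y g \<and> equivclp (one_step_homotopic J X Y) f g"


section \<open>Chain complexes\<close>

text \<open>Complexes are concentrated in nonnegative degrees: \<open>bdry C n\<close> maps degree \<open>n\<close> to degree
  \<open>n - 1\<close> and is only used for \<open>n \<ge> 1\<close>. Groups are written multiplicatively.\<close>

record 'g chain_cx =
  grp :: "nat \<Rightarrow> 'g monoid"
  bdry :: "nat \<Rightarrow> 'g \<Rightarrow> 'g"

definition cycles :: "'g chain_cx \<Rightarrow> nat \<Rightarrow> 'g set" where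
  "cycles C n =
     (if n = 0 then carrier (grp C 0) else kernel (grp C n) (grp C (n - 1)) (bdry C n))"

definition boundaries :: "'g chain_cx \<Rightarrow> nat \<Rightarrow> 'g set" where
  "boundaries C n = bdry C (Suc n) ` carrier (grp C (Suc n))"

definition homology :: "'g chain_cx \<Rightarrow> nat \<Rightarrow> 'g set monoid" where
  "homology C n = (grp C n)\<lparr>carrier := cycles C n\<rparr> Mod boundaries C n"

text \<open>The map \<open>G Mod M \<rightarrow> H Mod N\<close> induced by a homomorphism \<open>h : G \<rightarrow> H\<close> with \<open>h M \<subseteq> N\<close>:
  it sends the coset of \<open>x\<close> to the coset of \<open>h x\<close>.\<close>

definition quot_map :: "'h monoid \<Rightarrow> 'h set \<Rightarrow> ('g \<Rightarrow> 'h) \<Rightarrow> 'g set \<Rightarrow> 'h set" where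
  "quot_map H N h K = N <#>\<^bsub>H\<^esub> (h ` K)"

definition quot_cx :: "'g chain_cx \<Rightarrow> (nat \<Rightarrow> 'g set) \<Rightarrow> 'g set chain_cx" where
  "quot_cx C S =
     \<lparr>grp = (\<lambda>n. grp C n Mod S n),
      bdry = (\<lambda>n. quot_map (grp C (n - 1)) (S (n - 1)) (bdry C n))\<rparr>"


section \<open>Relative homology of a functor from closure spaces to chain complexes\<close>

text \<open>Such a functor is given by complexes \<open>C X\<close> and chain maps \<open>m n Y f\<close>, the degree \<open>n\<close> part of
  the map \<open>C X \<rightarrow> C Y\<close> induced by \<open>f : X \<rightarrow> Y\<close> (for the functors below its formula does not
  depend on \<open>X\<close>). A functor is a polymorphic constant, so its instances at different point types
  are passed as separate arguments.\<close>

type_synonym ('a, 'g) cx_obj = "'a cspace \<Rightarrow> 'g chain_cx"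
type_synonym ('a, 'g, 'b, 'h) cx_map = "nat \<Rightarrow> 'b cspace \<Rightarrow> ('a \<Rightarrow> 'b) \<Rightarrow> 'g \<Rightarrow> 'h"

text \<open>The image of \<open>C A \<rightarrow> C X\<close>.\<close>

definition sub_chains ::
  "('a, 'g) cx_obj \<Rightarrow> ('a, 'g, 'a, 'g) cx_map \<Rightarrow> 'a cspace \<Rightarrow> 'a set \<Rightarrow> nat \<Rightarrow> 'g set" where
  "sub_chains C m X A n = m n X id ` carrier (grp (C (subspace X A)) n)"

definition rel_cx ::
  "('a, 'g) cx_obj \<Rightarrow> ('a, 'g, 'a, 'g) cx_map \<Rightarrow> 'a cspace \<Rightarrow> 'a set \<Rightarrow> 'g set chain_cx" where
  "rel_cx C m X A = quot_cx (C X) (sub_chains C m X A)"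

definition rel_homology ::
  "('a, 'g) cx_obj \<Rightarrow> ('a, 'g, 'a, 'g) cx_map \<Rightarrow>
   nat \<Rightarrow> 'a cspace \<Rightarrow> 'a set \<Rightarrow> 'g set set monoid" where
  "rel_homology C m n X A = homology (rel_cx C m X A) n"

definition rel_hom_map ::
  "('b, 'h) cx_obj \<Rightarrow> ('b, 'h, 'b, 'h) cx_map \<Rightarrow> ('a, 'g, 'b, 'h) cx_map \<Rightarrow>
   nat \<Rightarrow> 'b cspace \<Rightarrow> 'b set \<Rightarrow> ('a \<Rightarrow> 'b) \<Rightarrow> 'g set set \<Rightarrow> 'h set set" where
  "rel_hom_map C m m' n Y B f =
     quot_map (grp (rel_cx C m Y B) n) (boundaries (rel_cx C m Y B) n)
       (quot_map (grp (C Y) n) (sub_chains C m Y B n) (m' n Y f))"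

text \<open>The homology class in \<open>H\<^sub>n(X,A)\<close> of a chain \<open>z\<close> of \<open>X\<close> (a cycle modulo \<open>A\<close>).\<close>

definition rel_class ::
  "('a, 'g) cx_obj \<Rightarrow> ('a, 'g, 'a, 'g) cx_map \<Rightarrow>
   nat \<Rightarrow> 'a cspace \<Rightarrow> 'a set \<Rightarrow> 'g \<Rightarrow> 'g set set" where
  "rel_class C m n X A z =
     boundaries (rel_cx C m X A) n #>\<^bsub>grp (rel_cx C m X A) n\<^esub>
       (sub_chains C m X A n #>\<^bsub>grp (C X) n\<^esub> z)"

text \<open>The connecting homomorphism from \<open>H\<^sub>n\<^sub>+\<^sub>1(X,A)\<close> to \<open>H\<^sub>n(A)\<close>: the class of \<open>z\<close> is sent to the
  class of the chain \<open>a\<close> of \<open>A\<close> whose image in \<open>C X\<close> is the boundary of \<open>z\<close>.\<close>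

definition connecting ::
  "('a, 'g) cx_obj \<Rightarrow> ('a, 'g, 'a, 'g) cx_map \<Rightarrow>
   nat \<Rightarrow> 'a cspace \<Rightarrow> 'a set \<Rightarrow> 'g set set \<Rightarrow> 'g set set" where
  "connecting C m n X A K =
     (THE L. \<exists>z \<in> carrier (grp (C X) (Suc n)). \<exists>a \<in> carrier (grp (C (subspace X A)) n).
        bdry (C X) (Suc n) z = m n X id a \<and>
        K = rel_class C m (Suc n) X A z \<and>
        L = rel_class C m n (subspace X A) {} a)"


section \<open>Singular simplices\<close>

text \<open>A simplicial model consists of the spaces \<open>\<Delta> n\<close> and the face inclusions
  \<open>d i : \<Delta> (n - 1) \<rightarrow> \<Delta> n\<close>, whose formulas do not depend on \<open>n\<close>. Singular simplices are made
  extensional so that each map on \<open>\<Delta> n\<close> is represented by exactly one HOL function.\<close>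

definition simplex_I :: "nat \<Rightarrow> (nat \<Rightarrow> real) cspace" where
  "simplex_I n = top_cspace (subtopology (powertop_real UNIV) (standard_simplex n))"

definition simplex_1 :: "nat \<Rightarrow> nat cspace" where
  "simplex_1 n = indiscrete_cspace {0..n}"

definition simplex_plus :: "nat \<Rightarrow> nat cspace" where
  "simplex_plus n = up_cspace {0..n}"

definition face_I :: "nat \<Rightarrow> (nat \<Rightarrow> real) \<Rightarrow> (nat \<Rightarrow> real)" where
  "face_I i = simplical_face i"

definition face_vertex :: "nat \<Rightarrow> nat \<Rightarrow> nat" where
  "face_vertex i j = (if j < i then j else Suc j)"

definition sing_simplices :: "(nat \<Rightarrow> 's cspace) \<Rightarrow> 'a cspace \<Rightarrow> nat \<Rightarrow> ('s \<Rightarrow> 'a) set" where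
  "sing_simplices \<Delta> X n = {\<sigma>. \<sigma> \<in> extensional (pts (\<Delta> n)) \<and> cont (\<Delta> n) X \<sigma>}"

definition simplicial_cx ::
  "(nat \<Rightarrow> 's cspace) \<Rightarrow> (nat \<Rightarrow> 's \<Rightarrow> 's) \<Rightarrow> ('a, ('s \<Rightarrow> 'a) \<Rightarrow>\<^sub>0 int) cx_obj" where
  "simplicial_cx \<Delta> d X =
     \<lparr>grp = (\<lambda>n. free_Abelian_group (sing_simplices \<Delta> X n)),
      bdry = (\<lambda>n. frag_extend (\<lambda>\<sigma>. \<Sum>i=0..n.
        frag_cmul ((-1) ^ i) (frag_of (compose (pts (\<Delta> (n - 1))) \<sigma> (d i)))))\<rparr>"

definition simplicial_map ::
  "(nat \<Rightarrow> 's cspace) \<Rightarrow> ('a, ('s \<Rightarrow> 'a) \<Rightarrow>\<^sub>0 int, 'b, ('s \<Rightarrow> 'b) \<Rightarrow>\<^sub>0 int) cx_map" where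
  "simplicial_map \<Delta> n Y f = frag_extend (\<lambda>\<sigma>. frag_of (compose (pts (\<Delta> n)) f \<sigma>))"


section \<open>Singular cubes\<close>

definition sing_cubes :: "real cspace \<Rightarrow> 'a cspace \<Rightarrow> nat \<Rightarrow> ((nat \<Rightarrow> real) \<Rightarrow> 'a) set" where
  "sing_cubes J X n = {\<sigma>. \<sigma> \<in> extensional (pts (cpower J n)) \<and> cont (cpower J n) X \<sigma>}"

definition degenerate_cubes ::
  "real cspace \<Rightarrow> 'a cspace \<Rightarrow> nat \<Rightarrow> ((nat \<Rightarrow> real) \<Rightarrow> 'a) set" where
  "degenerate_cubes J X n =
     {\<sigma> \<in> sing_cubes J X n. \<exists>i\<in>{1..n}. \<forall>x\<in>pts (cpower J n). \<forall>y\<in>pts (cpower J n).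
        (\<forall>j. j \<noteq> i \<longrightarrow> x j = y j) \<longrightarrow> \<sigma> x = \<sigma> y}"

definition insert_coord :: "nat \<Rightarrow> 'a \<Rightarrow> (nat \<Rightarrow> 'a) \<Rightarrow> nat \<Rightarrow> 'a" where
  "insert_coord i t x = (\<lambda>j. if j < i then x j else if j = i then t else x (j - 1))"

definition cube_face ::
  "real cspace \<Rightarrow> nat \<Rightarrow> nat \<Rightarrow> real \<Rightarrow> ((nat \<Rightarrow> real) \<Rightarrow> 'a) \<Rightarrow> (nat \<Rightarrow> real) \<Rightarrow> 'a" where
  "cube_face J n i t \<sigma> = compose (pts (cpower J (n - 1))) \<sigma> (insert_coord i t)"

definition cube_cx :: "real cspace \<Rightarrow> ('a, ((nat \<Rightarrow> real) \<Rightarrow> 'a) \<Rightarrow>\<^sub>0 int) cx_obj" where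
  "cube_cx J X =
     \<lparr>grp = (\<lambda>n. free_Abelian_group (sing_cubes J X n)),
      bdry = (\<lambda>n. frag_extend (\<lambda>\<sigma>. \<Sum>i=1..n.
        frag_cmul ((-1) ^ i) (frag_of (cube_face J n i 0 \<sigma>) - frag_of (cube_face J n i 1 \<sigma>))))\<rparr>"

definition degenerate_chains ::
  "real cspace \<Rightarrow> 'a cspace \<Rightarrow> nat \<Rightarrow> (((nat \<Rightarrow> real) \<Rightarrow> 'a) \<Rightarrow>\<^sub>0 int) set" where
  "degenerate_chains J X n = generate (grp (cube_cx J X) n) (frag_of ` degenerate_cubes J X n)"

definition cubical_cx :: "real cspace \<Rightarrow> ('a, (((nat \<Rightarrow> real) \<Rightarrow> 'a) \<Rightarrow>\<^sub>0 int) set) cx_obj" where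
  "cubical_cx J X = quot_cx (cube_cx J X) (degenerate_chains J X)"

definition cubical_map ::
  "real cspace \<Rightarrow> ('a, (((nat \<Rightarrow> real) \<Rightarrow> 'a) \<Rightarrow>\<^sub>0 int) set,
                  'b, (((nat \<Rightarrow> real) \<Rightarrow> 'b) \<Rightarrow>\<^sub>0 int) set) cx_map" where
  "cubical_map J n Y f =
     quot_map (grp (cube_cx J Y) n) (degenerate_chains J Y n)
       (frag_extend (\<lambda>\<sigma>. frag_of (compose (pts (cpower J n)) f \<sigma>)))"


section \<open>Homology theories\<close>

type_synonym ('a, 'g) pair_groups = "nat \<Rightarrow> 'a cspace \<Rightarrow> 'a set \<Rightarrow> 'g monoid"
type_synonym ('a, 'g, 'b, 'h) pair_maps =
  "nat \<Rightarrow> 'a cspace \<Rightarrow> 'a set \<Rightarrow> 'b cspace \<Rightarrow> 'b set \<Rightarrow> ('a \<Rightarrow> 'b) \<Rightarrow> 'g \<Rightarrow> 'h"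
type_synonym ('a, 'g) pair_conn = "nat \<Rightarrow> 'a cspace \<Rightarrow> 'a set \<Rightarrow> 'g \<Rightarrow> 'g"

text \<open>A functor defined on the closure spaces over all types is a polymorphic constant, which
  cannot be quantified inside a formula. The axioms therefore take its instances as separate
  arguments: \<open>Ha, Hb, Hc\<close> are the groups of pairs with points in \<open>'a, 'b, 'c\<close>, \<open>Mab\<close> are the maps
  induced by maps of pairs from \<open>'a\<close> to \<open>'b\<close> etc., and \<open>bda n X A\<close> is the connecting map from
  \<open>Ha (n + 1) X A\<close> to \<open>Ha n (subspace X A) {}\<close>. They are meant to be applied to instances of one and
  the same polymorphic constant at three arbitrary types.\<close>

definition functor_objects :: "('a, 'g) pair_groups \<Rightarrow> bool" where
  "functor_objects Ha \<longleftrightarrow> (\<forall>n X A. space_pair X A \<longrightarrow> comm_group (Ha n X A))"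

text \<open>The last clause says that the induced map depends only on the restriction of the HOL
  function to the points of the source.\<close>

definition functor_morphisms ::
  "('a, 'g) pair_groups \<Rightarrow> ('b, 'h) pair_groups \<Rightarrow> ('a, 'g, 'b, 'h) pair_maps \<Rightarrow> bool" where
  "functor_morphisms Ha Hb Mab \<longleftrightarrow>
     (\<forall>n X A Y B f. space_pair X A \<longrightarrow> space_pair Y B \<longrightarrow> pair_map X A Y B f \<longrightarrow>
        Mab n X A Y B f \<in> hom (Ha n X A) (Hb n Y B) \<and>
        (\<forall>g. (\<forall>x\<in>pts X. g x = f x) \<longrightarrow>
           (\<forall>u\<in>carrier (Ha n X A). Mab n X A Y B g u = Mab n X A Y B f u)))"

definition functor_identity ::
  "('a, 'g) pair_groups \<Rightarrow> ('a, 'g, 'a, 'g) pair_maps \<Rightarrow> bool" where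
  "functor_identity Ha Maa \<longleftrightarrow>
     (\<forall>n X A. space_pair X A \<longrightarrow> (\<forall>u\<in>carrier (Ha n X A). Maa n X A X A id u = u))"

definition functor_composition ::
  "('a, 'g) pair_groups \<Rightarrow> ('a, 'g, 'b, 'h) pair_maps \<Rightarrow> ('b, 'h, 'c, 'k) pair_maps \<Rightarrow>
   ('a, 'g, 'c, 'k) pair_maps \<Rightarrow> bool" where
  "functor_composition Ha Mab Mbc Mac \<longleftrightarrow>
     (\<forall>n X A Y B Z D f g.
        space_pair X A \<longrightarrow> space_pair Y B \<longrightarrow> space_pair Z D \<longrightarrow>
        pair_map X A Y B f \<longrightarrow> pair_map Y B Z D g \<longrightarrow>
        (\<forall>u\<in>carrier (Ha n X A). Mac n X A Z D (g \<circ> f) u = Mbc n Y B Z D g (Mab n X A Y B f u)))"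

definition connecting_natural ::
  "('a, 'g) pair_groups \<Rightarrow> ('a, 'g, 'b, 'h) pair_maps \<Rightarrow>
   ('a, 'g) pair_conn \<Rightarrow> ('b, 'h) pair_conn \<Rightarrow> bool" where
  "connecting_natural Ha Mab bda bdb \<longleftrightarrow>
     (\<forall>n X A. space_pair X A \<longrightarrow> bda n X A \<in> hom (Ha (Suc n) X A) (Ha n (subspace X A) {})) \<and>
     (\<forall>n X A Y B f. space_pair X A \<longrightarrow> space_pair Y B \<longrightarrow> pair_map X A Y B f \<longrightarrow>
        (\<forall>u\<in>carrier (Ha (Suc n) X A).
           bdb n Y B (Mab (Suc n) X A Y B f u) =
           Mab n (subspace X A) {} (subspace Y B) {} f (bda n X A u)))"

definition homotopy_axiom ::
  "real cspace \<Rightarrow> ('a, 'g) pair_groups \<Rightarrow> ('a, 'g, 'b, 'h) pair_maps \<Rightarrow> bool" where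
  "homotopy_axiom J Ha Mab \<longleftrightarrow>
     (\<forall>n X Y f g. closure_space X \<longrightarrow> closure_space Y \<longrightarrow> homotopic J X Y f g \<longrightarrow>
        (\<forall>u\<in>carrier (Ha n X {}). Mab n X {} Y {} f u = Mab n X {} Y {} g u))"

definition excision_axiom ::
  "('a, 'g) pair_groups \<Rightarrow> ('a, 'g, 'a, 'g) pair_maps \<Rightarrow> bool" where
  "excision_axiom Ha Maa \<longleftrightarrow>
     (\<forall>n X A B. closure_space X \<longrightarrow> interior_cover X {A, B} \<longrightarrow>
        Maa n (subspace X B) (A \<inter> B) X A id \<in> iso (Ha n (subspace X B) (A \<inter> B)) (Ha n X A))"

definition dimension_axiom :: "('a, 'g) pair_groups \<Rightarrow> bool" where
  "dimension_axiom Ha \<longleftrightarrow>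
     (\<forall>n X x. closure_space X \<longrightarrow> pts X = {x} \<longrightarrow> n \<ge> 1 \<longrightarrow> trivial_group (Ha n X {}))"

text \<open>Homology is indexed by nonnegative degrees, so the sequence of a pair ends with
  \<open>H\<^sub>0(A) \<rightarrow> H\<^sub>0(X) \<rightarrow> H\<^sub>0(X,A) \<rightarrow> 0\<close>. The clauses are exactness at \<open>H\<^sub>n(X)\<close>,
  at \<open>H\<^sub>n\<^sub>+\<^sub>1(X,A)\<close>, at \<open>H\<^sub>n(A)\<close> and at \<open>H\<^sub>0(X,A)\<close>.\<close>

definition exactness_axiom ::
  "('a, 'g) pair_groups \<Rightarrow> ('a, 'g, 'a, 'g) pair_maps \<Rightarrow> ('a, 'g) pair_conn \<Rightarrow> bool" where
  "exactness_axiom Ha Maa bda \<longleftrightarrow>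
     (\<forall>X A. space_pair X A \<longrightarrow>
        (let i = (\<lambda>n. Maa n (subspace X A) {} X {} id); j = (\<lambda>n. Maa n X {} X A id) in
          (\<forall>n. i n ` carrier (Ha n (subspace X A) {}) = kernel (Ha n X {}) (Ha n X A) (j n)) \<and>
          (\<forall>n. j (Suc n) ` carrier (Ha (Suc n) X {}) =
                 kernel (Ha (Suc n) X A) (Ha n (subspace X A) {}) (bda n X A)) \<and>
          (\<forall>n. bda n X A ` carrier (Ha (Suc n) X A) =
                 kernel (Ha n (subspace X A) {}) (Ha n X {}) (i n)) \<and>
          j 0 ` carrier (Ha 0 X {}) = carrier (Ha 0 X A)))"

definition homology_theory ::
  "real cspace \<Rightarrow>
   ('a, 'g) pair_groups \<Rightarrow> ('b, 'h) pair_groups \<Rightarrow> ('c, 'k) pair_groups \<Rightarrow>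
   ('a, 'g, 'a, 'g) pair_maps \<Rightarrow> ('a, 'g, 'b, 'h) pair_maps \<Rightarrow>
   ('b, 'h, 'c, 'k) pair_maps \<Rightarrow> ('a, 'g, 'c, 'k) pair_maps \<Rightarrow>
   ('a, 'g) pair_conn \<Rightarrow> ('b, 'h) pair_conn \<Rightarrow> bool" where
  "homology_theory J Ha Hb Hc Maa Mab Mbc Mac bda bdb \<longleftrightarrow>
     functor_objects Ha \<and> functor_objects Hb \<and> functor_objects Hc \<and>
     functor_morphisms Ha Ha Maa \<and> functor_morphisms Ha Hb Mab \<and>
     functor_morphisms Hb Hc Mbc \<and> functor_morphisms Ha Hc Mac \<and>
     functor_identity Ha Maa \<and> functor_composition Ha Mab Mbc Mac \<and>
     connecting_natural Ha Mab bda bdb \<and>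
     homotopy_axiom J Ha Mab \<and> excision_axiom Ha Maa \<and> dimension_axiom Ha \<and>
     exactness_axiom Ha Maa bda"


section \<open>The homology groups of closure spaces\<close>

definition simp_H ::
  "(nat \<Rightarrow> 's cspace) \<Rightarrow> (nat \<Rightarrow> 's \<Rightarrow> 's) \<Rightarrow>
   ('a, (('s \<Rightarrow> 'a) \<Rightarrow>\<^sub>0 int) set set) pair_groups" where
  "simp_H \<Delta> d = rel_homology (simplicial_cx \<Delta> d) (simplicial_map \<Delta>)"

definition simp_map ::
  "(nat \<Rightarrow> 's cspace) \<Rightarrow> (nat \<Rightarrow> 's \<Rightarrow> 's) \<Rightarrow>
   ('a, (('s \<Rightarrow> 'a) \<Rightarrow>\<^sub>0 int) set set, 'b, (('s \<Rightarrow> 'b) \<Rightarrow>\<^sub>0 int) set set) pair_maps" where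
  "simp_map \<Delta> d n X A Y B f =
     rel_hom_map (simplicial_cx \<Delta> d) (simplicial_map \<Delta>) (simplicial_map \<Delta>) n Y B f"

definition simp_conn ::
  "(nat \<Rightarrow> 's cspace) \<Rightarrow> (nat \<Rightarrow> 's \<Rightarrow> 's) \<Rightarrow>
   ('a, (('s \<Rightarrow> 'a) \<Rightarrow>\<^sub>0 int) set set) pair_conn" where
  "simp_conn \<Delta> d = connecting (simplicial_cx \<Delta> d) (simplicial_map \<Delta>)"

definition cub_H ::
  "real cspace \<Rightarrow> ('a, (((nat \<Rightarrow> real) \<Rightarrow> 'a) \<Rightarrow>\<^sub>0 int) set set set) pair_groups" where
  "cub_H J = rel_homology (cubical_cx J) (cubical_map J)"

definition cub_map ::
  "real cspace \<Rightarrow>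
   ('a, (((nat \<Rightarrow> real) \<Rightarrow> 'a) \<Rightarrow>\<^sub>0 int) set set set,
    'b, (((nat \<Rightarrow> real) \<Rightarrow> 'b) \<Rightarrow>\<^sub>0 int) set set set) pair_maps" where
  "cub_map J n X A Y B f =
     rel_hom_map (cubical_cx J) (cubical_map J) (cubical_map J) n Y B f"

definition cub_conn ::
  "real cspace \<Rightarrow> ('a, (((nat \<Rightarrow> real) \<Rightarrow> 'a) \<Rightarrow>\<^sub>0 int) set set set) pair_conn" where
  "cub_conn J = connecting (cubical_cx J) (cubical_map J)"

end

theory Submission
  imports Defs
begin

text \<open>
  Up to isomorphism, a relative homology group is a quotient of a group of chains of \<open>X\<close>: cycles
  modulo boundaries, chains of \<open>A\<close> and degenerate chains. With representatives chosen in this way,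
  functoriality, the connecting homomorphism and exactness are formal consequences of the fact
  that chains of \<open>A\<close> are the chains of \<open>X\<close> with image in \<open>A\<close>.

  Homotopy invariance comes from a prism operator; the prism over a simplex is triangulated by the
  same combinatorial formulas in all three models, and for cubes it is itself a cube. Cubes in a
  point are degenerate, and simplices in a point have boundary \<open>0\<close> or a simplex in turn.

  For excision it suffices that the chains of \<open>X\<close> modulo the small ones, those carried by \<open>A\<close> or by
  \<open>B\<close>, form an acyclic complex. For \<open>J_1\<close> and \<open>J_plus\<close> every simplex and every cube has a point all
  of whose neighborhoods are the whole model, so it is already small. For \<open>J_I\<close> one subdivides: the
  barycentric subdivision of the library applies because its operators do not refer to a topology
  of \<open>X\<close>, and a cube is subdivided by halving its coordinates one after the other. A closure
  operator that is not idempotent causes no difficulty, since only the neighborhoods pulled back to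
  the compact model are used.
\<close>

section \<open>Presentations of abelian groups\<close>

text \<open>The cubical groups are quotients of quotients of quotients, and nested cosets are
  unpleasant to compute with. Every group is therefore tied to one free group of chains, where a
  further quotient only enlarges the set of chains counted as zero. Two choices keep these sets
  simple. Relative and degenerate chains are given by generators, so that sums of subgroups become
  unions of generating sets and intersections become intersections. And degeneracy of a cube is a
  property of the function alone, so that the same degenerate generators serve \<open>X\<close>,
  \<open>A\<close> and \<open>B\<close>. Together they give the step on which excision rests: a
  chain of \<open>B\<close> that vanishes modulo \<open>A\<close> also vanishes modulo
  \<open>A \<inter> B\<close>. Acyclicity modulo small chains enters there twice, in degree
  \<open>n\<close> for surjectivity and in degree \<open>n + 1\<close> for injectivity. For
  simplices the identities about subdivision hold exactly, whereas the cubical homotopy has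
  degenerate cubes among its faces; the abstract subdivision argument therefore asks for its
  identities only modulo degenerate chains.\<close>

definition add_subgroup :: "'q::ab_group_add set \<Rightarrow> bool" where
  "add_subgroup Q \<longleftrightarrow> 0 \<in> Q \<and> (\<forall>x\<in>Q. \<forall>y\<in>Q. x - y \<in> Q)"

lemma add_subgroup_zero: "add_subgroup Q \<Longrightarrow> 0 \<in> Q"
  and add_subgroup_diff: "add_subgroup Q \<Longrightarrow> x \<in> Q \<Longrightarrow> y \<in> Q \<Longrightarrow> x - y \<in> Q"
  by (auto simp: add_subgroup_def)

lemma add_subgroup_minus: "add_subgroup Q \<Longrightarrow> x \<in> Q \<Longrightarrow> - x \<in> Q"
  by (metis add_subgroup_def diff_0)

lemma add_subgroup_add: "add_subgroup Q \<Longrightarrow> x \<in> Q \<Longrightarrow> y \<in> Q \<Longrightarrow> x + y \<in> Q"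
  by (metis add_subgroup_diff add_subgroup_minus diff_minus_eq_add)

text \<open>Iterated quotient groups are handled through representatives: \<open>p\<close> identifies \<open>G\<close> with the
  additive group \<open>Q\<close> modulo \<open>K\<close>, so that all calculations take place in \<open>Q\<close>.\<close>

definition pres :: "'g monoid \<Rightarrow> 'q::ab_group_add set \<Rightarrow> 'q set \<Rightarrow> ('q \<Rightarrow> 'g) \<Rightarrow> bool" where
  "pres G Q K p \<longleftrightarrow> comm_group G \<and> add_subgroup Q \<and> carrier G = p ` Q \<and>
     (\<forall>x\<in>Q. \<forall>y\<in>Q. p (x + y) = p x \<otimes>\<^bsub>G\<^esub> p y) \<and>
     (\<forall>x\<in>Q. \<forall>y\<in>Q. p x = p y \<longleftrightarrow> x - y \<in> K)"

lemma presD: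
  assumes "pres G Q K p"
  shows "comm_group G" "add_subgroup Q" "carrier G = p ` Q"
    "\<And>x y. x \<in> Q \<Longrightarrow> y \<in> Q \<Longrightarrow> p (x + y) = p x \<otimes>\<^bsub>G\<^esub> p y"
    "\<And>x y. x \<in> Q \<Longrightarrow> y \<in> Q \<Longrightarrow> p x = p y \<longleftrightarrow> x - y \<in> K"
    "\<And>x. x \<in> Q \<Longrightarrow> p x \<in> carrier G"
  using assms by (auto simp: pres_def)

lemma pres_zero:
  assumes "pres G Q K p" shows "p 0 = \<one>\<^bsub>G\<^esub>"
proof -
  interpret comm_group G using assms by (rule presD)
  have "0 \<in> Q" using presD(2)[OF assms] by (rule add_subgroup_zero)
  then have "p 0 \<otimes>\<^bsub>G\<^esub> p 0 = p 0" "p 0 \<in> carrier G"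
    using presD(4)[OF assms, of 0 0] presD(6)[OF assms] by auto
  then show ?thesis by (metis r_cancel_one')
qed

lemma pres_minus:
  assumes "pres G Q K p" "x \<in> Q" shows "p (- x) = inv\<^bsub>G\<^esub> p x"
proof -
  interpret comm_group G using assms(1) by (rule presD)
  have "- x \<in> Q" using presD(2)[OF assms(1)] assms(2) by (rule add_subgroup_minus)
  then show ?thesis
    using presD(4)[OF assms(1), of "-x" x] presD(6)[OF assms(1)] assms pres_zero[OF assms(1)]
    by (metis inv_equality left_minus)
qed

lemma pres_diff:
  assumes "pres G Q K p" "x \<in> Q" "y \<in> Q"
  shows "p (x - y) = p x \<otimes>\<^bsub>G\<^esub> inv\<^bsub>G\<^esub> p y"
  using presD(4)[OF assms(1,2), of "-y"] pres_minus[OF assms(1,3)]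
    add_subgroup_minus[OF presD(2)[OF assms(1)] assms(3)] by simp

lemma pres_eq_one:
  assumes "pres G Q K p" "x \<in> Q"
  shows "p x = \<one>\<^bsub>G\<^esub> \<longleftrightarrow> x \<in> K"
  using presD(5)[OF assms(1,2), of 0] pres_zero[OF assms(1)]
    add_subgroup_zero[OF presD(2)[OF assms(1)]] by simp

lemma pres_subgroup:
  assumes "pres G Q K p" "W \<subseteq> Q" "add_subgroup W"
  shows "subgroup (p ` W) G"
proof -
  interpret comm_group G using assms(1) by (rule presD)
  show ?thesis
  proof (rule subgroupI)
    show "p ` W \<subseteq> carrier G" using assms presD(3) by blast
    show "p ` W \<noteq> {}" using assms(3) add_subgroup_zero by blast
    show "inv\<^bsub>G\<^esub> a \<in> p ` W" if "a \<in> p ` W" for a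
    proof -
      obtain x where "a = p x" "x \<in> W" using \<open>a \<in> p ` W\<close> by auto
      then have "inv\<^bsub>G\<^esub> a = p (- x)" using pres_minus[OF assms(1), of x] assms(2) by auto
      then show ?thesis using add_subgroup_minus[OF assms(3) \<open>x \<in> W\<close>] by simp
    qed
    show "a \<otimes>\<^bsub>G\<^esub> b \<in> p ` W" if "a \<in> p ` W" "b \<in> p ` W" for a b
    proof -
      obtain x y where xy: "a = p x" "x \<in> W" "b = p y" "y \<in> W" using \<open>a \<in> p ` W\<close> \<open>b \<in> p ` W\<close> by auto
      then have "a \<otimes>\<^bsub>G\<^esub> b = p (x + y)" using presD(4)[OF assms(1), of x y] assms(2) subsetD by metis
      then show ?thesis using add_subgroup_add[OF assms(3) xy(2,4)] by simp
    qed
  qed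
qed

text \<open>Dividing by the image of \<open>W\<close> leaves the representatives \<open>Q\<close>
  alone and replaces \<open>K\<close> by \<open>W + K\<close>, so repeated quotients stay presented
  by the same chains. The new kernel set may reach outside \<open>Q\<close>; this is harmless,
  because \<open>pres\<close> tests membership only for differences of elements of
  \<open>Q\<close>.\<close>

lemma pres_Mod:
  assumes "pres G Q K p" "W \<subseteq> Q" "add_subgroup W"
  shows "pres (G Mod p ` W) Q {x. \<exists>w\<in>W. x - w \<in> K} (\<lambda>x. p ` W #>\<^bsub>G\<^esub> p x)"
proof -
  interpret comm_group G using assms(1) by (rule presD)
  have sub: "subgroup (p ` W) G" using assms by (rule pres_subgroup)
  then interpret N: normal "p ` W" G by (rule subgroup_imp_normal)
  have Q: "add_subgroup Q" using assms(1) by (rule presD)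
  have eq: "p ` W #>\<^bsub>G\<^esub> p x = p ` W #>\<^bsub>G\<^esub> p y \<longleftrightarrow> (\<exists>w\<in>W. x - y - w \<in> K)" if "x \<in> Q" "y \<in> Q" for x y
  proof -
    have c: "p x \<in> carrier G" "p y \<in> carrier G" using that presD(6)[OF assms(1)] by auto
    have "p ` W #>\<^bsub>G\<^esub> p x = p ` W #>\<^bsub>G\<^esub> p y \<longleftrightarrow> p x \<in> p ` W #>\<^bsub>G\<^esub> p y"
      using c sub repr_independence rcos_self by metis
    also have "\<dots> \<longleftrightarrow> p x \<otimes>\<^bsub>G\<^esub> inv\<^bsub>G\<^esub> p y \<in> p ` W"
      using c N.rcos_module is_group by blast
    also have "\<dots> \<longleftrightarrow> (\<exists>w\<in>W. p (x - y) = p w)"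
      using pres_diff[OF assms(1) that] by auto
    also have "\<dots> \<longleftrightarrow> (\<exists>w\<in>W. x - y - w \<in> K)"
      using presD(5)[OF assms(1)] add_subgroup_diff[OF Q that] assms(2) by blast
    finally show ?thesis .
  qed
  have "comm_group (G Mod p ` W)"
    using abelian_FactGroup[OF sub] .
  then show ?thesis
    using Q eq presD(3,4,6)[OF assms(1)] N.rcos_sum
    by (auto simp: pres_def carrier_FactGroup image_image)
qed

text \<open>Passing to a subgroup shrinks the representatives and keeps the kernel set. This is the
  step from chains to cycles, where \<open>K\<close> may reach outside \<open>W\<close>.\<close>

lemma pres_restrict:
  assumes "pres G Q K p" "W \<subseteq> Q" "add_subgroup W" "U = p ` W"
  shows "pres (G\<lparr>carrier := U\<rparr>) W K p"
proof -
  interpret comm_group G using assms(1) by (rule presD)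
  have "comm_group (G\<lparr>carrier := U\<rparr>)"
  proof (rule group.group_comm_groupI)
    show "group (G\<lparr>carrier := U\<rparr>)"
      using pres_subgroup[OF assms(1-3)] subgroup_imp_group assms(4) by blast
    show "x \<otimes>\<^bsub>G\<lparr>carrier := U\<rparr>\<^esub> y = y \<otimes>\<^bsub>G\<lparr>carrier := U\<rparr>\<^esub> x"
      if "x \<in> carrier (G\<lparr>carrier := U\<rparr>)" "y \<in> carrier (G\<lparr>carrier := U\<rparr>)" for x y
      using that subgroup.subset[OF pres_subgroup[OF assms(1-3)]] assms(4)
      by (simp add: m_comm subset_iff)
  qed
  then show ?thesis
    using assms by (auto simp: pres_def subset_iff)
qed

text \<open>\<open>quot_map\<close> multiplies the image of a coset by the subgroup. Since
  \<open>h'\<close> sends \<open>W\<close> into \<open>W'\<close>, the image elements differ from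
  \<open>p' (h' x)\<close> by members of that subgroup, which absorbs them, and one coset remains.
  The maps induced on quotients below are evaluated through this rule.\<close>

lemma quot_map_coset:
  assumes G: "pres G Q K p" and H: "pres H Q' K' p'"
    and W: "W \<subseteq> Q" "add_subgroup W" "W' \<subseteq> Q'" "add_subgroup W'"
    and h: "\<And>x. x \<in> Q \<Longrightarrow> h (p x) = p' (h' x)"
    and add: "\<And>x y. h' (x + y) = h' x + h' y"
    and Q': "\<And>x. x \<in> Q \<Longrightarrow> h' x \<in> Q'" and W': "\<And>x. x \<in> W \<Longrightarrow> h' x \<in> W'"
    and x: "x \<in> Q"
  shows "quot_map H (p' ` W') h (p ` W #>\<^bsub>G\<^esub> p x) = p' ` W' #>\<^bsub>H\<^esub> p' (h' x)"
proof -
  interpret comm_group H using H by (rule presD)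
  have sub: "subgroup (p' ` W') H" using H W(3,4) by (rule pres_subgroup)
  have Qs: "add_subgroup Q" using G by (rule presD)
  have "h ` (p ` W #>\<^bsub>G\<^esub> p x) = (\<lambda>w. p' (h' w) \<otimes>\<^bsub>H\<^esub> p' (h' x)) ` W"
  proof -
    have "h (p w \<otimes>\<^bsub>G\<^esub> p x) = p' (h' w) \<otimes>\<^bsub>H\<^esub> p' (h' x)" if "w \<in> W" for w
    proof -
      have "w \<in> Q" using that W by auto
      then have "h (p w \<otimes>\<^bsub>G\<^esub> p x) = p' (h' (w + x))"
        using presD(4)[OF G] x h add_subgroup_add[OF Qs] by metis
      then show ?thesis using presD(4)[OF H] Q' x \<open>w \<in> Q\<close> add by metis
    qed
    then show ?thesis by (force simp: r_coset_def)
  qed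
  moreover have "p' ` W' <#>\<^bsub>H\<^esub> (\<lambda>w. p' (h' w) \<otimes>\<^bsub>H\<^esub> p' (h' x)) ` W = p' ` W' #>\<^bsub>H\<^esub> p' (h' x)"
  proof -
    have c: "p' (h' x) \<in> carrier H" using Q' x presD(6)[OF H] by auto
    have cw: "p' w \<in> carrier H" if "w \<in> W'" for w using W(3) that presD(6)[OF H] by auto
    have "p' ` W' #>\<^bsub>H\<^esub> (p' (h' w) \<otimes>\<^bsub>H\<^esub> p' (h' x)) = p' ` W' #>\<^bsub>H\<^esub> p' (h' x)" if "w \<in> W" for w
    proof -
      have "p' (h' w) \<in> p' ` W'" using W' that by auto
      then show ?thesis
        using sub c cw subgroup.rcos_const[OF sub is_group] coset_mult_assoc[of "p' ` W'" "p' (h' w)" "p' (h' x)"]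
        by (metis W' subgroup.subset that)
    qed
    moreover have "p' ` W' <#>\<^bsub>H\<^esub> (\<lambda>w. p' (h' w) \<otimes>\<^bsub>H\<^esub> p' (h' x)) ` W
        = (\<Union>w\<in>W. p' ` W' #>\<^bsub>H\<^esub> (p' (h' w) \<otimes>\<^bsub>H\<^esub> p' (h' x)))"
      by (auto simp: set_mult_def r_coset_def)
    \<comment> \<open>Without an element of \<open>W\<close> the union of cosets would be empty
      rather than a single coset.\<close>
    moreover have "W \<noteq> {}" using W(2) add_subgroup_zero by auto
    ultimately show ?thesis by auto
  qed
  ultimately show ?thesis by (simp add: quot_map_def)
qed

lemma pres_hom:
  assumes G: "pres G Q K p" and H: "pres H Q' K' p'"
    and h: "\<And>x. x \<in> Q \<Longrightarrow> h (p x) = p' (h' x)" and Q': "\<And>x. x \<in> Q \<Longrightarrow> h' x \<in> Q'"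
    and add: "\<And>x y. h' (x + y) = h' x + h' y"
  shows "h \<in> hom G H"
proof (rule homI)
  have Qs: "add_subgroup Q" using G by (rule presD)
  show "h x \<in> carrier H" if "x \<in> carrier G" for x
    using that presD(3)[OF G] h Q' presD(6)[OF H] by auto
  fix x y assume "x \<in> carrier G" "y \<in> carrier G"
  then obtain a b where "a \<in> Q" "b \<in> Q" "x = p a" "y = p b" using presD(3)[OF G] by auto
  then show "h (x \<otimes>\<^bsub>G\<^esub> y) = h x \<otimes>\<^bsub>H\<^esub> h y"
    using presD(4)[OF G] presD(4)[OF H] h Q' add add_subgroup_add[OF Qs] by metis
qed

section \<open>Closure spaces\<close>

lemma closure_spaceD:
  assumes "closure_space X"
  shows "cl X {} = {}" "A \<subseteq> pts X \<Longrightarrow> A \<subseteq> cl X A" "A \<subseteq> pts X \<Longrightarrow> cl X A \<subseteq> pts X"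
    "A \<subseteq> pts X \<Longrightarrow> B \<subseteq> pts X \<Longrightarrow> cl X (A \<union> B) = cl X A \<union> cl X B"
  using assms by (auto simp: closure_space_def)

lemma cl_mono: "closure_space X \<Longrightarrow> A \<subseteq> B \<Longrightarrow> B \<subseteq> pts X \<Longrightarrow> cl X A \<subseteq> cl X B"
  by (metis closure_spaceD(4) le_iff_sup order_trans)

lemma pts_subspace [simp]: "pts (subspace X A) = A"
  by (simp add: subspace_def)

lemma subspace_subspace: "A \<subseteq> B \<Longrightarrow> subspace (subspace X B) A = subspace X A"
  by (auto simp: subspace_def fun_eq_iff)

lemma closure_space_subspace:
  assumes "closure_space X" "A \<subseteq> pts X" shows "closure_space (subspace X A)"
proof -
  have "cl X (B \<union> C) = cl X B \<union> cl X C" "B \<subseteq> cl X B" if "B \<subseteq> A" "C \<subseteq> A" for B C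
    using that assms closure_spaceD[OF assms(1)] by (meson order_trans)+
  then show ?thesis
    using closure_spaceD(1)[OF assms(1)] by (auto simp: closure_space_def subspace_def)
qed

lemma space_pair_subspace: "space_pair X A \<Longrightarrow> closure_space (subspace X A)"
  by (simp add: space_pair_def closure_space_subspace)

lemma cont_image: "cont X Y f \<Longrightarrow> f ` pts X \<subseteq> pts Y"
  by (simp add: cont_def)

lemma cont_id: "cont X X id"
  by (simp add: cont_def)

lemma cont_compose:
  assumes "cont X Y f" "cont Y Z g" shows "cont X Z (g \<circ> f)"
  unfolding cont_def image_comp[symmetric]
proof (intro conjI allI impI)
  show "g ` f ` pts X \<subseteq> pts Z"
    using assms[THEN cont_image] by blast
  fix A assume "A \<subseteq> pts X"
  then have "f ` cl X A \<subseteq> cl Y (f ` A)" "f ` A \<subseteq> pts Y"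
    using assms(1) by (auto simp: cont_def)
  then show "g ` f ` cl X A \<subseteq> cl Z (g ` f ` A)"
    using assms(2) unfolding cont_def by (meson image_mono order_trans)
qed

text \<open>Continuity evaluates \<open>f\<close> on closures of subsets of the carrier; these stay
  in the carrier by the closure space axioms, so changing \<open>f\<close> elsewhere has no effect.
  This justifies replacing maps by extensional functions.\<close>

lemma cont_cong:
  assumes "closure_space X" "\<And>x. x \<in> pts X \<Longrightarrow> f x = g x"
  shows "cont X Y f \<longleftrightarrow> cont X Y g"
proof -
  have "f ` A = g ` A" if "A \<subseteq> pts X" for A using that assms(2) by (force simp: image_def)
  then show ?thesis
    using closure_spaceD(3)[OF assms(1)] unfolding cont_def by (metis order_refl)
qed

text \<open>The subspace closure only adds the demand that images of closures lie in
  \<open>A\<close>, and this follows from the image of the whole carrier lying in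
  \<open>A\<close>.\<close>

lemma cont_into_subspace:
  assumes "closure_space X" "A \<subseteq> pts Y"
  shows "cont X (subspace Y A) f \<longleftrightarrow> cont X Y f \<and> f ` pts X \<subseteq> A"
proof -
  have "f ` cl X B \<subseteq> f ` pts X" if "B \<subseteq> pts X" for B
    using closure_spaceD(3)[OF assms(1) that] by blast
  moreover have "cont X (subspace Y A) f \<longleftrightarrow>
      f ` pts X \<subseteq> A \<and> (\<forall>B. B \<subseteq> pts X \<longrightarrow> f ` cl X B \<subseteq> cl Y (f ` B) \<and> f ` cl X B \<subseteq> A)"
    by (simp add: cont_def subspace_def)
  ultimately show ?thesis
    unfolding cont_def using assms(2) by (meson order_trans)
qed

lemma cont_inclusion: "cont (subspace X A) X id" if "A \<subseteq> pts X"
  using that by (auto simp: cont_def subspace_def)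

lemma pair_map_subspace:
  assumes "pair_map X A Y B f" "space_pair X A" "space_pair Y B"
  shows "cont (subspace X A) (subspace Y B) f"
proof -
  have "cont (subspace X A) Y (f \<circ> id)"
    using assms by (intro cont_compose[OF cont_inclusion]) (auto simp: pair_map_def space_pair_def)
  moreover have "f ` A \<subseteq> B" "B \<subseteq> pts Y" using assms by (auto simp: pair_map_def space_pair_def)
  ultimately show ?thesis
    using cont_into_subspace[OF space_pair_subspace[OF assms(2)], of B Y f] by simp
qed

section \<open>Neighborhoods and continuity at a point\<close>

lemma cl_iff_nbhd:
  assumes "closure_space X" "A \<subseteq> pts X" "x \<in> pts X"
  shows "x \<in> cl X A \<longleftrightarrow> (\<forall>V. nbhd X x V \<longrightarrow> V \<inter> A \<noteq> {})"
proof
  assume x: "x \<in> cl X A"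
  show "\<forall>V. nbhd X x V \<longrightarrow> V \<inter> A \<noteq> {}"
  proof (intro allI impI notI)
    fix V assume V: "nbhd X x V" "V \<inter> A = {}"
    then have "cl X A \<subseteq> cl X (pts X - V)"
      using assms by (intro cl_mono) auto
    then show False using x V by (auto simp: nbhd_def cinterior_def)
  qed
next
  assume R: "\<forall>V. nbhd X x V \<longrightarrow> V \<inter> A \<noteq> {}"
  have "(pts X - A) \<inter> A = {}" by blast
  then have "\<not> nbhd X x (pts X - A)" using R by blast
  then show "x \<in> cl X A"
    using assms by (simp add: nbhd_def cinterior_def double_diff)
qed

lemma nbhd_Int:
  assumes "closure_space X" "nbhd X x U" "nbhd X x V" shows "nbhd X x (U \<inter> V)"
  using assms closure_spaceD(4)[OF assms(1), of "pts X - U" "pts X - V"]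
  by (auto simp: nbhd_def cinterior_def Diff_Int)

lemma nbhd_pts: "closure_space X \<Longrightarrow> x \<in> pts X \<Longrightarrow> nbhd X x (pts X)"
  by (simp add: nbhd_def cinterior_def closure_spaceD)

lemma nbhd_self: "closure_space X \<Longrightarrow> nbhd X x U \<Longrightarrow> x \<in> U"
  using closure_spaceD(2)[of X "pts X - U"] by (auto simp: nbhd_def cinterior_def)

lemma nbhd_in_pts: "nbhd X x U \<Longrightarrow> x \<in> pts X \<and> U \<subseteq> pts X"
  by (auto simp: nbhd_def cinterior_def)

lemma nbhd_mono:
  assumes "closure_space X" "nbhd X x U" "U \<subseteq> V" "V \<subseteq> pts X" shows "nbhd X x V"
  using assms cl_mono[OF assms(1), of "pts X - V" "pts X - U"]
  by (auto simp: nbhd_def cinterior_def)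

lemma nbhd_INT:
  assumes "closure_space X" "x \<in> pts X" "finite I" "\<And>i. i \<in> I \<Longrightarrow> nbhd X x (U i)"
  shows "nbhd X x (pts X \<inter> (\<Inter>i\<in>I. U i))"
  using assms(3,4)
proof (induction I rule: finite_induct)
  case empty
  then show ?case using nbhd_pts assms by auto
next
  case (insert i I)
  then have "nbhd X x (U i \<inter> (pts X \<inter> (\<Inter>i\<in>I. U i)))"
    using nbhd_Int[OF assms(1)] by auto
  then show ?case by (simp add: Int_left_commute)
qed

text \<open>If the preimage of \<open>V\<close> is not a neighborhood of \<open>x\<close>, then
  \<open>x\<close> lies in the closure of the complementary points, whose images avoid
  \<open>V\<close>. The converse tests closures through neighborhoods. Products are given by
  neighborhood bases, so this form carries the later continuity proofs.\<close>

lemma cont_iff_nbhd: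
  assumes X: "closure_space X" and Y: "closure_space Y"
  shows "cont X Y f \<longleftrightarrow> f ` pts X \<subseteq> pts Y \<and>
           (\<forall>x\<in>pts X. \<forall>V. nbhd Y (f x) V \<longrightarrow> nbhd X x {z \<in> pts X. f z \<in> V})"
proof (intro iffI conjI ballI allI impI)
  fix x V assume f: "cont X Y f" and x: "x \<in> pts X" and V: "nbhd Y (f x) V"
  let ?A = "pts X - {z \<in> pts X. f z \<in> V}"
  have "x \<notin> cl X ?A"
  proof
    assume "x \<in> cl X ?A"
    then have "f x \<in> cl Y (f ` ?A)" using f unfolding cont_def by blast
    moreover have "cl Y (f ` ?A) \<subseteq> cl Y (pts Y - V)"
      using cont_image[OF f] by (intro cl_mono Y) auto
    ultimately show False using V by (auto simp: nbhd_def cinterior_def)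
  qed
  then show "nbhd X x {z \<in> pts X. f z \<in> V}"
    using x by (auto simp: nbhd_def cinterior_def)
next
  assume f: "f ` pts X \<subseteq> pts Y \<and> (\<forall>x\<in>pts X. \<forall>V. nbhd Y (f x) V \<longrightarrow> nbhd X x {z \<in> pts X. f z \<in> V})"
  show "cont X Y f"
    unfolding cont_def
  proof (intro conjI allI impI subsetI; (elim imageE)?)
    fix A y x assume A: "A \<subseteq> pts X" and y: "y = f x" "x \<in> cl X A"
    have x: "x \<in> pts X" using A y closure_spaceD(3)[OF X] by blast
    have "f x \<in> cl Y (f ` A)"
    proof (subst cl_iff_nbhd[OF Y])
      show "f ` A \<subseteq> pts Y" "f x \<in> pts Y" using f A x by auto
      show "\<forall>V. nbhd Y (f x) V \<longrightarrow> V \<inter> f ` A \<noteq> {}"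
      proof (intro allI impI)
        fix V assume "nbhd Y (f x) V"
        then have "nbhd X x {z \<in> pts X. f z \<in> V}" using f x by blast
        then have "{z \<in> pts X. f z \<in> V} \<inter> A \<noteq> {}" using cl_iff_nbhd[OF X A x] y by blast
        then show "V \<inter> f ` A \<noteq> {}" by blast
      qed
    qed
    then show "y \<in> cl Y (f ` A)" using y by simp
  qed (use f in auto)
qed (auto dest: cont_image)

section \<open>Products and powers of closure spaces\<close>

lemma pts_cprod [simp]: "pts (cprod X Y) = pts X \<times> pts Y"
  by (simp add: cprod_def)

lemma pts_cpower [simp]: "pts (cpower J n) = {1..n} \<rightarrow>\<^sub>E pts J"
  by (simp add: cpower_def)

text \<open>Additivity of the closure is where the base must be directed: base sets missing
  \<open>A\<close> and \<open>B\<close> respectively contain a common base set missing the union.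
  The second claim intersects with \<open>P\<close> because base sets may stick out of the
  carrier.\<close>

lemma closure_space_of_base:
  assumes base: "\<forall>x\<in>P. N x \<noteq> {}"
    and self: "\<forall>x\<in>P. \<forall>U\<in>N x. x \<in> U"
    and Int: "\<forall>x\<in>P. \<forall>U\<in>N x. \<forall>V\<in>N x. \<exists>W\<in>N x. W \<subseteq> U \<inter> V"
    and X: "pts X = P" "cl X = (\<lambda>A. {x \<in> P. \<forall>U\<in>N x. U \<inter> A \<noteq> {}})"
  shows "closure_space X"
    and "V \<subseteq> P \<Longrightarrow> nbhd X x V \<longleftrightarrow> x \<in> P \<and> (\<exists>U\<in>N x. U \<inter> P \<subseteq> V)"
proof -
  have "x \<in> cl X A \<or> x \<in> cl X B" if x: "x \<in> cl X (A \<union> B)" for x A B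
  proof (rule ccontr)
    assume n: "\<not> ?thesis"
    have P: "x \<in> P" and AB: "\<forall>U\<in>N x. U \<inter> (A \<union> B) \<noteq> {}" using x unfolding X(2) by auto
    obtain U where U: "U \<in> N x" "U \<inter> A = {}" using n P unfolding X(2) by blast
    obtain V where V: "V \<in> N x" "V \<inter> B = {}" using n P unfolding X(2) by blast
    obtain W where "W \<in> N x" "W \<subseteq> U \<inter> V" using Int P U(1) V(1) by blast
    then show False using AB U(2) V(2) by blast
  qed
  moreover have "cl X A \<union> cl X B \<subseteq> cl X (A \<union> B)" for A B unfolding X(2) by blast
  ultimately have "cl X (A \<union> B) = cl X A \<union> cl X B" for A B by blast
  moreover have "cl X {} = {}" using base unfolding X(2) by auto
  moreover have "A \<subseteq> cl X A" if "A \<subseteq> P" for A using self that unfolding X(2) by blast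
  moreover have "cl X A \<subseteq> P" for A unfolding X(2) by blast
  ultimately show "closure_space X"
    unfolding closure_space_def X(1) by blast
  show "V \<subseteq> P \<Longrightarrow> nbhd X x V \<longleftrightarrow> x \<in> P \<and> (\<exists>U\<in>N x. U \<inter> P \<subseteq> V)"
    using X by (auto simp: nbhd_def cinterior_def)
qed

lemma
  assumes X: "closure_space X" and Y: "closure_space Y"
  shows closure_space_cprod: "closure_space (cprod X Y)"
    and nbhd_cprod: "nbhd (cprod X Y) (x, y) W \<longleftrightarrow> W \<subseteq> pts X \<times> pts Y \<and> 
       (\<exists>U V. nbhd X x U \<and> nbhd Y y V \<and> U \<times> V \<subseteq> W)"
proof -
  let ?N = "\<lambda>z. {U \<times> V |U V. nbhd X (fst z) U \<and> nbhd Y (snd z) V}"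
  have 1: "\<forall>z\<in>pts X \<times> pts Y. ?N z \<noteq> {}"
  proof
    fix z assume "z \<in> pts X \<times> pts Y"
    then have "nbhd X (fst z) (pts X)" "nbhd Y (snd z) (pts Y)"
      using nbhd_pts X Y by auto
    then show "?N z \<noteq> {}" by blast
  qed
  have 2: "z \<in> U" if "z \<in> pts X \<times> pts Y" "U \<in> ?N z" for z U
    using nbhd_self[OF X, of "fst z"] nbhd_self[OF Y, of "snd z"] that by (auto simp: mem_Times_iff)
  have 3: "\<exists>W\<in>?N z. W \<subseteq> U \<inter> V" if z: "z \<in> pts X \<times> pts Y" "U \<in> ?N z" "V \<in> ?N z" for z U V
  proof -
    obtain U1 U2 V1 V2 where "U = U1 \<times> U2" "V = V1 \<times> V2" "nbhd X (fst z) U1" "nbhd X (fst z) V1"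
      "nbhd Y (snd z) U2" "nbhd Y (snd z) V2" using z(2,3) by blast
    then have "nbhd X (fst z) (U1 \<inter> V1)" "nbhd Y (snd z) (U2 \<inter> V2)" "(U1 \<inter> V1) \<times> (U2 \<inter> V2) \<subseteq> U \<inter> V"
      using nbhd_Int[OF X] nbhd_Int[OF Y] by auto
    then show ?thesis by blast
  qed
  have 4: "cl (cprod X Y) = (\<lambda>A. {z \<in> pts X \<times> pts Y. \<forall>U\<in>?N z. U \<inter> A \<noteq> {}})"
  proof -
    have "(\<forall>W\<in>{U \<times> V |U V. P U \<and> R V}. W \<inter> A \<noteq> {}) \<longleftrightarrow> (\<forall>U V. P U \<longrightarrow> R V \<longrightarrow> (U \<times> V) \<inter> A \<noteq> {})"
      for P R and A :: "('a \<times> 'b) set" by blast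
    note eq = this
    show ?thesis
      unfolding eq cprod_def cspace.simps
    proof (rule ext, goal_cases)
      case (1 A)
      show ?case by (rule Set.set_eqI) (simp add: mem_Times_iff split: prod.split)
    qed
  qed
  have 5: "\<forall>z\<in>pts X \<times> pts Y. \<forall>U\<in>?N z. z \<in> U"
    using 2 by (intro ballI)
  have 6: "\<forall>z\<in>pts X \<times> pts Y. \<forall>U\<in>?N z. \<forall>V\<in>?N z. \<exists>W\<in>?N z. W \<subseteq> U \<inter> V" by (intro ballI 3)
  note * = closure_space_of_base[of "pts X \<times> pts Y" ?N, OF 1 5 6 pts_cprod 4]
  show "closure_space (cprod X Y)" by (rule *(1))
  show "nbhd (cprod X Y) (x, y) W \<longleftrightarrow> W \<subseteq> pts X \<times> pts Y \<and> 
       (\<exists>U V. nbhd X x U \<and> nbhd Y y V \<and> U \<times> V \<subseteq> W)" (is "?L \<longleftrightarrow> ?R")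
  proof
    assume L: ?L
    then have W: "W \<subseteq> pts X \<times> pts Y" using nbhd_in_pts[OF L] by simp
    then obtain U V where "nbhd X x U" "nbhd Y y V" "U \<times> V \<inter> pts X \<times> pts Y \<subseteq> W"
      using *(2)[OF W, of "(x, y)"] L by auto
    moreover have "U \<times> V \<subseteq> pts X \<times> pts Y" using calculation nbhd_in_pts[of X x U] nbhd_in_pts[of Y y V] by blast
    ultimately have "nbhd X x U \<and> nbhd Y y V \<and> U \<times> V \<subseteq> W" by blast
    then show ?R using W by blast
  next
    assume R: ?R
    then obtain U V where UV: "nbhd X x U" "nbhd Y y V" "U \<times> V \<subseteq> W" by auto
    then have "U \<times> V \<in> ?N (x, y)" "U \<times> V \<inter> pts X \<times> pts Y \<subseteq> W" "(x, y) \<in> pts X \<times> pts Y"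
      using nbhd_in_pts[of X x U] nbhd_in_pts[of Y y V] by auto
    then have "\<exists>U\<in>?N (x, y). U \<inter> pts X \<times> pts Y \<subseteq> W" by blast
    then show ?L using *(2)[of W "(x, y)"] R \<open>(x, y) \<in> pts X \<times> pts Y\<close> by blast
  qed
qed

text \<open>The preimage of a product neighborhood contains the intersection of two preimages, which
  is again a neighborhood.\<close>

lemma cont_Pair:
  assumes "closure_space Z" "closure_space X" "closure_space Y" "cont Z X f" "cont Z Y g"
  shows "cont Z (cprod X Y) (\<lambda>z. (f z, g z))"
  unfolding cont_iff_nbhd[OF assms(1) closure_space_cprod[OF assms(2,3)]]
proof (intro conjI ballI allI impI)
  show "(\<lambda>z. (f z, g z)) ` pts Z \<subseteq> pts (cprod X Y)"
    using assms(4,5)[THEN cont_image] by auto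
  fix z W assume z: "z \<in> pts Z" and "nbhd (cprod X Y) (f z, g z) W"
  then obtain U V where UV: "nbhd X (f z) U" "nbhd Y (g z) V" "U \<times> V \<subseteq> W"
    using nbhd_cprod[OF assms(2,3)] by blast
  have "nbhd Z z ({x \<in> pts Z. f x \<in> U} \<inter> {x \<in> pts Z. g x \<in> V})"
    using assms UV z by (intro nbhd_Int) (auto simp: cont_iff_nbhd)
  then show "nbhd Z z {x \<in> pts Z. (f x, g x) \<in> W}"
    using UV(3) by (elim nbhd_mono[OF assms(1)]) auto
qed

lemma
  assumes J: "closure_space J"
  shows closure_space_cpower: "closure_space (cpower J n)"
    and nbhd_cpower: "nbhd (cpower J n) x W \<longleftrightarrow> x \<in> pts (cpower J n) \<and> W \<subseteq> pts (cpower J n) \<and> 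
       (\<exists>U. (\<forall>i\<in>{1..n}. nbhd J (x i) (U i)) \<and> Pi\<^sub>E {1..n} U \<subseteq> W)"
proof -
  let ?P = "{1..n} \<rightarrow>\<^sub>E pts J"
  let ?N = "\<lambda>x. {Pi\<^sub>E {1..n} U |U. \<forall>i\<in>{1..n}. nbhd J (x i) (U i)}"
  have 1: "\<forall>z\<in>?P. ?N z \<noteq> {}"
  proof
    fix z assume "z \<in> ?P"
    then have "\<forall>i\<in>{1..n}. nbhd J (z i) (pts J)" using nbhd_pts[OF J] by (simp add: PiE_iff)
    then have "Pi\<^sub>E {1..n} (\<lambda>_. pts J) \<in> ?N z" by blast
    then show "?N z \<noteq> {}" by blast
  qed
  have 2: "z \<in> U" if z: "z \<in> ?P" "U \<in> ?N z" for z U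
  proof -
    obtain V where V: "U = Pi\<^sub>E {1..n} V" "\<forall>i\<in>{1..n}. nbhd J (z i) (V i)" using z(2) by blast
    then have "\<forall>i\<in>{1..n}. z i \<in> V i" using nbhd_self[OF J] by blast
    then show ?thesis using z(1) V(1) by (simp add: PiE_iff)
  qed
  have 3: "\<exists>W\<in>?N z. W \<subseteq> U \<inter> V" if z: "z \<in> ?P" "U \<in> ?N z" "V \<in> ?N z" for z U V
  proof -
    obtain U1 V1 where UV: "U = Pi\<^sub>E {1..n} U1" "V = Pi\<^sub>E {1..n} V1"
      "\<forall>i\<in>{1..n}. nbhd J (z i) (U1 i)" "\<forall>i\<in>{1..n}. nbhd J (z i) (V1 i)" using z(2,3) by blast
    then have "Pi\<^sub>E {1..n} (\<lambda>i. U1 i \<inter> V1 i) \<in> ?N z"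
      using nbhd_Int[OF J] UV(3,4) by blast
    moreover have "Pi\<^sub>E {1..n} (\<lambda>i. U1 i \<inter> V1 i) \<subseteq> U \<inter> V" using UV by (auto simp: PiE_iff)
    ultimately show ?thesis by blast
  qed
  have 4: "cl (cpower J n) = (\<lambda>A. {z \<in> ?P. \<forall>U\<in>?N z. U \<inter> A \<noteq> {}})"
  proof -
    have "(\<forall>V\<in>{g U |U. P U}. Q V) \<longleftrightarrow> (\<forall>U. P U \<longrightarrow> Q (g U))"
      for g :: "(nat \<Rightarrow> 'a set) \<Rightarrow> (nat \<Rightarrow> 'a) set" and P Q by blast
    then show ?thesis unfolding cpower_def by (simp only: cspace.simps)
  qed
  have 5: "\<forall>z\<in>?P. \<forall>U\<in>?N z. z \<in> U"
    using 2 by (intro ballI)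
  have 6: "\<forall>z\<in>?P. \<forall>U\<in>?N z. \<forall>V\<in>?N z. \<exists>W\<in>?N z. W \<subseteq> U \<inter> V" by (intro ballI 3)
  note * = closure_space_of_base[of ?P ?N, OF 1 5 6 pts_cpower 4]
  show "closure_space (cpower J n)" by (rule *(1))
  have sub: "Pi\<^sub>E {1..n} U \<subseteq> ?P" if U: "\<forall>i\<in>{1..n}. nbhd J (x i) (U i)" for U x
  proof (rule PiE_mono)
    fix i assume "i \<in> {1..n}"
    then show "U i \<subseteq> pts J" using nbhd_in_pts[of J "x i" "U i"] U by blast
  qed
  show "nbhd (cpower J n) x W \<longleftrightarrow> x \<in> pts (cpower J n) \<and> W \<subseteq> pts (cpower J n) \<and> 
       (\<exists>U. (\<forall>i\<in>{1..n}. nbhd J (x i) (U i)) \<and> Pi\<^sub>E {1..n} U \<subseteq> W)" (is "?L \<longleftrightarrow> ?R")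
  proof
    assume L: ?L
    then have W: "W \<subseteq> ?P" "x \<in> ?P" using nbhd_in_pts[OF L] by simp_all
    have "\<exists>U\<in>?N x. U \<inter> ?P \<subseteq> W" using iffD1[OF *(2)[OF W(1)] L] by (rule conjunct2)
    then obtain U where U: "\<forall>i\<in>{1..n}. nbhd J (x i) (U i)" "Pi\<^sub>E {1..n} U \<inter> ?P \<subseteq> W"
      by blast
    have "Pi\<^sub>E {1..n} U \<subseteq> W" using U(2) sub[OF U(1)] by (simp add: Int_absorb2)
    then show ?R using W U(1) unfolding pts_cpower by blast
  next
    assume R: ?R
    then obtain U where "\<forall>i\<in>{1..n}. nbhd J (x i) (U i)" "Pi\<^sub>E {1..n} U \<subseteq> W" by blast
    then have "\<exists>V\<in>?N x. V \<inter> ?P \<subseteq> W" by blast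
    then show ?L using R by (intro iffD2[OF *(2)]) auto
  qed
qed

lemma cont_coord:
  assumes "closure_space J" "i \<in> {1..n}"
  shows "cont (cpower J n) J (\<lambda>x. x i)"
  unfolding cont_iff_nbhd[OF closure_space_cpower[OF assms(1)] assms(1)]
proof (intro conjI ballI allI impI)
  show "(\<lambda>x. x i) ` pts (cpower J n) \<subseteq> pts J" using assms by auto
  fix x V assume x: "x \<in> pts (cpower J n)" and V: "nbhd J (x i) V"
  have "\<forall>j\<in>{1..n}. nbhd J (x j) (if j = i then V else pts J)"
    using V x nbhd_pts[OF assms(1)] by (auto simp: PiE_iff)
  moreover have "Pi\<^sub>E {1..n} (\<lambda>j. if j = i then V else pts J) \<subseteq> {z \<in> pts (cpower J n). z i \<in> V}"
    using assms(2) V nbhd_in_pts by (fastforce simp: PiE_iff split: if_splits)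
  ultimately show "nbhd (cpower J n) x {z \<in> pts (cpower J n). z i \<in> V}"
    using x by (auto simp: nbhd_cpower[OF assms(1)])
qed

text \<open>As for pairs, with a finite intersection; finiteness of the index set is what makes the
  preimage of a box a neighborhood.\<close>

lemma cont_cpower:
  assumes "closure_space Z" "closure_space J"
    and "\<And>i. i \<in> {1..n} \<Longrightarrow> cont Z J (\<lambda>z. f z i)" "\<And>z. z \<in> pts Z \<Longrightarrow> f z \<in> extensional {1..n}"
  shows "cont Z (cpower J n) f"
  unfolding cont_iff_nbhd[OF assms(1) closure_space_cpower[OF assms(2)]]
proof (intro conjI ballI allI impI)
  show im: "f ` pts Z \<subseteq> pts (cpower J n)"
    using assms(4) cont_image[OF assms(3)] by (fastforce simp: PiE_iff)
  fix z W assume z: "z \<in> pts Z" and W: "nbhd (cpower J n) (f z) W"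
  obtain U where U: "\<forall>i\<in>{1..n}. nbhd J (f z i) (U i)" "Pi\<^sub>E {1..n} U \<subseteq> W"
    using W[unfolded nbhd_cpower[OF assms(2)]] by blast
  have "nbhd Z z (pts Z \<inter> (\<Inter>i\<in>{1..n}. {x \<in> pts Z. f x i \<in> U i}))"
    using assms(3) U z by (intro nbhd_INT assms(1)) (auto simp: cont_iff_nbhd[OF assms(1,2)])
  then show "nbhd Z z {x \<in> pts Z. f x \<in> W}"
    using U(2) assms(4) by (elim nbhd_mono[OF assms(1)]) (auto simp: PiE_iff subset_iff)
qed

lemma cont_const:
  assumes "closure_space X" "closure_space Y" "c \<in> pts Y" shows "cont X Y (\<lambda>_. c)"
  using assms nbhd_pts nbhd_self by (fastforce simp: cont_iff_nbhd)

section \<open>The closure spaces from which the models are built\<close>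

lemma pts_top_cspace [simp]: "pts (top_cspace T) = topspace T"
  by (simp add: top_cspace_def)

lemma closure_space_top_cspace: "closure_space (top_cspace T)"
  by (auto simp: closure_space_def top_cspace_def closure_of_subset closure_of_subset_topspace
      dest: subsetD[OF closure_of_subset_topspace])

lemma cont_top_cspace: "continuous_map T T' f \<Longrightarrow> cont (top_cspace T) (top_cspace T') f"
  using continuous_map_image_subset_topspace[of T T' f]
  by (simp add: cont_def top_cspace_def continuous_map_image_closure_subset)

lemma nbhd_top_cspace: "nbhd (top_cspace T) x V \<longleftrightarrow> V \<subseteq> topspace T \<and> x \<in> T interior_of V"
  by (auto simp: nbhd_def cinterior_def top_cspace_def closure_of_complement interior_of_subset_topspace
      dest: subsetD[OF interior_of_subset_topspace])

lemma pts_up_cspace [simp]: "pts (up_cspace S) = S"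
  by (simp add: up_cspace_def)

lemma closure_space_up_cspace: "closure_space (up_cspace S)"
  by (auto simp: closure_space_def up_cspace_def)

lemma cont_up_cspace:
  assumes "mono_on S f" "f ` S \<subseteq> T" shows "cont (up_cspace S) (up_cspace T) f"
proof -
  have "\<exists>k\<in>f ` A. k \<le> f j" if "A \<subseteq> S" "j \<in> S" "i \<in> A" "i \<le> j" for A i j
    using that assms(1) by (meson imageI mono_onD subsetD)
  then show ?thesis
    using assms(2) by (auto simp: cont_def up_cspace_def)
qed

text \<open>Closures go upwards, so neighborhoods must contain everything below the point. The
  largest point therefore has only the whole space as a neighborhood, which excision for
  \<open>J_plus\<close> exploits.\<close>

lemma nbhd_up_cspace:
  "nbhd (up_cspace S) x V \<longleftrightarrow> V \<subseteq> S \<and> x \<in> S \<and> {y \<in> S. y \<le> x} \<subseteq> V"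
  by (auto simp: nbhd_def cinterior_def up_cspace_def)

lemma pts_indiscrete_cspace [simp]: "pts (indiscrete_cspace S) = S"
  by (simp add: indiscrete_cspace_def)

lemma closure_space_indiscrete_cspace: "closure_space (indiscrete_cspace S)"
  by (auto simp: closure_space_def indiscrete_cspace_def)

lemma cont_indiscrete_cspace:
  "f ` S \<subseteq> T \<Longrightarrow> cont (indiscrete_cspace S) (indiscrete_cspace T) f"
  by (auto simp: cont_def indiscrete_cspace_def)

lemma nbhd_indiscrete_cspace: "nbhd (indiscrete_cspace S) x V \<longleftrightarrow> x \<in> S \<and> V = S"
  by (auto simp: nbhd_def cinterior_def indiscrete_cspace_def)

lemma interior_cover_nbhd:
  assumes "interior_cover X {A, B}" "x \<in> pts X" shows "nbhd X x A \<or> nbhd X x B"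
  using assms by (auto simp: interior_cover_def nbhd_def)

section \<open>Chains\<close>

definition ch :: "'b set \<Rightarrow> ('b \<Rightarrow>\<^sub>0 int) set" where
  "ch U = {c. Poly_Mapping.keys c \<subseteq> U}"

lemma add_subgroup_ch: "add_subgroup (ch U)"
  using keys_diff by (fastforce simp: add_subgroup_def ch_def)

lemma zero_ch [simp]: "0 \<in> ch U"
  by (simp add: ch_def)

lemma diff_ch: "x \<in> ch U \<Longrightarrow> y \<in> ch U \<Longrightarrow> x - y \<in> ch U"
  and add_ch: "x \<in> ch U \<Longrightarrow> y \<in> ch U \<Longrightarrow> x + y \<in> ch U"
  and minus_ch: "x \<in> ch U \<Longrightarrow> - x \<in> ch U"
  using add_subgroup_ch add_subgroup_diff add_subgroup_add add_subgroup_minus by blast+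

lemma frag_of_ch [simp]: "frag_of x \<in> ch U \<longleftrightarrow> x \<in> U"
  by (simp add: ch_def)

lemma cmul_ch: "x \<in> ch U \<Longrightarrow> frag_cmul k x \<in> ch U"
  using keys_cmul by (force simp: ch_def)

lemma sum_ch: "(\<And>i. i \<in> I \<Longrightarrow> f i \<in> ch U) \<Longrightarrow> sum f I \<in> ch U"
  by (induction I rule: infinite_finite_induct) (auto intro: add_ch)

lemma ch_mono: "U \<subseteq> V \<Longrightarrow> x \<in> ch U \<Longrightarrow> x \<in> ch V"
  by (auto simp: ch_def)

lemma ch_Int: "x \<in> ch U \<Longrightarrow> x \<in> ch V \<Longrightarrow> x \<in> ch (U \<inter> V)"
  by (auto simp: ch_def)

text \<open>Splitting a chain along its support turns the sum of two subgroups into the chains on a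
  union of generators. Quotients by several subgroups can thus be written as one support
  condition.\<close>

lemma ch_Un_iff: "c \<in> ch (U \<union> V) \<longleftrightarrow> (\<exists>u\<in>ch U. c - u \<in> ch V)"
proof
  assume "c \<in> ch (U \<union> V)"
  then have "Poly_Mapping.keys c \<subseteq> U \<union> V" by (simp add: ch_def)
  then obtain d e where de: "Poly_Mapping.keys d \<subseteq> U" "Poly_Mapping.keys e \<subseteq> V" "d + e = c"
    by (rule frag_split)
  then have "c - d = e" by auto
  then show "\<exists>u\<in>ch U. c - u \<in> ch V" using de by (intro bexI[of _ d]) (simp_all add: ch_def)
next
  assume "\<exists>u\<in>ch U. c - u \<in> ch V"
  then obtain u where u: "u \<in> ch U" "c - u \<in> ch V" by blast
  then have "u + (c - u) \<in> ch (U \<union> V)"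
    by (intro add_ch) (auto elim: ch_mono[rotated])
  then show "c \<in> ch (U \<union> V)" by simp
qed

lemma ch_UnE:
  assumes "c \<in> ch (U \<union> V)" obtains u v where "u \<in> ch U" "v \<in> ch V" "c = u + v"
proof -
  obtain u where "u \<in> ch U" "c - u \<in> ch V" using assms by (auto simp: ch_Un_iff)
  then show ?thesis by (intro that[of u "c - u"]) auto
qed

lemma extend_ch:
  "c \<in> ch U \<Longrightarrow> (\<And>x. x \<in> U \<Longrightarrow> f x \<in> ch V) \<Longrightarrow> frag_extend f c \<in> ch V"
  using keys_frag_extend[of f c] by (fastforce simp: ch_def)

lemma ch_induct [consumes 1, case_names zero one diff]:
  assumes "c \<in> ch U" "P 0" "\<And>x. x \<in> U \<Longrightarrow> P (frag_of x)" "\<And>a b. P a \<Longrightarrow> P b \<Longrightarrow> P (a - b)"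
  shows "P c"
  using assms unfolding ch_def by (elim CollectE frag_induction) auto

lemma pres_free: "pres (free_Abelian_group U) (ch U) (ch {}) (\<lambda>c. c)"
  using abelian_free_Abelian_group add_subgroup_ch
  by (auto simp: pres_def ch_def free_Abelian_group_def)

section \<open>Functors to chain complexes presented by chains\<close>

text \<open>The complex of \<open>X\<close> is presented by the chains on \<open>S X\<close>, modulo those on the degenerate
  elements \<open>D\<close>, which do not depend on \<open>X\<close>.\<close>

locale chain_model =
  fixes S :: "'a cspace \<Rightarrow> nat \<Rightarrow> 'b set" and D :: "nat \<Rightarrow> 'b set"
    and bd :: "nat \<Rightarrow> ('b \<Rightarrow>\<^sub>0 int) \<Rightarrow> ('b \<Rightarrow>\<^sub>0 int)"
    and C :: "('a, 'g) cx_obj" and m :: "('a, 'g, 'a, 'g) cx_map"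
    and p :: "'a cspace \<Rightarrow> nat \<Rightarrow> ('b \<Rightarrow>\<^sub>0 int) \<Rightarrow> 'g"
  assumes bd_diff: "bd n (x - y) = bd n x - bd n y"
    and S_subspace: "space_pair X A \<Longrightarrow> S (subspace X A) n \<subseteq> S X n"
    and S_Int: "space_pair X A \<Longrightarrow> space_pair X B \<Longrightarrow>
      S (subspace X A) n \<inter> S (subspace X B) n = S (subspace X (A \<inter> B)) n"
    and S_empty: "closure_space X \<Longrightarrow> S (subspace X {}) n = {}"
    and bd_S: "closure_space X \<Longrightarrow> c \<in> ch (S X (Suc n)) \<Longrightarrow> bd (Suc n) c \<in> ch (S X n)"
    and bd_D: "c \<in> ch (D (Suc n)) \<Longrightarrow> bd (Suc n) c \<in> ch (D n)"
    and bd_bd: "closure_space X \<Longrightarrow> c \<in> ch (S X (Suc (Suc n))) \<Longrightarrow> bd (Suc n) (bd (Suc (Suc n)) c) = 0"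
    and pres_C: "closure_space X \<Longrightarrow> pres (grp (C X) n) (ch (S X n)) (ch (D n)) (p X n)"
    and bdry_p: "closure_space X \<Longrightarrow> c \<in> ch (S X (Suc n)) \<Longrightarrow>
      bdry (C X) (Suc n) (p X (Suc n) c) = p X n (bd (Suc n) c)"
    and m_p: "space_pair X A \<Longrightarrow> c \<in> ch (S (subspace X A) n) \<Longrightarrow> m n X id (p (subspace X A) n c) = p X n c"
begin

text \<open>The chains that die modulo \<open>A\<close>, degenerate ones included. The degenerate
  part is not cut down to \<open>X\<close>, so a member may fail to be a chain of
  \<open>X\<close>.\<close>

definition rel_null :: "'a cspace \<Rightarrow> 'a set \<Rightarrow> nat \<Rightarrow> ('b \<Rightarrow>\<^sub>0 int) set" where
  "rel_null X A n = ch (S (subspace X A) n \<union> D n)"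

text \<open>The quantifier over \<open>k\<close> makes the boundary condition void in degree 0,
  where every chain is a cycle.\<close>

definition rel_cyc :: "'a cspace \<Rightarrow> 'a set \<Rightarrow> nat \<Rightarrow> ('b \<Rightarrow>\<^sub>0 int) set" where
  "rel_cyc X A n = {c \<in> ch (S X n). \<forall>k. n = Suc k \<longrightarrow> bd n c \<in> rel_null X A k}"

definition rel_bdry :: "'a cspace \<Rightarrow> 'a set \<Rightarrow> nat \<Rightarrow> ('b \<Rightarrow>\<^sub>0 int) set" where
  "rel_bdry X A n = {c. \<exists>w\<in>ch (S X (Suc n)). c - bd (Suc n) w \<in> rel_null X A n}"

abbreviation \<kappa> :: "'a cspace \<Rightarrow> 'a set \<Rightarrow> nat \<Rightarrow> ('b \<Rightarrow>\<^sub>0 int) \<Rightarrow> 'g set set" where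
  "\<kappa> X A n c \<equiv> rel_class C m n X A (p X n c)"

lemma bd_0 [simp]: "bd n 0 = 0"
  using bd_diff[of n 0 0] by simp

lemma bd_minus: "bd n (- x) = - bd n x"
  using bd_diff[of n 0 x] by simp

lemma bd_add: "bd n (x + y) = bd n x + bd n y"
  using bd_diff[of n x "- y"] by (simp add: bd_minus)

lemma rel_null_diff: "x \<in> rel_null X A n \<Longrightarrow> y \<in> rel_null X A n \<Longrightarrow> x - y \<in> rel_null X A n"
  and rel_null_add: "x \<in> rel_null X A n \<Longrightarrow> y \<in> rel_null X A n \<Longrightarrow> x + y \<in> rel_null X A n"
  and rel_null_zero [simp]: "0 \<in> rel_null X A n"
  by (auto simp: rel_null_def intro: diff_ch add_ch minus_ch)

lemma S_rel_null: "c \<in> ch (S (subspace X A) n) \<Longrightarrow> c \<in> rel_null X A n"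
  and D_rel_null: "c \<in> ch (D n) \<Longrightarrow> c \<in> rel_null X A n"
  by (auto simp: rel_null_def elim: ch_mono[rotated])

lemma rcE:
  assumes "c \<in> rel_null X A n" obtains a d where "a \<in> ch (S (subspace X A) n)" "d \<in> ch (D n)" "c = a + d"
  using assms unfolding rel_null_def by (elim ch_UnE) blast

lemma rel_null_empty: "closure_space X \<Longrightarrow> rel_null X {} n = ch (D n)"
  by (simp add: rel_null_def S_empty)

lemma bd_sub: "space_pair X A \<Longrightarrow> c \<in> ch (S (subspace X A) (Suc n)) \<Longrightarrow> bd (Suc n) c \<in> ch (S (subspace X A) n)"
  using bd_S space_pair_subspace by blast

lemma sub_S: "space_pair X A \<Longrightarrow> c \<in> ch (S (subspace X A) n) \<Longrightarrow> c \<in> ch (S X n)"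
  using S_subspace ch_mono by metis

lemma add_subgroup_rel_cyc: "add_subgroup (rel_cyc X A n)"
  by (auto simp: add_subgroup_def rel_cyc_def bd_diff intro: diff_ch rel_null_diff)

lemma sub_chains_eq:
  assumes "space_pair X A" shows "sub_chains C m X A n = p X n ` ch (S (subspace X A) n)"
  using presD(3)[OF pres_C[OF space_pair_subspace[OF assms]]] m_p[OF assms]
  by (force simp: sub_chains_def image_image)

lemma pres_rel_cx:
  assumes X: "space_pair X A"
  shows "pres (grp (rel_cx C m X A) n) (ch (S X n)) (rel_null X A n)
          (\<lambda>c. sub_chains C m X A n #>\<^bsub>grp (C X) n\<^esub> p X n c)"
proof -
  have cs: "closure_space X" using X by (simp add: space_pair_def)
  have "rel_null X A n = {x. \<exists>w\<in>ch (S (subspace X A) n). x - w \<in> ch (D n)}"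
    by (auto simp: rel_null_def ch_Un_iff)
  moreover have "ch (S (subspace X A) n) \<subseteq> ch (S X n)" using sub_S[OF X] by blast
  ultimately show ?thesis
    using pres_Mod[OF pres_C[OF cs] _ add_subgroup_ch, of "S (subspace X A) n" n] X
    by (simp add: rel_cx_def quot_cx_def sub_chains_eq)
qed

lemma bdry_rel_cx:
  assumes X: "space_pair X A" and c: "c \<in> ch (S X (Suc n))"
  shows "bdry (rel_cx C m X A) (Suc n) (sub_chains C m X A (Suc n) #>\<^bsub>grp (C X) (Suc n)\<^esub> p X (Suc n) c)
    = sub_chains C m X A n #>\<^bsub>grp (C X) n\<^esub> p X n (bd (Suc n) c)"
proof -
  have cs: "closure_space X" using X by (simp add: space_pair_def)
  show ?thesis
    unfolding rel_cx_def quot_cx_def sub_chains_eq[OF X] chain_cx.simps diff_Suc_1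
    using sub_S[OF X] bd_S[OF cs] bd_sub[OF X] c
    by (intro quot_map_coset[OF pres_C[OF cs] pres_C[OF cs], where h' = "bd (Suc n)"])
       (auto simp: bd_add bdry_p[OF cs] intro: add_subgroup_ch)
qed

lemma boundary_in_rel_cyc:
  assumes X: "space_pair X A" and w: "w \<in> ch (S X (Suc n))" shows "bd (Suc n) w \<in> rel_cyc X A n"
proof -
  have cs: "closure_space X" using X by (simp add: space_pair_def)
  show ?thesis using bd_S[OF cs w] bd_bd[OF cs] w by (auto simp: rel_cyc_def)
qed

text \<open>The relative complex is presented by all chains of \<open>X\<close>; restricting to
  cycles shrinks the representatives, and dividing by boundaries enlarges the kernel to
  \<open>rel_bdry\<close>.\<close>

lemma pres_homology:
  assumes X: "space_pair X A"
  shows "pres (rel_homology C m n X A) (rel_cyc X A n) (rel_bdry X A n) (\<kappa> X A n)"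
proof -
  have cs: "closure_space X" using X by (simp add: space_pair_def)
  let ?R = "rel_cx C m X A"
  let ?\<rho> = "\<lambda>n c. sub_chains C m X A n #>\<^bsub>grp (C X) n\<^esub> p X n c"
  note pr = pres_rel_cx[OF X]
  have cyc: "cycles ?R n = ?\<rho> n ` rel_cyc X A n"
  proof (cases n)
    case 0
    then show ?thesis using presD(3)[OF pr] by (simp add: cycles_def rel_cyc_def)
  next
    case (Suc k)
    have "bdry ?R (Suc k) (?\<rho> (Suc k) c) = \<one>\<^bsub>grp ?R k\<^esub> \<longleftrightarrow> bd (Suc k) c \<in> rel_null X A k"
      if "c \<in> ch (S X (Suc k))" for c
      using pres_eq_one[OF pr bd_S[OF cs that]] bdry_rel_cx[OF X that] by simp
    then show ?thesis
      using presD(3)[OF pr] Suc by (auto simp: cycles_def kernel_def rel_cyc_def)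
  qed
  have Zsub: "rel_cyc X A n \<subseteq> ch (S X n)" by (auto simp: rel_cyc_def)
  note p1 = pres_restrict[OF pr Zsub add_subgroup_rel_cyc cyc]
  let ?W = "bd (Suc n) ` ch (S X (Suc n))"
  have W: "?W \<subseteq> rel_cyc X A n" using boundary_in_rel_cyc[OF X] by blast
  have "add_subgroup ?W"
  proof -
    have "bd (Suc n) x - bd (Suc n) y \<in> ?W" if "x \<in> ch (S X (Suc n))" "y \<in> ch (S X (Suc n))" for x y
      using that by (intro image_eqI[of _ _ "x - y"]) (auto simp: bd_diff intro: diff_ch)
    moreover have "0 \<in> ?W" by (intro image_eqI[of _ _ 0]) auto
    ultimately show ?thesis unfolding add_subgroup_def by blast
  qed
  note p2 = pres_Mod[OF p1 W this]
  have bdr: "boundaries ?R n = ?\<rho> n ` ?W"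
    using presD(3)[OF pr] bdry_rel_cx[OF X] by (force simp: boundaries_def image_image)
  have "{x. \<exists>w\<in>?W. x - w \<in> rel_null X A n} = rel_bdry X A n" by (auto simp: rel_bdry_def)
  then show ?thesis
    using p2 unfolding rel_homology_def homology_def rel_class_def bdr
    by (simp add: r_coset_def)
qed

text \<open>The boundary of \<open>z\<close> equals \<open>a\<close> only up to degenerate chains.
  That \<open>a\<close> is nevertheless a cycle of \<open>A\<close> uses that the boundary squares
  to zero and preserves degeneracy.\<close>

lemma connecting_rel_cyc:
  assumes X: "space_pair X A" and a: "a \<in> ch (S (subspace X A) n)"
    and z: "z \<in> ch (S X (Suc n))" and d: "bd (Suc n) z - a \<in> ch (D n)"
  shows "a \<in> rel_cyc (subspace X A) {} n" "z \<in> rel_cyc X A (Suc n)"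
proof -
  have cs: "closure_space X" "closure_space (subspace X A)"
    using X by (simp_all add: space_pair_def closure_space_subspace)
  show "a \<in> rel_cyc (subspace X A) {} n"
  proof (cases n)
    case (Suc k)
    have "bd (Suc k) (bd (Suc (Suc k)) z - a) \<in> ch (D k)" using d Suc bd_D by blast
    then have "bd (Suc k) a \<in> ch (D k)"
      using bd_bd[OF cs(1)] z Suc minus_ch by (fastforce simp: bd_diff)
    then show ?thesis using a Suc by (simp add: rel_cyc_def rel_null_empty cs)
  qed (use a in \<open>simp add: rel_cyc_def\<close>)
  have "bd (Suc n) z = a + (bd (Suc n) z - a)" by simp
  also have "\<dots> \<in> rel_null X A n" using a d by (intro rel_null_add S_rel_null D_rel_null)
  finally show "z \<in> rel_cyc X A (Suc n)" using z by (simp add: rel_cyc_def)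
qed

lemma ex_connecting:
  assumes "z \<in> rel_cyc X A (Suc n)"
  obtains a where "a \<in> ch (S (subspace X A) n)" "bd (Suc n) z - a \<in> ch (D n)"
proof -
  have "bd (Suc n) z \<in> rel_null X A n" using assms by (simp add: rel_cyc_def)
  then show ?thesis using that by (elim rcE) auto
qed

text \<open>The description operator in \<open>connecting\<close> needs uniqueness. Two choices of
  \<open>z\<close> differ by a boundary, a chain \<open>a2\<close> of \<open>A\<close> and a
  degenerate chain, so the two choices of \<open>a\<close> differ by the boundary of
  \<open>a2\<close> up to degenerate chains. The point is that this is a boundary in
  \<open>A\<close>, not merely in \<open>X\<close>.\<close>

lemma connecting_\<kappa>:
  assumes X: "space_pair X A" and a: "a \<in> ch (S (subspace X A) n)"
    and z: "z \<in> ch (S X (Suc n))" and d: "bd (Suc n) z - a \<in> ch (D n)"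
  shows "connecting C m n X A (\<kappa> X A (Suc n) z) = \<kappa> (subspace X A) {} n a"
proof -
  have cs: "closure_space X" "closure_space (subspace X A)" "space_pair (subspace X A) {}"
    using X by (simp_all add: space_pair_def closure_space_subspace)
  note pX = pres_C[OF cs(1)] and pA = pres_C[OF cs(2)]
  have eq: "bdry (C X) (Suc n) (p X (Suc n) z) = m n X id (p (subspace X A) n a) \<longleftrightarrow> bd (Suc n) z - a \<in> ch (D n)"
    if "z \<in> ch (S X (Suc n))" "a \<in> ch (S (subspace X A) n)" for z a
    using that presD(5)[OF pX] bd_S[OF cs(1)] sub_S[OF X] by (simp add: bdry_p cs m_p[OF X])
  show ?thesis
    unfolding connecting_def
  proof (rule the_equality)
    show "\<exists>z'\<in>carrier (grp (C X) (Suc n)). \<exists>a'\<in>carrier (grp (C (subspace X A)) n).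
       bdry (C X) (Suc n) z' = m n X id a' \<and>
       \<kappa> X A (Suc n) z = rel_class C m (Suc n) X A z' \<and>
       \<kappa> (subspace X A) {} n a = rel_class C m n (subspace X A) {} a'"
      using presD(6)[OF pX z] presD(6)[OF pA a] eq[OF z a] d by blast
  next
    fix L
    assume "\<exists>z'\<in>carrier (grp (C X) (Suc n)). \<exists>a'\<in>carrier (grp (C (subspace X A)) n).
       bdry (C X) (Suc n) z' = m n X id a' \<and>
       \<kappa> X A (Suc n) z = rel_class C m (Suc n) X A z' \<and>
       L = rel_class C m n (subspace X A) {} a'"
    then obtain z1 a1 where 1: "z1 \<in> ch (S X (Suc n))" "a1 \<in> ch (S (subspace X A) n)"
      "bd (Suc n) z1 - a1 \<in> ch (D n)" "\<kappa> X A (Suc n) z = \<kappa> X A (Suc n) z1" "L = \<kappa> (subspace X A) {} n a1"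
      using presD(3)[OF pX] presD(3)[OF pA] eq by auto
    note zz = connecting_rel_cyc[OF X a z d] connecting_rel_cyc[OF X 1(2,1,3)]
    have "z - z1 \<in> rel_bdry X A (Suc n)"
      using presD(5)[OF pres_homology[OF X]] zz 1(4) by blast
    then obtain w where w: "w \<in> ch (S X (Suc (Suc n)))" "z - z1 - bd (Suc (Suc n)) w \<in> rel_null X A (Suc n)"
      by (auto simp: rel_bdry_def)
    obtain a2 d2 where 2: "a2 \<in> ch (S (subspace X A) (Suc n))" "d2 \<in> ch (D (Suc n))"
      "z - z1 - bd (Suc (Suc n)) w = a2 + d2"
      using w(2) by (elim rcE)
    have "bd (Suc n) z - bd (Suc n) z1 = bd (Suc n) a2 + bd (Suc n) d2"
      using arg_cong[OF 2(3), of "bd (Suc n)"] bd_bd[OF cs(1) w(1)] by (simp add: bd_diff bd_add)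
    then have "a - a1 - bd (Suc n) a2 = bd (Suc n) d2 - (bd (Suc n) z - a) + (bd (Suc n) z1 - a1)"
      by (simp add: algebra_simps)
    also have "\<dots> \<in> ch (D n)" by (rule add_ch[OF diff_ch[OF bd_D[OF 2(2)] d] 1(3)])
    finally have "a - a1 \<in> rel_bdry (subspace X A) {} n"
      using 2(1) by (auto simp: rel_bdry_def rel_null_empty cs)
    then show "L = \<kappa> (subspace X A) {} n a"
      using presD(5)[OF pres_homology[OF cs(3)]] zz 1(5) by blast
  qed
qed

end

text \<open>Source and target are separate copies of \<open>chain_model\<close> because locale
  parameters are monomorphic and the point types differ. \<open>fs\<close> takes neither space as an
  argument; on chains of \<open>X\<close> it sees \<open>f\<close> only through the points of
  \<open>X\<close>, which is \<open>fs_cong\<close>.\<close>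

locale chain_model_map = A: chain_model S D bd C m p + B: chain_model S' D' bd' C' m' p'
  for S :: "'a cspace \<Rightarrow> nat \<Rightarrow> 'b set" and D bd and C :: "('a, 'g) cx_obj" and m p
    and S' :: "'c cspace \<Rightarrow> nat \<Rightarrow> 'd set" and D' bd' and C' :: "('c, 'h) cx_obj" and m' p' +
  fixes fs :: "nat \<Rightarrow> ('a \<Rightarrow> 'c) \<Rightarrow> ('b \<Rightarrow>\<^sub>0 int) \<Rightarrow> ('d \<Rightarrow>\<^sub>0 int)"
    and mf :: "('a, 'g, 'c, 'h) cx_map"
  assumes fs_diff: "fs n f (x - y) = fs n f x - fs n f y"
    and fs_S: "closure_space X \<Longrightarrow> closure_space Y \<Longrightarrow> cont X Y f \<Longrightarrow> c \<in> ch (S X n) \<Longrightarrow> fs n f c \<in> ch (S' Y n)"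
    and fs_D: "c \<in> ch (D n) \<Longrightarrow> fs n f c \<in> ch (D' n)"
    and fs_bd: "closure_space X \<Longrightarrow> c \<in> ch (S X (Suc n)) \<Longrightarrow> bd' (Suc n) (fs (Suc n) f c) = fs n f (bd (Suc n) c)"
    and fs_cong: "closure_space X \<Longrightarrow> c \<in> ch (S X n) \<Longrightarrow> (\<And>x. x \<in> pts X \<Longrightarrow> f x = g x) \<Longrightarrow> fs n f c = fs n g c"
    and mf_p: "closure_space X \<Longrightarrow> closure_space Y \<Longrightarrow> cont X Y f \<Longrightarrow> c \<in> ch (S X n) \<Longrightarrow>
      mf n Y f (p X n c) = p' Y n (fs n f c)"
begin

lemma fs_0: "fs n f 0 = 0"
  using fs_diff[of n f 0 0] by simp

lemma fs_add: "fs n f (x + y) = fs n f x + fs n f y"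
  using fs_diff[of n f x "- y"] fs_diff[of n f 0 y] by (simp add: fs_0)

lemma fs_sub:
  assumes "pair_map X A Y B f" "space_pair X A" "space_pair Y B" "c \<in> ch (S (subspace X A) n)"
  shows "fs n f c \<in> ch (S' (subspace Y B) n)"
  using fs_S[OF _ _ pair_map_subspace[OF assms(1-3)] assms(4)] assms(2,3) by (simp add: space_pair_subspace)

lemma fs_rel_null:
  assumes "pair_map X A Y B f" "space_pair X A" "space_pair Y B" "c \<in> A.rel_null X A n"
  shows "fs n f c \<in> B.rel_null Y B n"
  using assms(4)
  by (rule A.rcE) (use B.S_rel_null[OF fs_sub[OF assms(1-3)]] B.D_rel_null[OF fs_D] B.rel_null_add in \<open>simp add: fs_add\<close>)

lemma fs_rel_cyc:
  assumes "pair_map X A Y B f" "space_pair X A" "space_pair Y B" "c \<in> A.rel_cyc X A n"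
  shows "fs n f c \<in> B.rel_cyc Y B n"
  using assms fs_S[of X Y f c n] fs_rel_null[OF assms(1-3)] fs_bd[of X]
  by (auto simp: A.rel_cyc_def B.rel_cyc_def space_pair_def pair_map_def)

text \<open>\<open>rel_hom_map\<close> nests two quotient maps; each collapses to a coset by
  \<open>quot_map_coset\<close>, so on classes the induced map is \<open>fs\<close> applied to
  representatives.\<close>

lemma rel_hom_map_\<kappa>:
  assumes f: "pair_map X A Y B f" "space_pair X A" "space_pair Y B" and c: "c \<in> A.rel_cyc X A n"
  shows "rel_hom_map C' m' mf n Y B f (A.\<kappa> X A n c) = B.\<kappa> Y B n (fs n f c)"
proof -
  have cs: "closure_space X" "closure_space Y" "cont X Y f"
    using f by (auto simp: space_pair_def pair_map_def)
  have sX: "ch (S (subspace X A) n) \<subseteq> ch (S X n)" and sY: "ch (S' (subspace Y B) n) \<subseteq> ch (S' Y n)"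
    using A.sub_S[OF f(2)] B.sub_S[OF f(3)] by auto
  let ?\<rho>A = "\<lambda>c. sub_chains C m X A n #>\<^bsub>grp (C X) n\<^esub> p X n c"
  let ?\<rho>B = "\<lambda>c. sub_chains C' m' Y B n #>\<^bsub>grp (C' Y) n\<^esub> p' Y n c"
  let ?h = "quot_map (grp (C' Y) n) (sub_chains C' m' Y B n) (mf n Y f)"
  have h: "?h (?\<rho>A c) = ?\<rho>B (fs n f c)" if "c \<in> ch (S X n)" for c
    unfolding A.sub_chains_eq[OF f(2)] B.sub_chains_eq[OF f(3)]
    by (rule quot_map_coset[OF A.pres_C[OF cs(1)] B.pres_C[OF cs(2)], where h' = "fs n f"])
       (use that sX sY fs_S[OF cs] fs_sub[OF f] mf_p[OF cs] in \<open>auto simp: fs_add intro: add_subgroup_ch\<close>)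
  have bA: "boundaries (rel_cx C m X A) n = ?\<rho>A ` bd (Suc n) ` ch (S X (Suc n))"
    using presD(3)[OF A.pres_rel_cx[OF f(2)]] A.bdry_rel_cx[OF f(2)] by (force simp: boundaries_def image_image)
  have bB: "boundaries (rel_cx C' m' Y B) n = ?\<rho>B ` bd' (Suc n) ` ch (S' Y (Suc n))"
    using presD(3)[OF B.pres_rel_cx[OF f(3)]] B.bdry_rel_cx[OF f(3)] by (force simp: boundaries_def image_image)
  have gA: "add_subgroup (bd (Suc n) ` ch (S X (Suc n)))"
    unfolding add_subgroup_def by (auto simp: A.bd_diff[symmetric] intro: diff_ch image_eqI[of _ _ 0])
  have gB: "add_subgroup (bd' (Suc n) ` ch (S' Y (Suc n)))"
    unfolding add_subgroup_def by (auto simp: B.bd_diff[symmetric] intro: diff_ch image_eqI[of _ _ 0])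
  show ?thesis
    unfolding rel_hom_map_def rel_class_def bA bB
    by (rule quot_map_coset[OF A.pres_rel_cx[OF f(2)] B.pres_rel_cx[OF f(3)], where h' = "fs n f"])
       (use c h fs_S[OF cs] fs_bd[OF cs(1)] A.bd_S[OF cs(1)] B.bd_S[OF cs(2)] gA gB
         in \<open>auto simp: fs_add A.rel_cyc_def intro!: imageI simp flip: fs_bd[OF cs(1)]\<close>)
qed

lemma rel_hom_map_hom:
  assumes "pair_map X A Y B f" "space_pair X A" "space_pair Y B"
  shows "rel_hom_map C' m' mf n Y B f \<in> hom (rel_homology C m n X A) (rel_homology C' m' n Y B)"
  by (rule pres_hom[OF A.pres_homology[OF assms(2)] B.pres_homology[OF assms(3)], where h' = "fs n f"])
     (use rel_hom_map_\<kappa>[OF assms] fs_rel_cyc[OF assms] in \<open>auto simp: fs_add\<close>)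

end

section \<open>The axioms of a homology theory in terms of representatives\<close>

context chain_model
begin

lemma carrier_H: "space_pair X A \<Longrightarrow> carrier (rel_homology C m n X A) = \<kappa> X A n ` rel_cyc X A n"
  using presD(3)[OF pres_homology] .

lemma \<kappa>_eq: "space_pair X A \<Longrightarrow> x \<in> rel_cyc X A n \<Longrightarrow> y \<in> rel_cyc X A n \<Longrightarrow> \<kappa> X A n x = \<kappa> X A n y \<longleftrightarrow> x - y \<in> rel_bdry X A n"
  using presD(5)[OF pres_homology] .

lemma \<kappa>_eq_one: "space_pair X A \<Longrightarrow> x \<in> rel_cyc X A n \<Longrightarrow> \<kappa> X A n x = \<one>\<^bsub>rel_homology C m n X A\<^esub> \<longleftrightarrow> x \<in> rel_bdry X A n"
  using pres_eq_one[OF pres_homology] .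

lemma \<kappa>_mult: "space_pair X A \<Longrightarrow> x \<in> rel_cyc X A n \<Longrightarrow> y \<in> rel_cyc X A n \<Longrightarrow>
    \<kappa> X A n x \<otimes>\<^bsub>rel_homology C m n X A\<^esub> \<kappa> X A n y = \<kappa> X A n (x + y)"
  using presD(4)[OF pres_homology] by metis

lemma in_rel_bdry: "w \<in> ch (S X (Suc n)) \<Longrightarrow> c - bd (Suc n) w \<in> rel_null X A n \<Longrightarrow> c \<in> rel_bdry X A n"
  by (auto simp: rel_bdry_def)

lemma rel_null_in_rel_bdry: "c \<in> rel_null X A n \<Longrightarrow> c \<in> rel_bdry X A n"
  by (rule in_rel_bdry[of 0]) auto

lemma add_subgroup_rel_bdry: "add_subgroup (rel_bdry X A n)"
proof -
  have "x - y \<in> rel_bdry X A n" if xy: "x \<in> rel_bdry X A n" "y \<in> rel_bdry X A n" for x y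
  proof -
    obtain v w where vw: "v \<in> ch (S X (Suc n))" "w \<in> ch (S X (Suc n))"
      "x - bd (Suc n) v \<in> rel_null X A n" "y - bd (Suc n) w \<in> rel_null X A n"
      using xy by (auto simp: rel_bdry_def)
    have "(x - y) - bd (Suc n) (v - w) = (x - bd (Suc n) v) - (y - bd (Suc n) w)"
      by (simp add: bd_diff)
    then show ?thesis using in_rel_bdry[of "v - w"] vw diff_ch rel_null_diff by metis
  qed
  then show ?thesis using rel_null_in_rel_bdry[OF rel_null_zero] by (auto simp: add_subgroup_def)
qed

lemma functor_objects: "functor_objects (rel_homology C m)"
  using presD(1)[OF pres_homology] by (simp add: functor_objects_def)

lemma connecting_hom:
  assumes X: "space_pair X A"
  shows "connecting C m n X A \<in> hom (rel_homology C m (Suc n) X A) (rel_homology C m n (subspace X A) {})"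
proof (rule homI)
  have sA: "space_pair (subspace X A) {}" using X by (simp add: space_pair_def closure_space_subspace)
  have *: "\<exists>z a. u = \<kappa> X A (Suc n) z \<and> z \<in> rel_cyc X A (Suc n) \<and> z \<in> ch (S X (Suc n)) \<and>
      a \<in> ch (S (subspace X A) n) \<and> a \<in> rel_cyc (subspace X A) {} n \<and> bd (Suc n) z - a \<in> ch (D n)"
    if u: "u \<in> carrier (rel_homology C m (Suc n) X A)" for u
  proof -
    obtain z where z: "u = \<kappa> X A (Suc n) z" "z \<in> rel_cyc X A (Suc n)" using u by (auto simp: carrier_H[OF X])
    then obtain a where "a \<in> ch (S (subspace X A) n)" "bd (Suc n) z - a \<in> ch (D n)" by (auto elim: ex_connecting)
    moreover have "z \<in> ch (S X (Suc n))" using z(2) by (simp add: rel_cyc_def)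
    ultimately show ?thesis using connecting_rel_cyc(1)[OF X] z by blast
  qed
  show "connecting C m n X A u \<in> carrier (rel_homology C m n (subspace X A) {})"
    if "u \<in> carrier (rel_homology C m (Suc n) X A)" for u
    using *[OF that] by (auto simp: connecting_\<kappa>[OF X] carrier_H[OF sA])
  fix u v assume "u \<in> carrier (rel_homology C m (Suc n) X A)" "v \<in> carrier (rel_homology C m (Suc n) X A)"
  from *[OF this(1)] *[OF this(2)] obtain z a y b where
    u: "u = \<kappa> X A (Suc n) z" "z \<in> rel_cyc X A (Suc n)" "z \<in> ch (S X (Suc n))"
      "a \<in> ch (S (subspace X A) n)" "a \<in> rel_cyc (subspace X A) {} n" "bd (Suc n) z - a \<in> ch (D n)" and
    v: "v = \<kappa> X A (Suc n) y" "y \<in> rel_cyc X A (Suc n)" "y \<in> ch (S X (Suc n))"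
      "b \<in> ch (S (subspace X A) n)" "b \<in> rel_cyc (subspace X A) {} n" "bd (Suc n) y - b \<in> ch (D n)" by blast
  have "bd (Suc n) (z + y) - (a + b) = (bd (Suc n) z - a) + (bd (Suc n) y - b)" by (simp add: bd_add)
  also have "\<dots> \<in> ch (D n)" by (rule add_ch[OF u(6) v(6)])
  finally have "connecting C m n X A (\<kappa> X A (Suc n) (z + y)) = \<kappa> (subspace X A) {} n (a + b)"
    by (rule connecting_\<kappa>[OF X add_ch[OF u(4) v(4)] add_ch[OF u(3) v(3)]])
  then show "connecting C m n X A (u \<otimes>\<^bsub>rel_homology C m (Suc n) X A\<^esub> v) =
      connecting C m n X A u \<otimes>\<^bsub>rel_homology C m n (subspace X A) {}\<^esub> connecting C m n X A v"
    using u v by (simp add: \<kappa>_mult[OF X] \<kappa>_mult[OF sA] connecting_\<kappa>[OF X])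
qed

lemma dimension_axiom_of_acyclic:
  assumes "\<And>n (X :: 'a cspace) x. closure_space X \<Longrightarrow> pts X = {x} \<Longrightarrow> n \<ge> 1 \<Longrightarrow> rel_cyc X {} n \<subseteq> rel_bdry X {} n"
  shows "dimension_axiom (rel_homology C m)"
  unfolding dimension_axiom_def
proof (intro allI impI)
  fix n :: nat and X :: "'a cspace" and x assume X: "closure_space X" "pts X = {x}" "n \<ge> 1"
  then have sp: "space_pair X {}" by (simp add: space_pair_def)
  have "carrier (rel_homology C m n X {}) = {\<one>\<^bsub>rel_homology C m n X {}\<^esub>}"
  proof -
    have "rel_cyc X {} n \<noteq> {}" using add_subgroup_zero[OF add_subgroup_rel_cyc] by blast
    moreover have "\<kappa> X {} n z = \<one>\<^bsub>rel_homology C m n X {}\<^esub>" if "z \<in> rel_cyc X {} n" for z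
      using \<kappa>_eq_one[OF sp that] assms[OF X] that by blast
    ultimately show ?thesis by (auto simp: carrier_H[OF sp])
  qed
  moreover have "group (rel_homology C m n X {})"
    using presD(1)[OF pres_homology[OF sp]] by (rule comm_group.axioms)
  ultimately show "trivial_group (rel_homology C m n X {})" by (simp add: trivial_group_def)
qed

end

context chain_model_map
begin

lemma functor_morphisms:
  "functor_morphisms (rel_homology C m) (rel_homology C' m') (\<lambda>n X A Y B f. rel_hom_map C' m' mf n Y B f)"
  unfolding functor_morphisms_def
proof (intro allI impI conjI ballI)
  fix n and X :: "'a cspace" and A and Y :: "'c cspace" and B f assume X: "space_pair X A" and Y: "space_pair Y B" and f: "pair_map X A Y B f"
  show "rel_hom_map C' m' mf n Y B f \<in> hom (rel_homology C m n X A) (rel_homology C' m' n Y B)"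
    by (rule rel_hom_map_hom[OF f X Y])
  fix g u assume gf: "\<forall>x\<in>pts X. g x = f x" and u: "u \<in> carrier (rel_homology C m n X A)"
  have cs: "closure_space X" using X by (simp add: space_pair_def)
  have "pair_map X A Y B g"
    using f X gf cont_cong[OF cs, of g f Y] unfolding pair_map_def space_pair_def by (auto simp: subset_iff)
  moreover have "fs n g z = fs n f z" if "z \<in> A.rel_cyc X A n" for z
    using fs_cong[OF cs, of z n g f] that gf by (simp add: A.rel_cyc_def)
  ultimately show "rel_hom_map C' m' mf n Y B g u = rel_hom_map C' m' mf n Y B f u"
    using u by (auto simp: A.carrier_H[OF X] rel_hom_map_\<kappa> X Y f)
qed

text \<open>If \<open>a\<close> agrees with the boundary of \<open>z\<close> up to degenerate
  chains, the same holds for their images, because \<open>fs\<close> is a chain map and keeps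
  degenerate chains degenerate. Both sides are thus computed from one pair \<open>z\<close>,
  \<open>a\<close>.\<close>

lemma connecting_natural:
  "connecting_natural (rel_homology C m) (\<lambda>n X A Y B f. rel_hom_map C' m' mf n Y B f)
     (connecting C m) (connecting C' m')"
  unfolding connecting_natural_def
proof (intro allI impI conjI ballI)
  show "connecting C m n X A \<in> hom (rel_homology C m (Suc n) X A) (rel_homology C m n (subspace X A) {})"
    if "space_pair X A" for n and X :: "'a cspace" and A using that by (rule A.connecting_hom)
  fix n and X :: "'a cspace" and A and Y :: "'c cspace" and B f u assume X: "space_pair X A" and Y: "space_pair Y B" and f: "pair_map X A Y B f"
    and "u \<in> carrier (rel_homology C m (Suc n) X A)"
  then obtain z where z: "z \<in> A.rel_cyc X A (Suc n)" and u: "u = A.\<kappa> X A (Suc n) z" by (auto simp: A.carrier_H[OF X])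
  obtain a where a: "a \<in> ch (S (subspace X A) n)" "bd (Suc n) z - a \<in> ch (D n)" using z by (rule A.ex_connecting)
  have cs: "closure_space X" "closure_space Y" "cont X Y f" using f X Y by (simp_all add: pair_map_def space_pair_def)
  have zS: "z \<in> ch (S X (Suc n))" using z by (simp add: A.rel_cyc_def)
  have sp: "space_pair (subspace X A) {}" "space_pair (subspace Y B) {}" "pair_map (subspace X A) {} (subspace Y B) {} f"
    using X Y pair_map_subspace[OF f X Y] by (simp_all add: space_pair_def closure_space_subspace pair_map_def)
  have "bd' (Suc n) (fs (Suc n) f z) - fs n f a = fs n f (bd (Suc n) z - a)"
    using fs_bd[OF cs(1) zS] by (simp add: fs_diff)
  then have "bd' (Suc n) (fs (Suc n) f z) - fs n f a \<in> ch (D' n)" using fs_D[OF a(2)] by simp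
  note c = B.connecting_\<kappa>[OF Y fs_sub[OF f X Y a(1)] fs_S[OF cs zS] this]
  show "connecting C' m' n Y B (rel_hom_map C' m' mf (Suc n) Y B f u) =
    rel_hom_map C' m' mf n (subspace Y B) {} f (connecting C m n X A u)"
    unfolding u rel_hom_map_\<kappa>[OF f X Y z] c A.connecting_\<kappa>[OF X a(1) zS a(2)]
    using rel_hom_map_\<kappa>[OF sp(3,1,2) A.connecting_rel_cyc(1)[OF X a(1) zS a(2)]] by simp
qed

text \<open>Having homologous images of a fixed cycle is an equivalence relation on maps, since
  boundaries form a subgroup; it therefore contains the equivalence relation generated by one-step
  homotopies.\<close>

lemma homotopy_axiom_of_homotopy:
  assumes "\<And>n (X :: 'a cspace) (Y :: 'c cspace) f g z. closure_space X \<Longrightarrow> closure_space Y \<Longrightarrow> one_step_homotopic J X Y f g \<Longrightarrow>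
    z \<in> A.rel_cyc X {} n \<Longrightarrow> fs n f z - fs n g z \<in> B.rel_bdry Y {} n"
  shows "homotopy_axiom J (rel_homology C m) (\<lambda>n X A Y B f. rel_hom_map C' m' mf n Y B f)"
  unfolding homotopy_axiom_def
proof (intro allI impI ballI)
  fix n and X :: "'a cspace" and Y :: "'c cspace" and f g u assume X: "closure_space X" and Y: "closure_space Y" and h: "homotopic J X Y f g"
    and "u \<in> carrier (rel_homology C m n X {})"
  have sp: "space_pair X {}" "space_pair Y {}" "pair_map X {} Y {} f" "pair_map X {} Y {} g"
    using X Y h by (simp_all add: space_pair_def homotopic_def pair_map_def)
  obtain z where z: "z \<in> A.rel_cyc X {} n" and u: "u = A.\<kappa> X {} n z"
    using \<open>u \<in> _\<close> by (auto simp: A.carrier_H[OF sp(1)])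
  note sub = add_subgroup_diff[OF B.add_subgroup_rel_bdry] add_subgroup_zero[OF B.add_subgroup_rel_bdry]
  have "equivclp (one_step_homotopic J X Y) f g" using h by (simp add: homotopic_def)
  then have "fs n f z - fs n g z \<in> B.rel_bdry Y {} n"
  proof (induction rule: equivclp_induct)
    case base
    then show ?case using sub(2) by simp
  next
    case (step g k)
    \<comment> \<open>A one-step homotopy may be traversed in either direction, so the hypothesis
      may supply the difference with the opposite sign.\<close>
    have "fs n g z - fs n k z \<in> B.rel_bdry Y {} n"
      using step(2) assms[OF X Y _ z] sub(1)[OF sub(2), of "fs n k z - fs n g z"] by auto
    then have "(fs n f z - fs n g z) + (fs n g z - fs n k z) \<in> B.rel_bdry Y {} n"
      using add_subgroup_add[OF B.add_subgroup_rel_bdry] step.IH by blast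
    then show ?case by simp
  qed
  then show "rel_hom_map C' m' mf n Y {} f u = rel_hom_map C' m' mf n Y {} g u"
    unfolding u using sp z fs_rel_cyc[of X "{}" Y "{}"]
    by (simp add: rel_hom_map_\<kappa> B.\<kappa>_eq)
qed

end

locale chain_model_self = chain_model_map S D bd C m p S D bd C m p fs m
  for S :: "'a cspace \<Rightarrow> nat \<Rightarrow> 'b set" and D bd and C :: "('a, 'g) cx_obj" and m p fs +
  assumes fs_id: "closure_space X \<Longrightarrow> c \<in> ch (S X n) \<Longrightarrow> fs n id c = c"
begin

text \<open>An inclusion keeps the representative and only changes which chains count as zero. In
  the exact sequence and in excision all classes are thus compared as chains of
  \<open>X\<close>.\<close>

lemma id_map_\<kappa>:
  assumes "pair_map X A Y B id" "space_pair X A" "space_pair Y B" "c \<in> A.rel_cyc X A n"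
  shows "rel_hom_map C m m n Y B id (A.\<kappa> X A n c) = A.\<kappa> Y B n c" "c \<in> A.rel_cyc Y B n"
proof -
  have "fs n id c = c" using assms fs_id[of X c n] by (simp add: A.rel_cyc_def space_pair_def)
  then show "rel_hom_map C m m n Y B id (A.\<kappa> X A n c) = A.\<kappa> Y B n c" "c \<in> A.rel_cyc Y B n"
    using rel_hom_map_\<kappa>[OF assms] fs_rel_cyc[OF assms] by simp_all
qed

lemma functor_identity:
  "functor_identity (rel_homology C m) (\<lambda>n X A Y B f. rel_hom_map C m m n Y B f)"
  unfolding functor_identity_def
proof (intro allI impI ballI)
  fix n and X :: "'a cspace" and A u assume X: "space_pair X A" and u: "u \<in> carrier (rel_homology C m n X A)"
  have "pair_map X A X A id" by (simp add: pair_map_def cont_id)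
  then show "rel_hom_map C m m n X A id u = u"
    using u id_map_\<kappa>(1)[OF _ X X] by (auto simp: A.carrier_H[OF X])
qed

text \<open>Each inclusion of a kernel in an image corrects a representative: by a boundary and a
  degenerate chain at the homology of \<open>X\<close>, by a chain of \<open>A\<close> at the
  homology of the pair. At the homology of \<open>A\<close>, the chain of \<open>X\<close> that
  bounds \<open>a\<close> is itself the required relative cycle.\<close>

lemma exactness:
  "exactness_axiom (rel_homology C m) (\<lambda>n X A Y B f. rel_hom_map C m m n Y B f) (connecting C m)"
  unfolding exactness_axiom_def Let_def
proof (intro allI impI)
  fix X :: "'a cspace" and A assume X: "space_pair X A"
  let ?A = "subspace X A"
  have sp: "space_pair ?A {}" "space_pair X {}" and cs: "closure_space X" "closure_space ?A"
    using X by (simp_all add: space_pair_def closure_space_subspace)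
  have "pair_map ?A {} X {} id" "pair_map X {} X A id"
    using X by (simp_all add: pair_map_def cont_id cont_inclusion space_pair_def)
  note i = id_map_\<kappa>[OF this(1) sp] and j = id_map_\<kappa>[OF this(2) sp(2) X]
  note H = A.carrier_H[OF X] A.carrier_H[OF sp(1)] A.carrier_H[OF sp(2)]
  note rcD = A.rel_null_empty[OF cs(1)] A.rel_null_empty[OF cs(2)]
  have 1: "rel_hom_map C m m n X {} id ` carrier (rel_homology C m n ?A {})
      = kernel (rel_homology C m n X {}) (rel_homology C m n X A) (rel_hom_map C m m n X A id)" (is "?L = ?R") for n
  proof (intro subset_antisym subsetI)
    fix u assume "u \<in> ?L"
    then obtain a where a: "a \<in> A.rel_cyc ?A {} n" "u = A.\<kappa> X {} n a" by (auto simp: H i)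
    have "a \<in> A.rel_null X A n" using a(1) A.S_rel_null by (simp add: A.rel_cyc_def)
    then show "u \<in> ?R"
      using a i(2)[OF a(1)] j A.\<kappa>_eq_one[OF X] A.rel_null_in_rel_bdry by (auto simp: kernel_def H)
  next
    fix u assume "u \<in> ?R"
    then obtain z where z: "z \<in> A.rel_cyc X {} n" "u = A.\<kappa> X {} n z" "z \<in> A.rel_bdry X A n"
      using j A.\<kappa>_eq_one[OF X] by (auto simp: kernel_def H)
    then obtain w where w: "w \<in> ch (S X (Suc n))" "z - bd (Suc n) w \<in> A.rel_null X A n" by (auto simp: A.rel_bdry_def)
    obtain a d where a: "a \<in> ch (S ?A n)" "d \<in> ch (D n)" "z - bd (Suc n) w = a + d" using w(2) by (rule A.rcE)
    have ad: "a = z - bd (Suc n) w - d" using a(3) by (simp add: algebra_simps)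
    have aZ: "a \<in> A.rel_cyc ?A {} n"
    proof -
      have "bd n a \<in> ch (D k)" if n: "n = Suc k" for k
      proof -
        have "bd n a = bd n z - bd n d" using A.bd_bd[OF cs(1)] w(1) n by (simp add: ad A.bd_diff)
        then show ?thesis using z(1) n A.bd_D a(2) rcD by (auto simp: A.rel_cyc_def intro: diff_ch)
      qed
      then show ?thesis using a(1) rcD by (simp add: A.rel_cyc_def)
    qed
    have "z - a \<in> A.rel_bdry X {} n" using A.in_rel_bdry[OF w(1), of "z - a" "{}"] a(2) by (simp add: ad rcD)
    then have "u = rel_hom_map C m m n X {} id (A.\<kappa> ?A {} n a)"
      using z A.\<kappa>_eq[OF sp(2) z(1) i(2)[OF aZ]] i(1)[OF aZ] by simp
    then show "u \<in> ?L" using aZ by (auto simp: H)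
  qed
  have 2: "rel_hom_map C m m (Suc n) X A id ` carrier (rel_homology C m (Suc n) X {})
     = kernel (rel_homology C m (Suc n) X A) (rel_homology C m n ?A {}) (connecting C m n X A)" (is "?L = ?R") for n
  proof (intro subset_antisym subsetI)
    fix u assume "u \<in> ?L"
    then obtain z where z: "z \<in> A.rel_cyc X {} (Suc n)" "u = A.\<kappa> X A (Suc n) z" by (auto simp: H j)
    \<comment> \<open>An absolute cycle has degenerate boundary, so the zero chain of
      \<open>A\<close> may stand for its boundary.\<close>
    have "z \<in> ch (S X (Suc n))" "bd (Suc n) z - 0 \<in> ch (D n)" using z(1) rcD by (simp_all add: A.rel_cyc_def)
    then have "connecting C m n X A u = A.\<kappa> ?A {} n 0" using A.connecting_\<kappa>[OF X zero_ch] z(2) by blast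
    then show "u \<in> ?R" using j(2)[OF z(1)] z(2) pres_zero[OF A.pres_homology[OF sp(1)]] by (auto simp: kernel_def H)
  next
    fix u assume "u \<in> ?R"
    then obtain z where z: "z \<in> A.rel_cyc X A (Suc n)" "u = A.\<kappa> X A (Suc n) z"
      and one: "connecting C m n X A u = \<one>\<^bsub>rel_homology C m n ?A {}\<^esub>" by (auto simp: kernel_def H)
    obtain a where a: "a \<in> ch (S ?A n)" "bd (Suc n) z - a \<in> ch (D n)" using z(1) by (rule A.ex_connecting)
    have zS: "z \<in> ch (S X (Suc n))" using z by (simp add: A.rel_cyc_def)
    have "a \<in> A.rel_bdry ?A {} n"
      using one z(2) A.connecting_\<kappa>[OF X a(1) zS a(2)] A.\<kappa>_eq_one[OF sp(1) A.connecting_rel_cyc(1)[OF X a(1) zS a(2)]] by simp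
    then obtain w where w: "w \<in> ch (S ?A (Suc n))" "a - bd (Suc n) w \<in> ch (D n)" by (auto simp: A.rel_bdry_def rcD)
    \<comment> \<open>Since \<open>a\<close> is the boundary of the chain \<open>w\<close> of
      \<open>A\<close> up to degenerate chains, subtracting \<open>w\<close> turns the relative
      cycle \<open>z\<close> into an absolute one without changing its class modulo
      \<open>A\<close>.\<close>
    have "bd (Suc n) (z - w) = (bd (Suc n) z - a) + (a - bd (Suc n) w)" by (simp add: A.bd_diff)
    then have "bd (Suc n) (z - w) \<in> ch (D n)" using a(2) w(2) add_ch by metis
    then have zw: "z - w \<in> A.rel_cyc X {} (Suc n)" using zS A.sub_S[OF X w(1)] by (simp add: A.rel_cyc_def rcD diff_ch)
    have "z - (z - w) \<in> A.rel_bdry X A (Suc n)" using A.rel_null_in_rel_bdry[OF A.S_rel_null[OF w(1)]] by simp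
    then have "u = A.\<kappa> X A (Suc n) (z - w)" using A.\<kappa>_eq[OF X z(1) j(2)[OF zw]] z(2) by simp
    then show "u \<in> ?L" using zw j(1)[OF zw] by (auto simp: H intro!: image_eqI)
  qed
  have 3: "connecting C m n X A ` carrier (rel_homology C m (Suc n) X A)
     = kernel (rel_homology C m n ?A {}) (rel_homology C m n X {}) (rel_hom_map C m m n X {} id)" (is "?L = ?R") for n
  proof (intro subset_antisym subsetI)
    fix u assume "u \<in> ?L"
    then obtain z where z: "z \<in> A.rel_cyc X A (Suc n)" "u = connecting C m n X A (A.\<kappa> X A (Suc n) z)" by (auto simp: H)
    obtain a where a: "a \<in> ch (S ?A n)" "bd (Suc n) z - a \<in> ch (D n)" using z(1) by (rule A.ex_connecting)
    have zS: "z \<in> ch (S X (Suc n))" using z by (simp add: A.rel_cyc_def)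
    note aZ = A.connecting_rel_cyc(1)[OF X a(1) zS a(2)]
    have "a - bd (Suc n) z \<in> ch (D n)" using minus_ch[OF a(2)] by simp
    then have "a \<in> A.rel_bdry X {} n" using A.in_rel_bdry[OF zS, of a "{}"] by (simp add: rcD)
    then show "u \<in> ?R"
      using z(2) A.connecting_\<kappa>[OF X a(1) zS a(2)] aZ i[OF aZ] A.\<kappa>_eq_one[OF sp(2)] by (auto simp: kernel_def H)
  next
    fix u assume "u \<in> ?R"
    then obtain a where a: "a \<in> A.rel_cyc ?A {} n" "u = A.\<kappa> ?A {} n a" "a \<in> A.rel_bdry X {} n"
      using i A.\<kappa>_eq_one[OF sp(2)] by (auto simp: kernel_def H)
    then obtain w where w: "w \<in> ch (S X (Suc n))" "a - bd (Suc n) w \<in> ch (D n)" by (auto simp: A.rel_bdry_def rcD)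
    have aS: "a \<in> ch (S ?A n)" and d: "bd (Suc n) w - a \<in> ch (D n)"
      using a(1) minus_ch[OF w(2)] by (simp_all add: A.rel_cyc_def)
    show "u \<in> ?L"
      using A.connecting_\<kappa>[OF X aS w(1) d] A.connecting_rel_cyc(2)[OF X aS w(1) d] a(2) by (auto simp: H)
  qed
  have 4: "rel_hom_map C m m 0 X A id ` carrier (rel_homology C m 0 X {}) = carrier (rel_homology C m 0 X A)"
  proof -
    \<comment> \<open>In degree 0 every chain is a cycle, absolutely as well as relatively.\<close>
    have "A.rel_cyc X {} 0 = A.rel_cyc X A 0" by (simp add: A.rel_cyc_def)
    then show ?thesis using j(1)[where n = 0] by (simp add: H image_image)
  qed
  show "(\<forall>n. rel_hom_map C m m n X {} id ` carrier (rel_homology C m n ?A {})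
      = kernel (rel_homology C m n X {}) (rel_homology C m n X A) (rel_hom_map C m m n X A id)) \<and>
    (\<forall>n. rel_hom_map C m m (Suc n) X A id ` carrier (rel_homology C m (Suc n) X {})
     = kernel (rel_homology C m (Suc n) X A) (rel_homology C m n ?A {}) (connecting C m n X A)) \<and>
    (\<forall>n. connecting C m n X A ` carrier (rel_homology C m (Suc n) X A)
     = kernel (rel_homology C m n ?A {}) (rel_homology C m n X {}) (rel_hom_map C m m n X {} id)) \<and>
    rel_hom_map C m m 0 X A id ` carrier (rel_homology C m 0 X {}) = carrier (rel_homology C m 0 X A)"
    using 1 2 3 4 by blast
qed

text \<open>Excision holds as soon as the complex of all chains modulo the sums of chains of \<open>A\<close> and of
  \<open>B\<close> is acyclic.\<close>

lemma excision_axiom_of_small: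
  assumes small: "\<And>n (X :: 'a cspace) A B z. closure_space X \<Longrightarrow> interior_cover X {A, B} \<Longrightarrow> z \<in> ch (S X n) \<Longrightarrow>
    (\<And>k. n = Suc k \<Longrightarrow> bd n z \<in> ch (S (subspace X A) k \<union> S (subspace X B) k \<union> D k)) \<Longrightarrow>
    \<exists>w\<in>ch (S X (Suc n)). z - bd (Suc n) w \<in> ch (S (subspace X A) n \<union> S (subspace X B) n \<union> D n)"
  shows "excision_axiom (rel_homology C m) (\<lambda>n X A Y B f. rel_hom_map C m m n Y B f)"
  unfolding excision_axiom_def
proof (intro allI impI)
  fix n and X :: "'a cspace" and A B assume X: "closure_space X" and cov: "interior_cover X {A, B}"
  let ?B = "subspace X B"
  have sub: "A \<subseteq> pts X" "B \<subseteq> pts X" using cov unfolding interior_cover_def by blast+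
  have sp: "space_pair X A" "space_pair X B" "space_pair ?B (A \<inter> B)" and csB: "closure_space ?B"
    using X sub by (auto simp: space_pair_def closure_space_subspace)
  have sAB: "subspace ?B (A \<inter> B) = subspace X (A \<inter> B)" by (simp add: subspace_subspace)
  have pm: "pair_map ?B (A \<inter> B) X A id" using cont_inclusion[OF sub(2)] by (simp add: pair_map_def)
  note e = id_map_\<kappa>[OF pm sp(3,1)]
  \<comment> \<open>The generators occurring in such a chain belong to \<open>B\<close>, and to
    \<open>A\<close> or to \<open>D\<close>; those in both \<open>A\<close> and \<open>B\<close>
    belong to \<open>A \<inter> B\<close>.\<close>
  have rel_null: "c \<in> A.rel_null ?B (A \<inter> B) k" if "c \<in> ch (S ?B k)" "c \<in> A.rel_null X A k" for c k
  proof -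
    have "c \<in> ch (S ?B k \<inter> (S (subspace X A) k \<union> D k))" using that by (intro ch_Int) (simp_all add: A.rel_null_def)
    then show ?thesis
      unfolding A.rel_null_def sAB A.S_Int[OF sp(1,2), symmetric] by (elim ch_mono[rotated]) auto
  qed
  have un: "\<exists>a\<in>ch (S (subspace X A) k). \<exists>b\<in>ch (S ?B k). \<exists>d\<in>ch (D k). c = a + b + d"
    if "c \<in> ch (S (subspace X A) k \<union> S ?B k \<union> D k)" for c k
    using that by (elim ch_UnE) blast
  have inj: "inj_on (rel_hom_map C m m n X A id) (carrier (rel_homology C m n ?B (A \<inter> B)))"
  proof (rule inj_onI)
    fix u v assume uv: "u \<in> carrier (rel_homology C m n ?B (A \<inter> B))" "v \<in> carrier (rel_homology C m n ?B (A \<inter> B))"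
      "rel_hom_map C m m n X A id u = rel_hom_map C m m n X A id v"
    then obtain x y where x: "x \<in> A.rel_cyc ?B (A \<inter> B) n" "u = A.\<kappa> ?B (A \<inter> B) n x"
      and y: "y \<in> A.rel_cyc ?B (A \<inter> B) n" "v = A.\<kappa> ?B (A \<inter> B) n y" by (auto simp: A.carrier_H[OF sp(3)])
    let ?c = "x - y"
    have c: "?c \<in> ch (S ?B n)" using x(1) y(1) by (simp add: A.rel_cyc_def diff_ch)
    have "?c \<in> A.rel_bdry X A n"
      using uv(3) x y e A.\<kappa>_eq[OF sp(1) e(2)[OF x(1)] e(2)[OF y(1)]] by simp
    then obtain w where w: "w \<in> ch (S X (Suc n))" "?c - bd (Suc n) w \<in> A.rel_null X A n" by (auto simp: A.rel_bdry_def)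
    let ?U = "S (subspace X A) n \<union> S ?B n \<union> D n"
    have "?c \<in> ch ?U" "?c - bd (Suc n) w \<in> ch ?U"
      using ch_mono[OF _ c, of ?U] ch_mono[OF _ w(2)[unfolded A.rel_null_def], of ?U] by auto
    \<comment> \<open>The chain \<open>?c\<close> of \<open>B\<close> is small, and so is
      \<open>?c\<close> minus the boundary of \<open>w\<close>. Hence this boundary is small, and
      the hypothesis applies to \<open>w\<close> in degree \<open>Suc n\<close>.\<close>
    from diff_ch[OF this] have "bd (Suc n) w \<in> ch ?U" by simp
    then obtain w' where v: "w' \<in> ch (S X (Suc (Suc n)))"
      "w - bd (Suc (Suc n)) w' \<in> ch (S (subspace X A) (Suc n) \<union> S ?B (Suc n) \<union> D (Suc n))"
      using small[OF X cov w(1)] by auto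
    from un[OF v(2)] obtain a b d where abd: "a \<in> ch (S (subspace X A) (Suc n))" "b \<in> ch (S ?B (Suc n))" "d \<in> ch (D (Suc n))"
      "w - bd (Suc (Suc n)) w' = a + b + d" by blast
    have "bd (Suc n) w = bd (Suc n) a + bd (Suc n) b + bd (Suc n) d"
      using arg_cong[OF abd(4), of "bd (Suc n)"] A.bd_bd[OF X v(1)] by (simp add: A.bd_diff A.bd_add)
    \<comment> \<open>Only the part \<open>b\<close> of \<open>w\<close> carried by \<open>B\<close>
      is kept as the bounding chain; the parts in \<open>A\<close> and in \<open>D\<close>
      contribute null chains.\<close>
    then have "?c - bd (Suc n) b = (?c - bd (Suc n) w) + bd (Suc n) a + bd (Suc n) d" by (simp add: algebra_simps)
    also have "\<dots> \<in> A.rel_null X A n"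
      by (rule A.rel_null_add[OF A.rel_null_add[OF w(2) A.S_rel_null[OF A.bd_sub[OF sp(1) abd(1)]]] A.D_rel_null[OF A.bd_D[OF abd(3)]]])
    finally have "?c - bd (Suc n) b \<in> A.rel_null ?B (A \<inter> B) n"
      by (rule rel_null[OF diff_ch[OF c A.bd_sub[OF sp(2) abd(2)]]])
    then have "?c \<in> A.rel_bdry ?B (A \<inter> B) n" using A.in_rel_bdry[OF abd(2)] by blast
    then show "u = v" using x y A.\<kappa>_eq[OF sp(3) x(1) y(1)] by simp
  qed
  have surj: "\<exists>v\<in>carrier (rel_homology C m n ?B (A \<inter> B)). u = rel_hom_map C m m n X A id v"
    if u: "u \<in> carrier (rel_homology C m n X A)" for u
  proof -
    obtain z where z: "z \<in> A.rel_cyc X A n" "u = A.\<kappa> X A n z" using u by (auto simp: A.carrier_H[OF sp(1)])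
    have zS: "z \<in> ch (S X n)" using z(1) by (simp add: A.rel_cyc_def)
    have "bd n z \<in> ch (S (subspace X A) k \<union> S ?B k \<union> D k)" if "n = Suc k" for k
      using z(1) that by (auto simp: A.rel_cyc_def A.rel_null_def elim: ch_mono[rotated])
    from small[OF X cov zS this] obtain w where
      w: "w \<in> ch (S X (Suc n))" "z - bd (Suc n) w \<in> ch (S (subspace X A) n \<union> S ?B n \<union> D n)" by blast
    from un[OF w(2)] obtain a b d where abd: "a \<in> ch (S (subspace X A) n)" "b \<in> ch (S ?B n)" "d \<in> ch (D n)"
      "z - bd (Suc n) w = a + b + d" by blast
    \<comment> \<open>The summand \<open>b\<close> in \<open>B\<close> represents the same class as
      \<open>z\<close>, since what is dropped is a boundary, a chain of \<open>A\<close> and a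
      degenerate chain.\<close>
    have b: "b = z - bd (Suc n) w - a - d" using abd(4) by (simp add: algebra_simps)
    have bZ: "b \<in> A.rel_cyc ?B (A \<inter> B) n"
    proof -
      have "bd n b \<in> A.rel_null ?B (A \<inter> B) k" if n: "n = Suc k" for k
      proof (rule rel_null)
        show "bd n b \<in> ch (S ?B k)" using A.bd_sub[OF sp(2)] abd(2) n by simp
        have "bd n b = bd n z - bd n a - bd n d" using A.bd_bd[OF X] w(1) n by (simp add: b A.bd_diff)
        moreover have "bd n a \<in> A.rel_null X A k" "bd n d \<in> A.rel_null X A k" "bd n z \<in> A.rel_null X A k"
          using A.S_rel_null[OF A.bd_sub[OF sp(1)]] A.D_rel_null[OF A.bd_D] abd(1,3) z(1) n by (simp_all add: A.rel_cyc_def)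
        ultimately show "bd n b \<in> A.rel_null X A k" by (simp add: A.rel_null_diff)
      qed
      then show ?thesis using abd(2) by (simp add: A.rel_cyc_def)
    qed
    have "z - b - bd (Suc n) w = a + d" by (simp add: b)
    then have "z - b \<in> A.rel_bdry X A n"
      using A.in_rel_bdry[OF w(1), of "z - b" A] A.rel_null_add[OF A.S_rel_null[OF abd(1)] A.D_rel_null[OF abd(3)]] by simp
    then have "u = A.\<kappa> X A n b" using A.\<kappa>_eq[OF sp(1) z(1) e(2)[OF bZ]] z(2) by simp
    then show ?thesis using e(1)[OF bZ] bZ by (auto simp: A.carrier_H[OF sp(3)])
  qed
  have hom: "rel_hom_map C m m n X A id \<in> hom (rel_homology C m n ?B (A \<inter> B)) (rel_homology C m n X A)"
    by (rule rel_hom_map_hom[OF pm sp(3,1)])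
  show "rel_hom_map C m m n X A id \<in> iso (rel_homology C m n ?B (A \<inter> B)) (rel_homology C m n X A)"
    using hom inj surj hom_carrier[OF hom] unfolding iso_def bij_betw_def by blast
qed

end

text \<open>Stated outside the locales, because three point types meet and each induced map comes
  from its own interpretation.\<close>

lemma functor_composition_chain_model:
  fixes Sa :: "'a cspace \<Rightarrow> nat \<Rightarrow> 'x set" and Sb :: "'b cspace \<Rightarrow> nat \<Rightarrow> 'y set"
    and Sc :: "'c cspace \<Rightarrow> nat \<Rightarrow> 'z set"
  assumes ab: "chain_model_map Sa Da bda Ca ma pa Sb Db bdb Cb mb pb fab mab"
    and bc: "chain_model_map Sb Db bdb Cb mb pb Sc Dc bdc Cc mc pc fbc mbc"
    and ac: "chain_model_map Sa Da bda Ca ma pa Sc Dc bdc Cc mc pc fac mac"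
    and comp: "\<And>n (X :: 'a cspace) (f :: 'a \<Rightarrow> 'b) (g :: 'b \<Rightarrow> 'c) c. closure_space X \<Longrightarrow> c \<in> ch (Sa X n) \<Longrightarrow> fac n (g \<circ> f) c = fbc n g (fab n f c)"
  shows "functor_composition (rel_homology Ca ma) (\<lambda>n X A Y B f. rel_hom_map Cb mb mab n Y B f)
    (\<lambda>n X A Y B f. rel_hom_map Cc mc mbc n Y B f) (\<lambda>n X A Y B f. rel_hom_map Cc mc mac n Y B f)"
  unfolding functor_composition_def
proof (intro allI impI ballI)
  interpret ab: chain_model_map Sa Da bda Ca ma pa Sb Db bdb Cb mb pb fab mab by (rule ab)
  interpret bc: chain_model_map Sb Db bdb Cb mb pb Sc Dc bdc Cc mc pc fbc mbc by (rule bc)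
  interpret ac: chain_model_map Sa Da bda Ca ma pa Sc Dc bdc Cc mc pc fac mac by (rule ac)
  fix n and X :: "'a cspace" and A and Y :: "'b cspace" and B and Z :: "'c cspace" and D f g u
  assume sp: "space_pair X A" "space_pair Y B" "space_pair Z D" and f: "pair_map X A Y B f" and g: "pair_map Y B Z D g"
    and "u \<in> carrier (rel_homology Ca ma n X A)"
  then obtain z where z: "z \<in> ab.A.rel_cyc X A n" and u: "u = ab.A.\<kappa> X A n z" by (auto simp: ab.A.carrier_H)
  have gf: "pair_map X A Z D (g \<circ> f)"
    using f g cont_compose[of X Y f Z g] by (auto simp: pair_map_def)
  have "fac n (g \<circ> f) z = fbc n g (fab n f z)" using comp[of X z n g f] z sp(1) by (simp add: ab.A.rel_cyc_def space_pair_def)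
  then show "rel_hom_map Cc mc mac n Z D (g \<circ> f) u = rel_hom_map Cc mc mbc n Z D g (rel_hom_map Cb mb mab n Y B f u)"
    unfolding u ab.rel_hom_map_\<kappa>[OF f sp(1,2) z] bc.rel_hom_map_\<kappa>[OF g sp(2,3) ab.fs_rel_cyc[OF f sp(1,2) z]]
      ac.rel_hom_map_\<kappa>[OF gf sp(1,3) z] by simp
qed

lemma homology_theory_chain_model:
  fixes Sa :: "'a cspace \<Rightarrow> nat \<Rightarrow> 'x set" and Sb :: "'b cspace \<Rightarrow> nat \<Rightarrow> 'y set"
    and Sc :: "'c cspace \<Rightarrow> nat \<Rightarrow> 'z set"
  assumes aa: "chain_model_self Sa Da bda Ca ma pa faa"
    and ab: "chain_model_map Sa Da bda Ca ma pa Sb Db bdb Cb mb pb fab mab"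
    and bc: "chain_model_map Sb Db bdb Cb mb pb Sc Dc bdc Cc mc pc fbc mbc"
    and ac: "chain_model_map Sa Da bda Ca ma pa Sc Dc bdc Cc mc pc fac mac"
    and comp: "\<And>n (X :: 'a cspace) (f :: 'a \<Rightarrow> 'b) (g :: 'b \<Rightarrow> 'c) c. closure_space X \<Longrightarrow> c \<in> ch (Sa X n) \<Longrightarrow> fac n (g \<circ> f) c = fbc n g (fab n f c)"
    and homotopy: "\<And>n (X :: 'a cspace) (Y :: 'b cspace) f g z. closure_space X \<Longrightarrow> closure_space Y \<Longrightarrow> one_step_homotopic J X Y f g \<Longrightarrow>
      z \<in> chain_model.rel_cyc Sa Da bda X {} n \<Longrightarrow> fab n f z - fab n g z \<in> chain_model.rel_bdry Sb Db bdb Y {} n"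
    and excision: "\<And>n (X :: 'a cspace) A B z. closure_space X \<Longrightarrow> interior_cover X {A, B} \<Longrightarrow> z \<in> ch (Sa X n) \<Longrightarrow>
      (\<And>k. n = Suc k \<Longrightarrow> bda n z \<in> ch (Sa (subspace X A) k \<union> Sa (subspace X B) k \<union> Da k)) \<Longrightarrow>
      \<exists>w\<in>ch (Sa X (Suc n)). z - bda (Suc n) w \<in> ch (Sa (subspace X A) n \<union> Sa (subspace X B) n \<union> Da n)"
    and dimension: "\<And>n (X :: 'a cspace) x. closure_space X \<Longrightarrow> pts X = {x} \<Longrightarrow> n \<ge> 1 \<Longrightarrow>
      chain_model.rel_cyc Sa Da bda X {} n \<subseteq> chain_model.rel_bdry Sa Da bda X {} n"
  shows "homology_theory J (rel_homology Ca ma) (rel_homology Cb mb) (rel_homology Cc mc)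
    (\<lambda>n X A Y B f. rel_hom_map Ca ma ma n Y B f) (\<lambda>n X A Y B f. rel_hom_map Cb mb mab n Y B f)
    (\<lambda>n X A Y B f. rel_hom_map Cc mc mbc n Y B f) (\<lambda>n X A Y B f. rel_hom_map Cc mc mac n Y B f)
    (connecting Ca ma) (connecting Cb mb)"
proof -
  interpret aa: chain_model_self Sa Da bda Ca ma pa faa by (rule aa)
  interpret ab: chain_model_map Sa Da bda Ca ma pa Sb Db bdb Cb mb pb fab mab by (rule ab)
  interpret bc: chain_model_map Sb Db bdb Cb mb pb Sc Dc bdc Cc mc pc fbc mbc by (rule bc)
  interpret ac: chain_model_map Sa Da bda Ca ma pa Sc Dc bdc Cc mc pc fac mac by (rule ac)
  show ?thesis
    unfolding homology_theory_def
  proof (intro conjI)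
    show "functor_composition (rel_homology Ca ma) (\<lambda>n X A Y B f. rel_hom_map Cb mb mab n Y B f)
      (\<lambda>n X A Y B f. rel_hom_map Cc mc mbc n Y B f) (\<lambda>n X A Y B f. rel_hom_map Cc mc mac n Y B f)"
      by (rule functor_composition_chain_model[OF ab bc ac]) (rule comp)
    show "homotopy_axiom J (rel_homology Ca ma) (\<lambda>n X A Y B f. rel_hom_map Cb mb mab n Y B f)"
      by (rule ab.homotopy_axiom_of_homotopy) (rule homotopy)
    show "excision_axiom (rel_homology Ca ma) (\<lambda>n X A Y B f. rel_hom_map Ca ma ma n Y B f)"
      by (rule aa.excision_axiom_of_small) (rule excision)
    show "dimension_axiom (rel_homology Ca ma)"
      by (rule aa.A.dimension_axiom_of_acyclic) (rule dimension)
  qed (rule aa.A.functor_objects chain_model.functor_objects[OF chain_model_map.axioms(2)[OF ab]]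
      chain_model.functor_objects[OF chain_model_map.axioms(2)[OF bc]]
      aa.functor_morphisms ab.functor_morphisms bc.functor_morphisms ac.functor_morphisms
      aa.functor_identity ab.connecting_natural aa.exactness)+
qed

section \<open>Alternating double sums\<close>

lemma sum_split_nat:
  fixes a j N :: nat
  assumes "a \<le> j" "j \<le> Suc N"
  shows "sum h {a..N} = sum h {a..<j} + (sum h {j..N} :: 'x::comm_monoid_add)"
  using sum.atLeastLessThan_concat[OF assms, of h] by (simp add: atLeastLessThanSuc_atLeastAtMost)

lemma sum_triangle_swap:
  "(\<Sum>j\<in>{a..N::nat}. \<Sum>i\<in>{a..j}. h i j) = (\<Sum>i\<in>{a..N}. \<Sum>j\<in>{i..N}. (h i j :: 'x::comm_monoid_add))"
  by (simp add: sum.Sigma, rule sum.reindex_bij_witness[of _ "\<lambda>(i, j). (j, i)" "\<lambda>(i, j). (j, i)"]) auto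

text \<open>The row \<open>j = a\<close> is empty, so the sum effectively starts at
  \<open>Suc a\<close> and can be shifted.\<close>

lemma sum_shift_triangle:
  assumes "a \<le> Suc N"
  shows "(\<Sum>j\<in>{a..Suc N}. \<Sum>i\<in>{a..<j}. h j i) = (\<Sum>j\<in>{a..N::nat}. \<Sum>i\<in>{a..j}. (h (Suc j) i :: 'x::comm_monoid_add))"
proof -
  have "(\<Sum>j\<in>{a..Suc N}. \<Sum>i\<in>{a..<j}. h j i) = (\<Sum>j\<in>{Suc a..Suc N}. \<Sum>i\<in>{a..<j}. h j i)"
    using assms by (subst sum.atLeast_Suc_atMost) (simp_all del: sum.cl_ivl_Suc)
  also have "\<dots> = (\<Sum>j\<in>{a..N}. \<Sum>i\<in>{a..j}. h (Suc j) i)"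
    by (simp only: sum.shift_bounds_cl_Suc_ivl atLeastLessThanSuc_atLeastAtMost)
  finally show ?thesis .
qed

text \<open>The terms with \<open>i < j\<close>, after shifting \<open>j\<close> by one, match those
  with \<open>i \<le> j\<close> under swapping the indices, and the shift reverses the sign. The
  lower bound \<open>a\<close> is 0 for simplices and 1 for cubes.\<close>

lemma boundary_sum_zero:
  fixes F :: "nat \<Rightarrow> nat \<Rightarrow> ('b \<Rightarrow>\<^sub>0 int)"
  assumes "\<And>i j. a \<le> i \<Longrightarrow> i \<le> j \<Longrightarrow> j \<le> N \<Longrightarrow> F (Suc j) i = F i j" "a \<le> Suc N"
  shows "(\<Sum>j\<in>{a..Suc N}. \<Sum>i\<in>{a..N}. frag_cmul ((-1) ^ (j + i)) (F j i)) = 0"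
proof -
  let ?f = "\<lambda>j i. frag_cmul ((-1) ^ (j + i)) (F j i)"
  have "(\<Sum>j\<in>{a..Suc N}. \<Sum>i\<in>{a..N}. ?f j i) = (\<Sum>j\<in>{a..Suc N}. (\<Sum>i\<in>{a..<j}. ?f j i) + (\<Sum>i\<in>{j..N}. ?f j i))"
    by (intro sum.cong refl sum_split_nat) auto
  also have "\<dots> = (\<Sum>j\<in>{a..Suc N}. \<Sum>i\<in>{a..<j}. ?f j i) + (\<Sum>j\<in>{a..Suc N}. \<Sum>i\<in>{j..N}. ?f j i)"
    by (rule sum.distrib)
  also have "(\<Sum>j\<in>{a..Suc N}. \<Sum>i\<in>{j..N}. ?f j i) = (\<Sum>j\<in>{a..N}. \<Sum>i\<in>{j..N}. ?f j i)"
    using assms(2) by simp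
  also have "(\<Sum>j\<in>{a..Suc N}. \<Sum>i\<in>{a..<j}. ?f j i) = (\<Sum>j\<in>{a..N}. \<Sum>i\<in>{a..j}. ?f (Suc j) i)"
    by (rule sum_shift_triangle[OF assms(2)])
  also have "\<dots> = (\<Sum>j\<in>{a..N}. \<Sum>i\<in>{a..j}. - ?f i j)"
    using assms(1) by (intro sum.cong refl) (simp add: add.commute)
  also have "\<dots> = - (\<Sum>i\<in>{a..N}. \<Sum>j\<in>{i..N}. ?f i j)"
    by (simp only: sum_triangle_swap sum_negf)
  finally show ?thesis by simp
qed

text \<open>\<open>F i j\<close> plays the \<open>j\<close>-th face of the \<open>i\<close>-th piece
  of a homotopy, \<open>G i j\<close> the \<open>i\<close>-th piece over the \<open>j\<close>-th
  face. Faces off the diagonal cancel against \<open>G\<close>; the faces \<open>i\<close> and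
  \<open>Suc i\<close> of each piece survive. Prisms over simplices and sheared cubes share this
  pattern.\<close>

lemma homotopy_sum:
  fixes F G :: "nat \<Rightarrow> nat \<Rightarrow> ('b \<Rightarrow>\<^sub>0 int)"
  assumes G1: "\<And>i j. a \<le> j \<Longrightarrow> j \<le> i \<Longrightarrow> i < n \<Longrightarrow> G i j = F (Suc i) j"
    and G2: "\<And>i j. a \<le> i \<Longrightarrow> i < j \<Longrightarrow> j \<le> n \<Longrightarrow> G i j = F i (Suc j)"
  shows "(\<Sum>i\<in>{a..n}. \<Sum>j\<in>{a..Suc n}. frag_cmul ((-1) ^ (i + j)) (F i j)) +
      (\<Sum>i\<in>{a..<n}. \<Sum>j\<in>{a..n}. frag_cmul ((-1) ^ (i + j)) (G i j)) = (\<Sum>i\<in>{a..n}. F i i - F i (Suc i))"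
proof (cases "a \<le> n")
  case True
  let ?f = "\<lambda>i j. frag_cmul ((-1) ^ (i + j)) (F i j)" and ?g = "\<lambda>i j. frag_cmul ((-1) ^ (i + j)) (G i j)"
  have "(\<Sum>i\<in>{a..n}. \<Sum>j\<in>{a..Suc n}. ?f i j) =
      (\<Sum>i\<in>{a..n}. (\<Sum>j\<in>{a..<i}. ?f i j) + (F i i - F i (Suc i)) + (\<Sum>j\<in>{Suc i..n}. ?f i (Suc j)))"
  proof (intro sum.cong refl)
    fix i assume i: "i \<in> {a..n}"
    have "(\<Sum>j\<in>{a..Suc n}. ?f i j) = (\<Sum>j\<in>{a..<i}. ?f i j) + (\<Sum>j\<in>{i..Suc n}. ?f i j)"
      using i by (intro sum_split_nat) auto
    also have "(\<Sum>j\<in>{i..Suc n}. ?f i j) = ?f i i + (?f i (Suc i) + (\<Sum>j\<in>{Suc (Suc i)..Suc n}. ?f i j))"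
      using i by (simp add: sum.atLeast_Suc_atMost del: sum.cl_ivl_Suc)
    also have "(\<Sum>j\<in>{Suc (Suc i)..Suc n}. ?f i j) = (\<Sum>j\<in>{Suc i..n}. ?f i (Suc j))"
      by (rule sum.shift_bounds_cl_Suc_ivl)
    also have "?f i i = F i i" by (simp add: mult_2[symmetric])
    also have "?f i (Suc i) = - F i (Suc i)" by (simp add: mult_2[symmetric])
    finally show "(\<Sum>j\<in>{a..Suc n}. ?f i j) = (\<Sum>j\<in>{a..<i}. ?f i j) + (F i i - F i (Suc i)) + (\<Sum>j\<in>{Suc i..n}. ?f i (Suc j))"
      by (simp add: algebra_simps)
  qed
  also have "\<dots> = (\<Sum>i\<in>{a..n}. \<Sum>j\<in>{a..<i}. ?f i j) + (\<Sum>i\<in>{a..n}. F i i - F i (Suc i)) +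
      (\<Sum>i\<in>{a..n}. \<Sum>j\<in>{Suc i..n}. ?f i (Suc j))"
    by (simp only: sum.distrib)
  \<comment> \<open>The row \<open>i = n\<close> is empty, which matches the range of
    \<open>G\<close>, whose pieces sit over faces of one dimension less.\<close>
  also have "(\<Sum>i\<in>{a..n}. \<Sum>j\<in>{Suc i..n}. ?f i (Suc j)) = (\<Sum>i\<in>{a..<n}. \<Sum>j\<in>{Suc i..n}. ?f i (Suc j))"
    using True by (simp add: sum.last_plus)
  also have "\<dots> = (\<Sum>i\<in>{a..<n}. - (\<Sum>j\<in>{Suc i..n}. ?g i j))"
    using G2 by (intro sum.cong refl) (auto simp: sum_negf[symmetric] intro!: sum.cong)
  also have "(\<Sum>i\<in>{a..n}. \<Sum>j\<in>{a..<i}. ?f i j) = (\<Sum>i\<in>{a..<n}. - (\<Sum>j\<in>{a..i}. ?g i j))"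
  proof (cases n)
    case (Suc N)
    have "(\<Sum>i\<in>{a..Suc N}. \<Sum>j\<in>{a..<i}. ?f i j) = (\<Sum>i\<in>{a..N}. \<Sum>j\<in>{a..i}. ?f (Suc i) j)"
      using True Suc by (intro sum_shift_triangle) simp
    also have "\<dots> = (\<Sum>i\<in>{a..N}. - (\<Sum>j\<in>{a..i}. ?g i j))"
      using G1 Suc by (intro sum.cong refl) (auto simp: sum_negf[symmetric] intro!: sum.cong)
    finally show ?thesis using Suc by (simp add: atLeastLessThanSuc_atLeastAtMost)
  qed (use True in simp)
  finally have *: "(\<Sum>i\<in>{a..n}. \<Sum>j\<in>{a..Suc n}. ?f i j) = (\<Sum>i\<in>{a..n}. F i i - F i (Suc i))
      - ((\<Sum>i\<in>{a..<n}. \<Sum>j\<in>{a..i}. ?g i j) + (\<Sum>i\<in>{a..<n}. \<Sum>j\<in>{Suc i..n}. ?g i j))"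
    by (simp add: sum_negf)
  have "(\<Sum>j\<in>{a..n}. ?g i j) = (\<Sum>j\<in>{a..i}. ?g i j) + (\<Sum>j\<in>{Suc i..n}. ?g i j)" if "i \<in> {a..<n}" for i
    using sum_split_nat[of a "Suc i" n "?g i"] that by (simp add: atLeastLessThanSuc_atLeastAtMost)
  then have "(\<Sum>i\<in>{a..<n}. \<Sum>j\<in>{a..n}. ?g i j) = 
      (\<Sum>i\<in>{a..<n}. \<Sum>j\<in>{a..i}. ?g i j) + (\<Sum>i\<in>{a..<n}. \<Sum>j\<in>{Suc i..n}. ?g i j)"
    by (simp add: sum.distrib)
  then show ?thesis using * by simp
qed simp

section \<open>Singular chains\<close>

abbreviation sing :: "(nat \<Rightarrow> 's cspace) \<Rightarrow> 'a cspace \<Rightarrow> nat \<Rightarrow> ('s \<Rightarrow> 'a) set" where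
  "sing \<equiv> sing_simplices"

definition push :: "(nat \<Rightarrow> 's cspace) \<Rightarrow> nat \<Rightarrow> ('a \<Rightarrow> 'b) \<Rightarrow> (('s \<Rightarrow> 'a) \<Rightarrow>\<^sub>0 int) \<Rightarrow> (('s \<Rightarrow> 'b) \<Rightarrow>\<^sub>0 int)" where
  "push M n f = frag_extend (\<lambda>\<sigma>. frag_of (compose (pts (M n)) f \<sigma>))"

lemma push_0: "push M n f 0 = 0"
  by (simp add: push_def)

lemma simplicial_map_eq: "simplicial_map M n Y f = push M n f"
  by (simp add: push_def simplicial_map_def)

lemma ch_empty: "ch {} = {0}"
  by (auto simp: ch_def)

lemma push_add: "push M n f (x + y) = push M n f x + push M n f y"
  by (simp add: push_def frag_extend_add)

lemma push_diff: "push M n f (x - y) = push M n f x - push M n f y"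
  by (simp add: push_def frag_extend_diff)

text \<open>\<open>compose\<close> pads with \<open>undefined\<close> outside its domain, so
  equality of the two composites is decided on \<open>P\<close> alone.\<close>

lemma compose_compose_eq:
  assumes "\<And>x. x \<in> P \<Longrightarrow> \<phi> x \<in> Q \<and> \<sigma> (\<psi> (\<phi> x)) = \<tau> (\<theta> x)"
  shows "compose P (compose Q \<sigma> \<psi>) \<phi> = compose P \<tau> \<theta>"
  using assms by (auto simp: compose_def restrict_def fun_eq_iff)

text \<open>Covers simplices and powers of \<open>J\<close> alike. Nonemptiness guarantees that the
  empty space has no singular maps, so that homology relative to \<open>{}\<close> is absolute
  homology.\<close>

locale singular_model =
  fixes M :: "nat \<Rightarrow> 's cspace"
  assumes cs_M: "closure_space (M n)" and ne_M: "pts (M n) \<noteq> {}"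
begin

lemma sing_restrict:
  "cont (M n) X f \<Longrightarrow> restrict f (pts (M n)) \<in> sing M X n"
  using cont_cong[OF cs_M, of n "restrict f (pts (M n))" f X] by (simp add: sing_simplices_def)

lemma sing_cont: "\<sigma> \<in> sing M X n \<Longrightarrow> cont (M n) X \<sigma>"
  and sing_ext: "\<sigma> \<in> sing M X n \<Longrightarrow> \<sigma> \<in> extensional (pts (M n))"
  by (simp_all add: sing_simplices_def)

lemma sing_pts: "\<sigma> \<in> sing M X n \<Longrightarrow> x \<in> pts (M n) \<Longrightarrow> \<sigma> x \<in> pts X"
  using cont_image sing_cont by fastforce

lemma sing_pull:
  assumes "\<sigma> \<in> sing M X k" "cont (M n) (M k) \<phi>"
  shows "compose (pts (M n)) \<sigma> \<phi> \<in> sing M X n"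
  using sing_restrict[OF cont_compose[OF assms(2) sing_cont[OF assms(1)]]]
  by (simp add: compose_def comp_def)

lemma sing_push:
  assumes "\<sigma> \<in> sing M X n" "cont X Y f"
  shows "compose (pts (M n)) f \<sigma> \<in> sing M Y n"
  using sing_restrict[OF cont_compose[OF sing_cont[OF assms(1)] assms(2)]]
  by (simp add: compose_def comp_def)

lemma sing_subspace_iff:
  "A \<subseteq> pts X \<Longrightarrow> \<sigma> \<in> sing M (subspace X A) n \<longleftrightarrow> \<sigma> \<in> sing M X n \<and> \<sigma> ` pts (M n) \<subseteq> A"
  by (auto simp: sing_simplices_def cont_into_subspace[OF cs_M])

lemma sing_subspace_simps:
  assumes "space_pair X A"
  shows "sing M (subspace X A) n \<subseteq> sing M X n"
    "space_pair X B \<Longrightarrow> sing M (subspace X A) n \<inter> sing M (subspace X B) n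
      = sing M (subspace X (A \<inter> B)) n"
    "sing M (subspace X {}) n = {}"
proof -
  have A: "A \<subseteq> pts X" "A \<inter> B \<subseteq> pts X" for B using assms by (auto simp: space_pair_def)
  show "sing M (subspace X A) n \<subseteq> sing M X n"
    using sing_subspace_iff[OF A(1)] by blast
  show "sing M (subspace X A) n \<inter> sing M (subspace X B) n
      = sing M (subspace X (A \<inter> B)) n" if "space_pair X B"
    using sing_subspace_iff[OF A(1)] sing_subspace_iff[OF A(2)] sing_subspace_iff[of B X] that
    by (auto simp: space_pair_def)
  show "sing M (subspace X {}) n = {}"
    using sing_subspace_iff[of "{}" X] ne_M by auto
qed

lemma push_S:
  assumes "cont X Y f" "c \<in> ch (sing M X n)" shows "push M n f c \<in> ch (sing M Y n)"
  unfolding push_def using assms(2) by (rule extend_ch) (simp add: sing_push assms(1))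

lemma push_cong:
  assumes "c \<in> ch (sing M X n)" "\<And>x. x \<in> pts X \<Longrightarrow> f x = g x"
  shows "push M n f c = push M n g c"
  unfolding push_def
proof (rule frag_extend_eq)
  fix \<sigma> assume "\<sigma> \<in> Poly_Mapping.keys c"
  then have "\<sigma> \<in> sing M X n" using assms(1) by (auto simp: ch_def)
  then have "compose (pts (M n)) f \<sigma> = compose (pts (M n)) g \<sigma>"
    using assms(2) sing_pts[of \<sigma> X n] by (auto simp: compose_def restrict_def fun_eq_iff)
  then show "frag_of (compose (pts (M n)) f \<sigma>) = frag_of (compose (pts (M n)) g \<sigma>)" by simp
qed

lemma push_compose: "push M n (g \<circ> f) c = push M n g (push M n f c)"
proof -
  have "compose (pts (M n)) (g \<circ> f) \<sigma> = compose (pts (M n)) g (compose (pts (M n)) f \<sigma>)" for \<sigma>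
    by (auto simp: compose_def restrict_def fun_eq_iff)
  then show ?thesis
    using frag_extend_compose[of "\<lambda>\<sigma>. frag_of (compose (pts (M n)) g \<sigma>)" "compose (pts (M n)) f" c]
    by (simp add: push_def comp_def)
qed

lemma push_id: "c \<in> ch (sing M X n) \<Longrightarrow> push M n id c = c"
proof (induction c rule: ch_induct)
  case (one \<sigma>)
  have "compose (pts (M n)) id \<sigma> = \<sigma>"
    using sing_ext[OF one] by (auto simp: compose_def restrict_def fun_eq_iff extensional_def)
  then show ?case unfolding push_def frag_extend_of by (rule arg_cong)
qed (simp_all add: push_diff, simp add: push_def)

lemma push_pull:
  "\<phi> ` pts (M n) \<subseteq> pts (M k) \<Longrightarrow>
    compose (pts (M n)) (compose (pts (M k)) f \<sigma>) \<phi> = compose (pts (M n)) f (compose (pts (M n)) \<sigma> \<phi>)"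
  by (auto simp: compose_def restrict_def fun_eq_iff image_subset_iff)

end

section \<open>Singular simplices\<close>

definition simplex_bd :: "(nat \<Rightarrow> 's cspace) \<Rightarrow> (nat \<Rightarrow> 's \<Rightarrow> 's) \<Rightarrow> nat \<Rightarrow> (('s \<Rightarrow> 'a) \<Rightarrow>\<^sub>0 int) \<Rightarrow> (('s \<Rightarrow> 'a) \<Rightarrow>\<^sub>0 int)" where
  "simplex_bd M d n = frag_extend (\<lambda>\<sigma>. \<Sum>i=0..n. frag_cmul ((-1) ^ i) (frag_of (compose (pts (M (n - 1))) \<sigma> (d i))))"

lemma simplex_bd_diff: "simplex_bd M d n (x - y) = simplex_bd M d n x - simplex_bd M d n y"
  by (simp add: simplex_bd_def frag_extend_diff)

lemma simplex_bd_0 [simp]: "simplex_bd M d n 0 = 0"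
  by (simp add: simplex_bd_def)

lemma simplex_bd_of: "simplex_bd M d (Suc n) (frag_of \<sigma>) =
    (\<Sum>i=0..Suc n. frag_cmul ((-1) ^ i) (frag_of (compose (pts (M n)) \<sigma> (d i))))"
  by (simp add: simplex_bd_def)

locale simplicial_model = singular_model M for M :: "nat \<Rightarrow> 's cspace" +
  fixes d :: "nat \<Rightarrow> 's \<Rightarrow> 's"
  assumes d_cont: "i \<le> Suc n \<Longrightarrow> cont (M n) (M (Suc n)) (d i)"
    and d_d: "i \<le> j \<Longrightarrow> j \<le> Suc n \<Longrightarrow> x \<in> pts (M n) \<Longrightarrow> d (Suc j) (d i x) = d i (d j x)"
begin

lemma d_pts: "i \<le> Suc n \<Longrightarrow> x \<in> pts (M n) \<Longrightarrow> d i x \<in> pts (M (Suc n))"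
  using cont_image[OF d_cont] by blast

lemma simplex_bd_simplex_bd: "c \<in> ch (sing M X (Suc (Suc n))) \<Longrightarrow> simplex_bd M d (Suc n) (simplex_bd M d (Suc (Suc n)) c) = 0"
proof (induction c rule: ch_induct)
  case (one \<sigma>)
  let ?F = "\<lambda>j i. frag_of (compose (pts (M n)) (compose (pts (M (Suc n))) \<sigma> (d j)) (d i))"
  have "simplex_bd M d (Suc n) (simplex_bd M d (Suc (Suc n)) (frag_of \<sigma>)) =
      (\<Sum>j\<in>{0..Suc (Suc n)}. \<Sum>i\<in>{0..Suc n}. frag_cmul ((-1) ^ (j + i)) (?F j i))"
    unfolding simplex_bd_of[of M d "Suc n"]
    by (simp only: simplex_bd_def frag_extend_sum frag_extend_cmul comp_def frag_cmul_sum frag_cmul_cmul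
        power_add finite_atLeastAtMost frag_extend_of diff_Suc_1)
  also have "\<dots> = 0"
  proof (rule boundary_sum_zero)
    fix i j assume ij: "i \<le> j" "j \<le> Suc n"
    have "compose (pts (M n)) (compose (pts (M (Suc n))) \<sigma> (d (Suc j))) (d i)
        = compose (pts (M n)) (compose (pts (M (Suc n))) \<sigma> (d i)) (d j)"
      using ij d_d d_pts by (intro compose_compose_eq) (auto simp: compose_def)
    then show "?F (Suc j) i = ?F i j" by simp
  qed simp
  finally show ?case .
qed (simp_all add: simplex_bd_diff)

lemma simplex_bd_S: "c \<in> ch (sing M X (Suc n)) \<Longrightarrow> simplex_bd M d (Suc n) c \<in> ch (sing M X n)"
  unfolding simplex_bd_def by (erule extend_ch, intro sum_ch cmul_ch) (simp add: sing_pull d_cont)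

lemma push_simplex_bd: "c \<in> ch (sing M X (Suc n)) \<Longrightarrow>
    simplex_bd M d (Suc n) (push M (Suc n) f c) = push M n f (simplex_bd M d (Suc n) c)"
proof (induction c rule: ch_induct)
  case (one \<sigma>)
  have "compose (pts (M n)) (compose (pts (M (Suc n))) f \<sigma>) (d i) = compose (pts (M n)) f (compose (pts (M n)) \<sigma> (d i))"
    if "i \<le> Suc n" for i using that d_pts by (intro push_pull) auto
  then show ?case
    by (auto simp add: push_def simplex_bd_of frag_extend_sum frag_extend_cmul simp del: sum.cl_ivl_Suc intro!: sum.cong)
qed (simp_all add: simplex_bd_diff push_diff, simp_all add: push_def simplex_bd_def)

text \<open>The simplicial complex divides out nothing, and a chain is already an element of the
  free group; hence the empty \<open>D\<close> and the identity as presentation.\<close>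

lemma chain_model: "chain_model (sing M) (\<lambda>_. {}) (simplex_bd M d) (simplicial_cx M d) (simplicial_map M) (\<lambda>X n c. c)"
proof
  fix X :: "'a cspace" and c n assume X: "closure_space X"
  show "sing M (subspace X {}) n = {}"
    using sing_subspace_simps(3)[of X "{}"] X by (simp add: space_pair_def)
  show "pres (grp (simplicial_cx M d X) n) (ch (sing M X n)) (ch {}) (\<lambda>c. c)"
    by (simp add: simplicial_cx_def pres_free)
  show "bdry (simplicial_cx M d X) (Suc n) c = simplex_bd M d (Suc n) c"
    by (simp add: simplicial_cx_def simplex_bd_def)
next
  fix X :: "'a cspace" and A c n assume X: "space_pair X A" and c: "c \<in> ch (sing M (subspace X A) n)"
  then show "simplicial_map M n X id c = c"
    using push_id by (simp add: simplicial_map_def push_def)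
qed (simp_all add: sing_subspace_simps(1,2) simplex_bd_diff simplex_bd_S simplex_bd_simplex_bd ch_empty)

lemma chain_model_map:
  "chain_model_map (sing M) (\<lambda>_. {}) (simplex_bd M d) (simplicial_cx M d) (simplicial_map M) (\<lambda>X n c. c)
    (sing M) (\<lambda>_. {}) (simplex_bd M d) (simplicial_cx M d) (simplicial_map M) (\<lambda>X n c. c) (push M) (simplicial_map M)"
  by (intro chain_model_map.intro chain_model chain_model_map_axioms.intro)
     (auto simp: push_diff push_S push_simplex_bd simplicial_map_eq ch_empty push_0 intro: push_cong)

lemma chain_model_self:
  "chain_model_self (sing M) (\<lambda>_. {}) (simplex_bd M d) (simplicial_cx M d) (simplicial_map M) (\<lambda>X n c. c) (push M)"
  by (intro chain_model_self.intro chain_model_map chain_model_self_axioms.intro push_id)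

lemma sing_point:
  assumes "closure_space X" "pts X = {x}"
  shows "sing M X n = {restrict (\<lambda>_. x) (pts (M n))}"
proof -
  have "\<sigma> = restrict (\<lambda>_. x) (pts (M n))" if "\<sigma> \<in> sing M X n" for \<sigma>
    using sing_ext[OF that] sing_pts[OF that] assms(2) by (auto simp: extensional_def restrict_def fun_eq_iff)
  moreover have "restrict (\<lambda>_. x) (pts (M n)) \<in> sing M X n"
    using cont_const[OF cs_M assms(1)] assms(2) by (intro sing_restrict) auto
  ultimately show ?thesis by blast
qed

text \<open>In degree \<open>Suc n\<close> there are \<open>n + 2\<close> equal faces with
  alternating signs, so one survives exactly when \<open>n\<close> is odd.\<close>

lemma simplex_bd_point:
  "simplex_bd M d (Suc n) (frag_of (restrict (\<lambda>_. x) (pts (M (Suc n))))) =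
    (if odd n then frag_of (restrict (\<lambda>_. x) (pts (M n))) else 0)"
proof -
  have "compose (pts (M n)) (restrict (\<lambda>_. x) (pts (M (Suc n)))) (d i) = restrict (\<lambda>_. x) (pts (M n))"
    if "i \<le> Suc n" for i using that d_pts by (auto simp: compose_def restrict_def fun_eq_iff)
  then have "simplex_bd M d (Suc n) (frag_of (restrict (\<lambda>_. x) (pts (M (Suc n))))) =
      (\<Sum>i=0..Suc n. frag_cmul ((-1) ^ i) (frag_of (restrict (\<lambda>_. x) (pts (M n)))))"
    unfolding simplex_bd_of by (intro sum.cong) auto
  also have "(\<Sum>i=0..k. frag_cmul ((-1) ^ i) c) = (if even k then c else 0)" for k and c :: "('s \<Rightarrow> 'a) \<Rightarrow>\<^sub>0 int"
    by (induction k) auto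
  finally show ?thesis by simp
qed

text \<open>In positive even degree the only generator has nonzero boundary, so 0 is the only cycle;
  in odd degree the generator is the boundary of the next one.\<close>

lemma dimension:
  fixes X :: "'a cspace"
  assumes X: "closure_space X" "pts X = {x}" and n: "n \<ge> 1"
  shows "chain_model.rel_cyc (sing M) (\<lambda>_. {}) (simplex_bd M d) X {} n
    \<subseteq> chain_model.rel_bdry (sing M) (\<lambda>_. {}) (simplex_bd M d) X {} n"
proof
  interpret chain_model "sing M" "\<lambda>_. {}" "simplex_bd M d" "simplicial_cx M d"
    "simplicial_map M :: ('a, _, 'a, _) cx_map" "\<lambda>X n c. c" by (rule chain_model)
  let ?k = "\<lambda>n. frag_of (restrict (\<lambda>_. x) (pts (M n))) :: ('s \<Rightarrow> 'a) \<Rightarrow>\<^sub>0 int"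
  fix c assume c: "c \<in> rel_cyc X {} n"
  obtain k where k: "n = Suc k" using n by (cases n) auto
  have cS: "c \<in> ch {restrict (\<lambda>_. x) (pts (M n))}" using c sing_point[OF X] by (simp add: rel_cyc_def)
  have d0: "simplex_bd M d (Suc k) c = 0" using c k rel_null_empty[OF X(1)] by (simp add: rel_cyc_def ch_def)
  show "c \<in> rel_bdry X {} n"
  proof (cases "odd k")
    case True
    have "\<exists>m. c = frag_cmul m (?k n)"
      using cS
    proof (induction c rule: ch_induct)
      case zero
      show ?case by (rule exI[of _ 0]) simp
    next
      case (one \<sigma>)
      then show ?case by (intro exI[of _ 1]) (simp only: frag_cmul_one singleton_iff)
    next
      case (diff a b)
      then show ?case by (metis frag_cmul_diff_distrib)
    qed
    then obtain m where m: "c = frag_cmul m (?k n)" by blast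
    then have "frag_cmul m (?k k) = 0"
      using d0 simplex_bd_point[of k x] True k by (simp add: simplex_bd_def frag_extend_cmul)
    then have "c = 0" using m by simp
    then show ?thesis using rel_null_in_rel_bdry[OF rel_null_zero] by simp
  next
    case False
    have kB: "?k n \<in> rel_bdry X {} n"
      using simplex_bd_point[of n x] sing_point[OF X, of "Suc n"] False k
      by (intro in_rel_bdry[of "?k (Suc n)"]) auto
    show ?thesis
      using cS
      by (induction c rule: ch_induct)
        (use kB in \<open>auto intro: add_subgroup_zero[OF add_subgroup_rel_bdry] add_subgroup_diff[OF add_subgroup_rel_bdry]\<close>)
  qed
qed

end

text \<open>The maps \<open>x \<mapsto> (s i x, t i x)\<close> are the simplices of the standard triangulation of the prism.\<close>

locale simplicial_prism = simplicial_model M d for M :: "nat \<Rightarrow> 's cspace" and d +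
  fixes J :: "real cspace" and s :: "nat \<Rightarrow> 's \<Rightarrow> 's" and t :: "nat \<Rightarrow> 's \<Rightarrow> real"
  assumes cs_J: "closure_space J"
    and s_cont: "i \<le> n \<Longrightarrow> cont (M (Suc n)) (M n) (s i)"
    and t_cont: "i \<le> n \<Longrightarrow> cont (M (Suc n)) J (t i)"
    and s_d_le: "j \<le> i \<Longrightarrow> i < n \<Longrightarrow> x \<in> pts (M n) \<Longrightarrow> s (Suc i) (d j x) = d j (s i x) \<and> t (Suc i) (d j x) = t i x"
    and s_d_gt: "i < j \<Longrightarrow> j \<le> n \<Longrightarrow> x \<in> pts (M n) \<Longrightarrow> s i (d (Suc j) x) = d j (s i x) \<and> t i (d (Suc j) x) = t i x"
    and s_d_eq: "i \<le> n \<Longrightarrow> x \<in> pts (M n) \<Longrightarrow> s i (d i x) = x \<and> s i (d (Suc i) x) = x"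
    and t_d: "i < n \<Longrightarrow> x \<in> pts (M n) \<Longrightarrow> t (Suc i) (d (Suc i) x) = t i (d (Suc i) x)"
    and t_d_0: "x \<in> pts (M n) \<Longrightarrow> t 0 (d 0 x) = 1"
    and t_d_n: "x \<in> pts (M n) \<Longrightarrow> t n (d (Suc n) x) = 0"
begin

text \<open>Composing with \<open>id\<close> only restricts the function to the simplex; it brings
  each piece into the shape handled by \<open>compose_compose_eq\<close>.\<close>

definition prism :: "('a \<times> real \<Rightarrow> 'b) \<Rightarrow> nat \<Rightarrow> (('s \<Rightarrow> 'a) \<Rightarrow>\<^sub>0 int) \<Rightarrow> (('s \<Rightarrow> 'b) \<Rightarrow>\<^sub>0 int)" where
  "prism H n = frag_extend (\<lambda>\<sigma>. \<Sum>i=0..n. frag_cmul ((-1) ^ i)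
    (frag_of (compose (pts (M (Suc n))) (\<lambda>x. H (\<sigma> (s i x), t i x)) id)))"

lemma prism_diff: "prism H n (x - y) = prism H n x - prism H n y"
  by (simp add: prism_def frag_extend_diff)

lemma prism_S:
  assumes X: "closure_space X" and H: "cont (cprod X J) Y H" and c: "c \<in> ch (sing M X n)"
  shows "prism H n c \<in> ch (sing M Y (Suc n))"
  unfolding prism_def using c
proof (rule extend_ch)
  fix \<sigma> assume \<sigma>: "\<sigma> \<in> sing M X n"
  have "compose (pts (M (Suc n))) (\<lambda>x. H (\<sigma> (s i x), t i x)) id \<in> sing M Y (Suc n)" if "i \<le> n" for i
  proof -
    have "cont (M (Suc n)) (cprod X J) (\<lambda>x. ((\<sigma> \<circ> s i) x, t i x))"
      by (rule cont_Pair[OF cs_M X cs_J cont_compose[OF s_cont[OF that] sing_cont[OF \<sigma>]] t_cont[OF that]])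
    from sing_restrict[OF cont_compose[OF this H]] show ?thesis by (simp add: compose_def comp_def)
  qed
  then show "(\<Sum>i=0..n. frag_cmul ((-1) ^ i)
    (frag_of (compose (pts (M (Suc n))) (\<lambda>x. H (\<sigma> (s i x), t i x)) id))) \<in> ch (sing M Y (Suc n))"
    by (auto intro!: sum_ch cmul_ch)
qed

text \<open>Off-diagonal faces of the pieces cancel against the prism over the boundary, and
  consecutive pieces share a diagonal face, so the diagonal telescopes. What remains is face 0 of
  piece 0, the top at height 1, minus the last face of piece \<open>n\<close>, the bottom at height
  0; hence \<open>g\<close> minus \<open>f\<close>.\<close>

lemma simplex_bd_prism:
  assumes c: "c \<in> ch (sing M X n)"
    and fg: "\<And>x. x \<in> pts X \<Longrightarrow> H (x, 0) = f x \<and> H (x, 1) = g x"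
  shows "simplex_bd M d (Suc n) (prism H n c) + (if n = 0 then 0 else prism H (n - 1) (simplex_bd M d n c))
    = push M n g c - push M n f c"
  using c
proof (induction c rule: ch_induct)
  case (one \<sigma>)
  let ?F = "\<lambda>i j. frag_of (compose (pts (M n)) (\<lambda>x. H (\<sigma> (s i (d j x)), t i (d j x))) id)"
  let ?G = "\<lambda>i j. frag_of (compose (pts (M n)) (\<lambda>x. H (\<sigma> (d j (s i x)), t i x)) id)"
  have c1: "compose (pts (M n)) (compose (pts (M (Suc n))) (\<lambda>x. H (\<sigma> (s i x), t i x)) id) (d j)
      = compose (pts (M n)) (\<lambda>x. H (\<sigma> (s i (d j x)), t i (d j x))) id" if "j \<le> Suc n" for i j
    using that d_pts by (intro compose_compose_eq) simp
  have 1: "simplex_bd M d (Suc n) (prism H n (frag_of \<sigma>)) =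
      (\<Sum>i\<in>{0..n}. \<Sum>j\<in>{0..Suc n}. frag_cmul ((-1) ^ (i + j)) (?F i j))"
  proof -
    have "simplex_bd M d (Suc n) (prism H n (frag_of \<sigma>)) =
      (\<Sum>i\<in>{0..n}. \<Sum>j\<in>{0..Suc n}. frag_cmul ((-1) ^ (i + j))
        (frag_of (compose (pts (M n)) (compose (pts (M (Suc n))) (\<lambda>x. H (\<sigma> (s i x), t i x)) id) (d j))))"
      by (simp only: prism_def simplex_bd_def frag_extend_sum frag_extend_cmul comp_def frag_cmul_sum frag_cmul_cmul
        power_add finite_atLeastAtMost frag_extend_of diff_Suc_1)
    also have "\<dots> = (\<Sum>i\<in>{0..n}. \<Sum>j\<in>{0..Suc n}. frag_cmul ((-1) ^ (i + j)) (?F i j))"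
      using c1 by (intro sum.cong refl) (simp only: atLeastAtMost_iff)
    finally show ?thesis .
  qed
  have 2: "(if n = 0 then 0 else prism H (n - 1) (simplex_bd M d n (frag_of \<sigma>))) =
      (\<Sum>i\<in>{0..<n}. \<Sum>j\<in>{0..n}. frag_cmul ((-1) ^ (i + j)) (?G i j))"
  proof (cases n)
    case (Suc k)
    have c2: "compose (pts (M n)) (\<lambda>x. H (compose (pts (M k)) \<sigma> (d j) (s i x), t i x)) id
      = compose (pts (M n)) (\<lambda>x. H (\<sigma> (d j (s i x)), t i x)) id" if "i \<le> k" for i j
    proof -
      have "s i x \<in> pts (M k)" if "x \<in> pts (M n)" for x
        using cont_image[OF s_cont[OF \<open>i \<le> k\<close>]] that Suc by auto
      then show ?thesis by (auto simp: compose_def restrict_def fun_eq_iff)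
    qed
    have "prism H k (simplex_bd M d (Suc k) (frag_of \<sigma>)) =
      (\<Sum>j\<in>{0..n}. \<Sum>i\<in>{0..k}. frag_cmul ((-1) ^ (j + i))
        (frag_of (compose (pts (M n)) (\<lambda>x. H (compose (pts (M k)) \<sigma> (d j) (s i x), t i x)) id)))"
      by (simp only: prism_def simplex_bd_def frag_extend_sum frag_extend_cmul comp_def frag_cmul_sum frag_cmul_cmul
        power_add finite_atLeastAtMost frag_extend_of diff_Suc_1 Suc)
    also have "\<dots> = (\<Sum>j\<in>{0..n}. \<Sum>i\<in>{0..k}. frag_cmul ((-1) ^ (i + j)) (?G i j))"
      using c2 by (intro sum.cong refl) (simp add: add.commute)
    also have "\<dots> = (\<Sum>i\<in>{0..k}. \<Sum>j\<in>{0..n}. frag_cmul ((-1) ^ (i + j)) (?G i j))"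
      by (rule sum.swap)
    finally show ?thesis using Suc by (simp add: atLeastLessThanSuc_atLeastAtMost del: sum.cl_ivl_Suc)
  qed simp
  have cong: "compose (pts (M n)) f id = compose (pts (M n)) g id" if "\<And>x. x \<in> pts (M n) \<Longrightarrow> f x = g x" for f g :: "'s \<Rightarrow> 'b"
    using that by (auto simp: compose_def restrict_def fun_eq_iff)
  have "(\<Sum>i\<in>{0..n}. \<Sum>j\<in>{0..Suc n}. frag_cmul ((-1) ^ (i + j)) (?F i j)) +
      (\<Sum>i\<in>{0..<n}. \<Sum>j\<in>{0..n}. frag_cmul ((-1) ^ (i + j)) (?G i j)) = (\<Sum>i\<in>{0..n}. ?F i i - ?F i (Suc i))"
  proof (rule homotopy_sum)
    show "?G i j = ?F (Suc i) j" if "j \<le> i" "i < n" for i j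
      using that s_d_le by (intro arg_cong[of _ _ frag_of] cong) simp
    show "?G i j = ?F i (Suc j)" if "i < j" "j \<le> n" for i j
      using that s_d_gt by (intro arg_cong[of _ _ frag_of] cong) simp
  qed
  also have "(\<Sum>i\<in>{0..n}. ?F i i - ?F i (Suc i)) = ?F 0 0 - ?F n (Suc n)"
  proof -
    \<comment> \<open>Neighboring pieces meet in this face: \<open>s_d_eq\<close> makes both
      projections the identity there, and \<open>t_d\<close> equates the heights.\<close>
    have "?F (Suc i) (Suc i) = ?F i (Suc i)" if "i < n" for i
      using that s_d_eq[of i n] s_d_eq[of "Suc i" n] t_d[of i n] by (intro arg_cong[of _ _ frag_of] cong) simp
    then have "(\<Sum>i\<in>{0..k}. ?F i i - ?F i (Suc i)) = ?F 0 0 - ?F k (Suc k)" if "k \<le> n" for k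
      using that by (induction k) auto
    then show ?thesis by blast
  qed
  also have "?F 0 0 = push M n g (frag_of \<sigma>)"
    unfolding push_def frag_extend_of using s_d_eq[of 0 n] t_d_0[of _ n] sing_pts[OF one] fg
    by (intro arg_cong[of _ _ frag_of]) (auto simp: compose_def restrict_def fun_eq_iff)
  also have "?F n (Suc n) = push M n f (frag_of \<sigma>)"
    unfolding push_def frag_extend_of using s_d_eq[of n n] t_d_n[of _ n] sing_pts[OF one] fg
    by (intro arg_cong[of _ _ frag_of]) (auto simp: compose_def restrict_def fun_eq_iff)
  finally show ?case by (simp only: 1 2)
next
  case (diff a b)
  have "simplex_bd M d (Suc n) (prism H n (a - b)) + (if n = 0 then 0 else prism H (n - 1) (simplex_bd M d n (a - b)))
    = (simplex_bd M d (Suc n) (prism H n a) + (if n = 0 then 0 else prism H (n - 1) (simplex_bd M d n a)))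
    - (simplex_bd M d (Suc n) (prism H n b) + (if n = 0 then 0 else prism H (n - 1) (simplex_bd M d n b)))"
    by (simp add: simplex_bd_diff prism_diff)
  then show ?case by (simp only: diff.IH push_diff) simp
qed (simp_all add: push_def prism_def simplex_bd_def)

lemma homotopy:
  fixes X :: "'a cspace" and Y :: "'b cspace"
  assumes X: "closure_space X" and Y: "closure_space Y" and h: "one_step_homotopic J X Y f g"
    and z: "z \<in> chain_model.rel_cyc (sing M) (\<lambda>_. {}) (simplex_bd M d) X {} n"
  shows "push M n f z - push M n g z \<in> chain_model.rel_bdry (sing M) (\<lambda>_. {}) (simplex_bd M d) Y {} n"
proof -
  interpret A: chain_model "sing M" "\<lambda>_. {}" "simplex_bd M d" "simplicial_cx M d"
    "simplicial_map M :: ('a, _, 'a, _) cx_map" "\<lambda>X n c. c" by (rule chain_model)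
  interpret B: chain_model "sing M" "\<lambda>_. {}" "simplex_bd M d" "simplicial_cx M d"
    "simplicial_map M :: ('b, _, 'b, _) cx_map" "\<lambda>X n c. c" by (rule chain_model)
  obtain H where H: "cont (cprod X J) Y H" "\<And>x. x \<in> pts X \<Longrightarrow> H (x, 0) = f x \<and> H (x, 1) = g x"
    using h unfolding one_step_homotopic_def by blast
  have zS: "z \<in> ch (sing M X n)" using z by (simp add: A.rel_cyc_def)
  have "(if n = 0 then 0 else prism H (n - 1) (simplex_bd M d n z)) = 0"
    using z A.rel_null_empty[OF X] by (cases n) (auto simp: A.rel_cyc_def ch_def prism_def)
  \<comment> \<open>The prism yields \<open>g\<close> minus \<open>f\<close>, so its negative bounds
    the difference required here.\<close>
  then have "push M n f z - push M n g z - simplex_bd M d (Suc n) (- prism H n z) = 0"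
    using simplex_bd_prism[OF zS H(2)] by (simp add: B.bd_minus algebra_simps)
  then show ?thesis using B.in_rel_bdry[OF minus_ch[OF prism_S[OF X H(1) zS]]] by simp
qed

lemma homology_theory_simplicial:
  assumes small: "\<And>n (X :: 'a cspace) A B z. closure_space X \<Longrightarrow> interior_cover X {A, B} \<Longrightarrow> z \<in> ch (sing M X n) \<Longrightarrow>
      (\<And>k. n = Suc k \<Longrightarrow> simplex_bd M d n z \<in> ch (sing M (subspace X A) k \<union> sing M (subspace X B) k)) \<Longrightarrow>
      \<exists>w\<in>ch (sing M X (Suc n)). z - simplex_bd M d (Suc n) w \<in> ch (sing M (subspace X A) n \<union> sing M (subspace X B) n)"
  shows "homology_theory J (simp_H M d :: ('a, _) pair_groups) (simp_H M d :: ('b, _) pair_groups)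
    (simp_H M d :: ('c, _) pair_groups) (simp_map M d) (simp_map M d) (simp_map M d) (simp_map M d)
    (simp_conn M d) (simp_conn M d)"
proof -
  have sm: "simp_map M d = (\<lambda>n X A Y B f. rel_hom_map (simplicial_cx M d) (simplicial_map M) (simplicial_map M) n Y B f)"
    by (intro ext) (simp add: simp_map_def)
  show ?thesis
    unfolding simp_H_def simp_conn_def sm
  proof (rule homology_theory_chain_model[OF chain_model_self chain_model_map chain_model_map chain_model_map])
    show "\<And>n X f g c. push M n (g \<circ> f) c = push M n g (push M n f c)" by (rule push_compose)
  qed (use homotopy dimension small in simp_all)
qed

end

section \<open>Excision\<close>

context chain_model
begin

text \<open>A chain \<open>z\<close> and its subdivision differ by a boundary and by the term \<open>T (bd z)\<close>, which is small
  because \<open>bd z\<close> is; hence \<open>z\<close> may be replaced by its iterated subdivisions.\<close>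

lemma small_by_subdivision:
  fixes X :: "'a cspace" and A B :: "'a set"
  assumes AB: "space_pair X A" "space_pair X B"
    and Sd_diff: "\<And>n x y. Sd n (x - y) = Sd n x - Sd n y" and T_diff: "\<And>n x y. T n (x - y) = T n x - T n y"
    and Sd_S: "\<And>(X :: 'a cspace) n c. closure_space X \<Longrightarrow> c \<in> ch (S X n) \<Longrightarrow> Sd n c \<in> ch (S X n)"
    and T_S: "\<And>(X :: 'a cspace) n c. closure_space X \<Longrightarrow> c \<in> ch (S X n) \<Longrightarrow> T n c \<in> ch (S X (Suc n))"
    and Sd_D: "\<And>n c. c \<in> ch (D n) \<Longrightarrow> Sd n c \<in> ch (D n)" and T_D: "\<And>n c. c \<in> ch (D n) \<Longrightarrow> T n c \<in> ch (D (Suc n))"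
    and chain: "\<And>n c. c \<in> ch (S X (Suc n)) \<Longrightarrow> bd (Suc n) (Sd (Suc n) c) - Sd n (bd (Suc n) c) \<in> ch (D n)"
    and homotopy: "\<And>n c. c \<in> ch (S X n) \<Longrightarrow>
      bd (Suc n) (T n c) + (case n of 0 \<Rightarrow> 0 | Suc k \<Rightarrow> T k (bd n c)) - (Sd n c - c) \<in> ch (D n)"
    and small: "\<And>n \<sigma>. \<sigma> \<in> S X n \<Longrightarrow>
      \<exists>m. (Sd n ^^ m) (frag_of \<sigma>) \<in> ch (S (subspace X A) n \<union> S (subspace X B) n \<union> D n)"
    and z: "z \<in> ch (S X n)"
      "\<And>k. n = Suc k \<Longrightarrow> bd n z \<in> ch (S (subspace X A) k \<union> S (subspace X B) k \<union> D k)"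
  shows "\<exists>w\<in>ch (S X (Suc n)). z - bd (Suc n) w \<in> ch (S (subspace X A) n \<union> S (subspace X B) n \<union> D n)"
proof -
  have cs: "closure_space X" "closure_space (subspace X A)" "closure_space (subspace X B)"
    using AB by (simp_all add: space_pair_def closure_space_subspace)
  let ?U = "\<lambda>n. S (subspace X A) n \<union> S (subspace X B) n \<union> D n"
  have Sd0: "Sd n 0 = 0" and T0: "T n 0 = 0" for n using Sd_diff[of n 0 0] T_diff[of n 0 0] by simp_all
  have U_Sd: "Sd n c \<in> ch (?U n)" if "c \<in> ch (?U n)" for n c
    using that
  proof (induction c rule: ch_induct)
    case (one \<sigma>)
    then show ?case
      using Sd_S[OF cs(2), of "frag_of \<sigma>" n] Sd_S[OF cs(3), of "frag_of \<sigma>" n] Sd_D[of "frag_of \<sigma>" n]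
      by (auto simp: ch_def)
  qed (auto simp: Sd0 Sd_diff intro: diff_ch)
  have U_T: "T n c \<in> ch (?U (Suc n))" if "c \<in> ch (?U n)" for n c
    using that
  proof (induction c rule: ch_induct)
    case (one \<sigma>)
    then show ?case
      using T_S[OF cs(2), of "frag_of \<sigma>" n] T_S[OF cs(3), of "frag_of \<sigma>" n] T_D[of "frag_of \<sigma>" n]
      by (auto simp: ch_def)
  qed (auto simp: T0 T_diff intro: diff_ch)
  have U_pow: "(Sd n ^^ m) c \<in> ch (?U n)" if "c \<in> ch (?U n)" for n m c
    using that U_Sd by (induction m) auto
  have pow_diff: "(Sd n ^^ m) (x - y) = (Sd n ^^ m) x - (Sd n ^^ m) y" for n m x y
    by (induction m) (auto simp: Sd_diff)
  have pow_0: "(Sd n ^^ m) 0 = 0" for n m by (induction m) (auto simp: Sd0)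
  have ex: "\<exists>m. (Sd n ^^ m) c \<in> ch (?U n)" if "c \<in> ch (S X n)" for c n
    using that
  proof (induction c rule: ch_induct)
    case zero
    then show ?case by (auto simp: pow_0)
  next
    case (one \<sigma>)
    then show ?case using small by blast
  next
    case (diff a b)
    then obtain i j where "(Sd n ^^ i) a \<in> ch (?U n)" "(Sd n ^^ j) b \<in> ch (?U n)" by blast
    \<comment> \<open>Different simplices may need different numbers of subdivisions. Small chains
      stay small under \<open>Sd\<close>, so the sum of the two exponents serves both.\<close>
    then have "(Sd n ^^ j) ((Sd n ^^ i) a) \<in> ch (?U n)" "(Sd n ^^ i) ((Sd n ^^ j) b) \<in> ch (?U n)"
      using U_pow by blast+
    then have "(Sd n ^^ (j + i)) a \<in> ch (?U n)" "(Sd n ^^ (i + j)) b \<in> ch (?U n)"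
      by (simp_all add: funpow_add)
    then have "(Sd n ^^ (i + j)) a \<in> ch (?U n)" "(Sd n ^^ (i + j)) b \<in> ch (?U n)"
      unfolding add.commute[of j i] .
    then show ?case by (auto simp: pow_diff intro!: exI[of _ "i + j"] diff_ch)
  qed
  have DU: "c \<in> ch (D k) \<Longrightarrow> c \<in> ch (?U k)" for c k by (rule ch_mono[rotated]) auto
  have "\<exists>w\<in>ch (S X (Suc n)). z - bd (Suc n) w \<in> ch (?U n)"
    if "(Sd n ^^ m) z \<in> ch (?U n)" "z \<in> ch (S X n)" "\<And>k. n = Suc k \<Longrightarrow> bd n z \<in> ch (?U k)" for m z
    using that
  proof (induction m arbitrary: z)
    case 0
    then show ?case by (intro bexI[of _ 0]) auto
  next
    case (Suc m)
    \<comment> \<open>Smallness of the boundary has to survive the passage from \<open>z\<close> to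
      \<open>Sd n z\<close>, since the induction hypothesis asks for it again.\<close>
    have "bd n (Sd n z) \<in> ch (?U k)" if k: "n = Suc k" for k
    proof -
      have "Sd k (bd n z) \<in> ch (?U k)" using U_Sd Suc.prems(3)[OF k] by blast
      moreover have "bd (Suc k) (Sd (Suc k) z) - Sd k (bd (Suc k) z) \<in> ch (?U k)"
        using DU[OF chain[of z k]] Suc.prems(2) k by simp
      ultimately show ?thesis using add_ch[of "Sd k (bd n z)" "?U k"] k by force
    qed
    moreover have "(Sd n ^^ m) (Sd n z) \<in> ch (?U n)" using Suc.prems(1) by (simp add: funpow_swap1)
    ultimately obtain w where w: "w \<in> ch (S X (Suc n))" "Sd n z - bd (Suc n) w \<in> ch (?U n)"
      using Suc.IH[OF _ Sd_S[OF cs(1) Suc.prems(2)]] by blast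
    let ?t = "case n of 0 \<Rightarrow> 0 | Suc k \<Rightarrow> T k (bd n z)"
    have t: "?t \<in> ch (?U n)" using U_T Suc.prems(3) by (cases n) auto
    \<comment> \<open>The bounding chain for \<open>z\<close> is the one for \<open>Sd n z\<close>
      corrected by \<open>T n z\<close>; the last bracket is the degenerate error of the homotopy
      identity.\<close>
    have "z - bd (Suc n) (w - T n z) = (Sd n z - bd (Suc n) w) - ?t + (bd (Suc n) (T n z) + ?t - (Sd n z - z))"
      by (simp add: bd_diff)
    also have "\<dots> \<in> ch (?U n)" by (rule add_ch[OF diff_ch[OF w(2) t] DU[OF homotopy[OF Suc.prems(2)]]])
    finally show ?case using diff_ch[OF w(1) T_S[OF cs(1) Suc.prems(2)]] by blast
  qed
  then show ?thesis using ex[OF z(1)] z by blast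
qed

end

context singular_model
begin

text \<open>Such a point exists for \<open>J_1\<close> and \<open>J_plus\<close>, so that no subdivision is needed there.\<close>

lemma sing_small_of_point:
  assumes X: "closure_space X" and cov: "interior_cover X {A, B}"
    and x: "x \<in> pts (M n)" "\<And>V. nbhd (M n) x V \<Longrightarrow> V = pts (M n)"
  shows "sing M X n \<subseteq> sing M (subspace X A) n \<union> sing M (subspace X B) n"
proof
  fix \<sigma> assume \<sigma>: "\<sigma> \<in> sing M X n"
  have AB: "A \<subseteq> pts X" "B \<subseteq> pts X" using cov unfolding interior_cover_def by blast+
  have c: "\<forall>x\<in>pts (M n). \<forall>V. nbhd X (\<sigma> x) V \<longrightarrow> nbhd (M n) x {z \<in> pts (M n). \<sigma> z \<in> V}"
    using sing_cont[OF \<sigma>] unfolding cont_iff_nbhd[OF cs_M X] by (rule conjunct2)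
  have "{z \<in> pts (M n). \<sigma> z \<in> U} = pts (M n)" if "nbhd X (\<sigma> x) U" for U
    by (rule x(2)[OF c[rule_format, OF x(1) that]])
  moreover have "nbhd X (\<sigma> x) A \<or> nbhd X (\<sigma> x) B"
    using interior_cover_nbhd[OF cov sing_pts[OF \<sigma> x(1)]] .
  ultimately have "{z \<in> pts (M n). \<sigma> z \<in> A} = pts (M n) \<or> {z \<in> pts (M n). \<sigma> z \<in> B} = pts (M n)" by blast
  then have "\<sigma> ` pts (M n) \<subseteq> A \<or> \<sigma> ` pts (M n) \<subseteq> B" by auto
  then show "\<sigma> \<in> sing M (subspace X A) n \<union> sing M (subspace X B) n"
    using \<sigma> by (simp add: sing_subspace_iff AB)
qed

end

lemma (in simplicial_prism) homology_theory_simplicial_of_point: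
  assumes x: "\<And>n. x n \<in> pts (M n)" "\<And>n V. nbhd (M n) (x n) V \<Longrightarrow> V = pts (M n)"
  shows "homology_theory J (simp_H M d :: ('a, _) pair_groups) (simp_H M d :: ('b, _) pair_groups)
    (simp_H M d :: ('c, _) pair_groups) (simp_map M d) (simp_map M d) (simp_map M d) (simp_map M d)
    (simp_conn M d) (simp_conn M d)"
proof (rule homology_theory_simplicial)
  fix n and X :: "'a cspace" and A B z
  assume X: "closure_space X" "interior_cover X {A, B}" and z: "z \<in> ch (sing M X n)"
  show "\<exists>w\<in>ch (sing M X (Suc n)). z - simplex_bd M d (Suc n) w \<in> ch (sing M (subspace X A) n \<union> sing M (subspace X B) n)"
    using ch_mono[OF sing_small_of_point[OF X x] z] by (intro bexI[of _ 0]) auto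
qed

section \<open>Combinatorial simplices\<close>

text \<open>Together, \<open>vertex_degeneracy i\<close> and \<open>vertex_height i\<close> run
  through the vertices \<open>(0,0), ..., (i,0), (i,1), ..., (n,1)\<close>, which span the
  \<open>i\<close>-th maximal simplex of the prism. Both maps are monotone, as continuity in the
  model \<open>J_plus\<close> demands.\<close>

definition vertex_degeneracy :: "nat \<Rightarrow> nat \<Rightarrow> nat" where
  "vertex_degeneracy i k = (if k \<le> i then k else k - 1)"

definition vertex_height :: "nat \<Rightarrow> nat \<Rightarrow> real" where
  "vertex_height i k = (if k \<le> i then 0 else 1)"

lemma pts_simplex_1 [simp]: "pts (simplex_1 n) = {0..n}"
  and pts_simplex_plus [simp]: "pts (simplex_plus n) = {0..n}"
  by (simp_all add: simplex_1_def simplex_plus_def)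

lemma simplicial_prism_1: "simplicial_prism simplex_1 face_vertex J_1 vertex_degeneracy vertex_height"
  by unfold_locales
     (auto simp: simplex_1_def J_1_def closure_space_indiscrete_cspace face_vertex_def vertex_degeneracy_def
       vertex_height_def intro!: cont_indiscrete_cspace)

lemma simplicial_prism_plus: "simplicial_prism simplex_plus face_vertex J_plus vertex_degeneracy vertex_height"
  by unfold_locales
     (auto simp: simplex_plus_def J_plus_def closure_space_up_cspace face_vertex_def vertex_degeneracy_def
       vertex_height_def mono_on_def intro!: cont_up_cspace)

lemma homology_theory_simplex_1:
  "homology_theory J_1 (simp_H simplex_1 face_vertex :: ('a, _) pair_groups) (simp_H simplex_1 face_vertex :: ('b, _) pair_groups)
    (simp_H simplex_1 face_vertex :: ('c, _) pair_groups)
    (simp_map simplex_1 face_vertex) (simp_map simplex_1 face_vertex) (simp_map simplex_1 face_vertex)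
    (simp_map simplex_1 face_vertex) (simp_conn simplex_1 face_vertex) (simp_conn simplex_1 face_vertex)"
  by (rule simplicial_prism.homology_theory_simplicial_of_point[OF simplicial_prism_1, of "\<lambda>_. 0"])
     (auto simp: simplex_1_def nbhd_indiscrete_cspace)

lemma homology_theory_simplex_plus:
  "homology_theory J_plus (simp_H simplex_plus face_vertex :: ('a, _) pair_groups) (simp_H simplex_plus face_vertex :: ('b, _) pair_groups)
    (simp_H simplex_plus face_vertex :: ('c, _) pair_groups)
    (simp_map simplex_plus face_vertex) (simp_map simplex_plus face_vertex) (simp_map simplex_plus face_vertex)
    (simp_map simplex_plus face_vertex) (simp_conn simplex_plus face_vertex) (simp_conn simplex_plus face_vertex)"
  \<comment> \<open>The point is the last vertex: its neighborhoods contain all vertices below it,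
    hence all vertices.\<close>
  by (rule simplicial_prism.homology_theory_simplicial_of_point[OF simplicial_prism_plus, of "\<lambda>n. n"])
     (auto simp: simplex_plus_def nbhd_up_cspace)

section \<open>Topological simplices\<close>

text \<open>Affine extension of \<open>vertex_degeneracy i\<close> in barycentric coordinates:
  vertices \<open>i\<close> and \<open>Suc i\<close> are identified, so their weights add
  up.\<close>

definition simplex_degeneracy :: "nat \<Rightarrow> (nat \<Rightarrow> real) \<Rightarrow> nat \<Rightarrow> real" where
  "simplex_degeneracy i x = (\<lambda>k. if k < i then x k else if k = i then x i + x (Suc i) else x (Suc k))"

text \<open>Affine extension of \<open>vertex_height i\<close>: the total weight of the vertices
  after \<open>i\<close>. Writing it as a complement keeps the dimension out of the formula.\<close>

definition simplex_height :: "nat \<Rightarrow> (nat \<Rightarrow> real) \<Rightarrow> real" where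
  "simplex_height i x = 1 - (\<Sum>k\<le>i. x k)"

abbreviation simplex_top :: "nat \<Rightarrow> (nat \<Rightarrow> real) topology" where
  "simplex_top n \<equiv> subtopology (powertop_real UNIV) (standard_simplex n)"

lemma pts_simplex_I [simp]: "pts (simplex_I n) = standard_simplex n"
  by (simp add: simplex_I_def)

lemma standard_simplex_iff:
  "x \<in> standard_simplex p \<longleftrightarrow> (\<forall>i. 0 \<le> x i) \<and> (\<forall>i>p. x i = 0) \<and> (\<Sum>i\<le>p. x i) = 1"
proof -
  have "x i \<le> 1" if "\<forall>i. 0 \<le> x i" "\<forall>i>p. x i = 0" "(\<Sum>i\<le>p. x i) = 1" for i
    using member_le_sum[of i "{..p}" x] that by (cases "i \<le> p") auto
  then show ?thesis by (auto simp: standard_simplex_def)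
qed

lemma sum_simplex_degeneracy: "i \<le> n \<Longrightarrow> (\<Sum>k\<le>n. simplex_degeneracy i x k) = (\<Sum>k\<le>Suc n. x k)"
proof (induction n rule: dec_induct)
  case base
  have "(\<Sum>k<i. simplex_degeneracy i x k) = (\<Sum>k<i. x k)" by (simp add: simplex_degeneracy_def)
  then show ?case by (simp add: lessThan_Suc_atMost[symmetric] simplex_degeneracy_def)
next
  case (step n)
  then show ?case by (simp add: simplex_degeneracy_def)
qed

lemma simplex_degeneracy_in: "i \<le> n \<Longrightarrow> x \<in> standard_simplex (Suc n) \<Longrightarrow> simplex_degeneracy i x \<in> standard_simplex n"
  using sum_simplex_degeneracy[of i n x] by (auto simp: standard_simplex_iff simplex_degeneracy_def)

lemma simplex_height_in:
  assumes "i \<le> n" "x \<in> standard_simplex n" shows "simplex_height i x \<in> {0..1}"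
proof -
  have "(\<Sum>k\<le>i. x k) \<le> (\<Sum>k\<le>n. x k)" "0 \<le> (\<Sum>k\<le>i. x k)"
    by (rule sum_mono2 sum_nonneg; use assms in \<open>simp add: standard_simplex_iff\<close>)+
  moreover have "(\<Sum>k\<le>n. x k) = 1" using assms(2) by (simp add: standard_simplex_iff)
  ultimately show ?thesis by (simp add: simplex_height_def)
qed

lemma continuous_map_coord: "continuous_map (simplex_top n) euclideanreal (\<lambda>x. x k)"
  by (intro continuous_map_from_subtopology continuous_map_product_projection) simp

lemma simplical_face_image: "k \<le> Suc n \<Longrightarrow> x \<in> standard_simplex n \<Longrightarrow> simplical_face k x \<in> standard_simplex (Suc n)"
  using simplical_face_in_standard_simplex[of "Suc n" k x] by simp

text \<open>A face map inserts a zero weight, so a partial sum reaching past that position is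
  unchanged apart from its length.\<close>

lemma sum_simplical_face: "j \<le> m \<Longrightarrow> (\<Sum>k<Suc m. simplical_face j x k) = (\<Sum>k<m. (x k :: real))"
proof (induction m rule: dec_induct)
  case base
  have "(\<Sum>k<j. simplical_face j x k) = (\<Sum>k<j. x k)" by (simp add: simplical_face_def)
  then show ?case by (simp add: simplical_face_def)
next
  case (step i)
  then show ?case by (simp add: simplical_face_def)
qed

lemma simplex_height_face:
  "j \<le> Suc i \<Longrightarrow> simplex_height (Suc i) (simplical_face j x) = simplex_height i x"
  "i < j \<Longrightarrow> simplex_height i (simplical_face j x) = simplex_height i x"
  "simplex_height 0 (simplical_face 0 x) = 1"
  "x \<in> standard_simplex n \<Longrightarrow> simplex_height n x = 0"
  using sum_simplical_face[of j "Suc i" x]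
  by (simp_all only: simplex_height_def lessThan_Suc_atMost) (simp_all add: simplical_face_def standard_simplex_iff)

lemma simplicial_prism_I: "simplicial_prism simplex_I face_I J_I simplex_degeneracy simplex_height"
proof
  fix i n :: nat assume "i \<le> Suc n"
  then show "cont (simplex_I n) (simplex_I (Suc n)) (face_I i)"
    unfolding simplex_I_def face_I_def
  proof (intro cont_top_cspace continuous_map_into_subtopology)
    have "continuous_map (simplex_top n) euclideanreal (\<lambda>x. simplical_face i x k)" for k
      unfolding simplical_face_def by (cases "k < i"; cases "k = i") (simp_all add: continuous_map_coord)
    then show "continuous_map (simplex_top n) (powertop_real UNIV) (simplical_face i)"
      by (simp add: continuous_map_componentwise_UNIV)
  qed (use \<open>i \<le> Suc n\<close> simplical_face_image in auto)
next
  fix i n :: nat assume "i \<le> n"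
  then show "cont (simplex_I (Suc n)) (simplex_I n) (simplex_degeneracy i)"
    unfolding simplex_I_def
  proof (intro cont_top_cspace continuous_map_into_subtopology)
    have "continuous_map (simplex_top (Suc n)) euclideanreal (\<lambda>x. simplex_degeneracy i x k)" for k
      unfolding simplex_degeneracy_def
      by (cases "k < i"; cases "k = i") (simp_all add: continuous_map_coord continuous_map_add)
    then show "continuous_map (simplex_top (Suc n)) (powertop_real UNIV) (simplex_degeneracy i)"
      by (simp add: continuous_map_componentwise_UNIV)
  qed (use \<open>i \<le> n\<close> simplex_degeneracy_in in auto)
  have "continuous_map (simplex_top (Suc n)) euclideanreal (simplex_height i)"
    unfolding simplex_height_def[abs_def] by (intro continuous_intros continuous_map_coord) auto
  then show "cont (simplex_I (Suc n)) J_I (simplex_height i)"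
    unfolding simplex_I_def J_I_def using simplex_height_in[of i "Suc n"] \<open>i \<le> n\<close>
    by (intro cont_top_cspace) (auto simp: continuous_map_in_subtopology)
qed (auto simp: simplex_I_def J_I_def closure_space_top_cspace nonempty_standard_simplex face_I_def
      simplex_height_face, auto simp: simplical_face_def simplex_degeneracy_def fun_eq_iff)

text \<open>Every function is continuous into an indiscrete space, which makes the library's results on
  singular chains applicable to arbitrary chains of functions on the standard simplex.\<close>

definition indiscrete_topology :: "'a topology" where
  "indiscrete_topology = topology (\<lambda>U. U = {} \<or> U = UNIV)"

lemma openin_indiscrete_topology: "openin indiscrete_topology U \<longleftrightarrow> U = {} \<or> U = UNIV"
proof -
  have "istopology (\<lambda>U :: 'a set. U = {} \<or> U = UNIV)"
    unfolding istopology_def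
  proof (intro conjI allI impI)
    fix K :: "'a set set" assume "\<forall>U\<in>K. U = {} \<or> U = UNIV"
    then show "\<Union>K = {} \<or> \<Union>K = UNIV" by (cases "UNIV \<in> K") blast+
  qed blast
  then show ?thesis by (simp add: indiscrete_topology_def)
qed

lemma continuous_map_indiscrete_topology: "continuous_map T (indiscrete_topology :: 'b topology) f"
proof -
  have "topspace (indiscrete_topology :: 'b topology) = UNIV"
    unfolding topspace_def by (auto simp: openin_indiscrete_topology)
  then show ?thesis by (auto simp: continuous_map_def openin_indiscrete_topology)
qed

lemma singular_chain_indiscrete:
  "c \<in> ch (sing simplex_I X n) \<Longrightarrow> singular_chain n indiscrete_topology c"
  by (auto simp: ch_def singular_chain_def singular_simplex_def continuous_map_indiscrete_topology sing_simplices_def)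

lemma simplex_bd_simplex_I: "simplex_bd simplex_I face_I (Suc n) c = chain_boundary (Suc n) c"
  by (simp add: simplex_bd_def chain_boundary_def singular_face_def compose_def comp_def restrict_def face_I_def
      atMost_atLeast0 del: sum.cl_ivl_Suc)

section \<open>Barycentric subdivision of simplices in a closure space\<close>

abbreviation id_simplex :: "nat \<Rightarrow> ((nat \<Rightarrow> real) \<Rightarrow> nat \<Rightarrow> real) \<Rightarrow>\<^sub>0 int" where
  "id_simplex n \<equiv> frag_of (restrict id (standard_simplex n))"

text \<open>The library's \<open>subd\<close> is the subdivision homotopy for linear simplices.
  Pushing its value on the identity simplex forward along \<open>\<sigma>\<close> extends it to
  arbitrary functions \<open>\<sigma>\<close>, whatever the structure of the target.\<close>

definition subdivision_homotopy :: "nat \<Rightarrow> (((nat \<Rightarrow> real) \<Rightarrow> 'a) \<Rightarrow>\<^sub>0 int) \<Rightarrow> (((nat \<Rightarrow> real) \<Rightarrow> 'a) \<Rightarrow>\<^sub>0 int)" where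
  "subdivision_homotopy n = frag_extend (\<lambda>\<sigma>. chain_map (Suc n) \<sigma> (subd n (id_simplex n)))"

lemma subdivision_homotopy_diff:
    "subdivision_homotopy n (x - y) = subdivision_homotopy n x - subdivision_homotopy n y"
  and subdivision_homotopy_0 [simp]: "subdivision_homotopy n 0 = 0"
  by (simp_all add: subdivision_homotopy_def frag_extend_diff)

text \<open>A library chain in the standard simplex consists of continuous maps between simplices;
  composing \<open>\<sigma>\<close> with them gives continuous maps of closure spaces again.\<close>

lemma chain_map_in_S:
  assumes "\<sigma> \<in> sing simplex_I X k" "singular_chain n (simplex_top k) b"
  shows "chain_map n \<sigma> b \<in> ch (sing simplex_I X n)"
  unfolding chain_map_def
proof (rule extend_ch)
  interpret simplicial_prism simplex_I face_I J_I simplex_degeneracy simplex_height by (rule simplicial_prism_I)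
  show "b \<in> ch {f. singular_simplex n (simplex_top k) f}"
    using assms(2) by (simp add: singular_chain_def ch_def)
  fix f assume "f \<in> {f. singular_simplex n (simplex_top k) f}"
  then have "cont (simplex_I n) (simplex_I k) f"
    unfolding simplex_I_def by (intro cont_top_cspace) (simp add: singular_simplex_def)
  from sing_pull[OF assms(1) this]
  show "(frag_of \<circ> simplex_map n \<sigma>) f \<in> ch (sing simplex_I X n)"
    by (simp add: simplex_map_def compose_def restrict_def comp_def)
qed

lemma id_simplex_chain:
  "simplicial_chain n (standard_simplex n) (id_simplex n)" "singular_chain n (simplex_top n) (id_simplex n)"
  by (simp_all add: simplicial_imp_singular_chain)

lemma subd_id_simplex: "singular_chain (Suc n) (simplex_top n) (subd n (id_simplex n))"
  by (simp add: chain_homotopic_simplicial_subdivision2 simplicial_imp_singular_chain)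

lemma chain_map_id_simplex: "\<sigma> \<in> sing simplex_I X n \<Longrightarrow> chain_map n \<sigma> (id_simplex n) = frag_of \<sigma>"
  by (rule singular_simplex_chain_map_id[of n indiscrete_topology])
     (simp add: singular_simplex_def continuous_map_indiscrete_topology sing_simplices_def)

text \<open>Reduced to the universal case: a linear simplex \<open>g\<close> is the image of the
  identity simplex under \<open>g\<close> itself, and \<open>subd\<close> commutes with maps induced
  by linear simplices.\<close>

lemma subdivision_homotopy_natural:
  assumes "simplicial_chain q (standard_simplex p) c"
  shows "chain_map (Suc q) \<sigma> (subd q c) = subdivision_homotopy q (chain_map q \<sigma> c)"
  using assms unfolding simplicial_chain_def
proof (induction rule: frag_induction)
  case (one g)
  then have g: "simplicial_simplex q (standard_simplex p) g" by simp
  then have gs: "singular_simplex q (simplex_top p) g" by (rule simplicial_imp_singular_simplex)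
  have "subd q (frag_of g) = subd q (chain_map q g (id_simplex q))"
    using singular_simplex_chain_map_id[OF gs] by simp
  also have "\<dots> = chain_map (Suc q) g (subd q (id_simplex q))"
    by (rule chain_homotopic_simplicial_subdivision1[OF id_simplex_chain(1) g, symmetric])
  finally have "chain_map (Suc q) \<sigma> (subd q (frag_of g)) = chain_map (Suc q) (\<sigma> \<circ> g) (subd q (id_simplex q))"
    by (simp add: chain_map_compose)
  also have "\<dots> = chain_map (Suc q) (simplex_map q \<sigma> g) (subd q (id_simplex q))"
    by (rule chain_map_eq[OF subd_id_simplex]) (simp add: simplex_map_def)
  finally show ?case by (simp add: subdivision_homotopy_def)
qed (simp_all add: subdivision_homotopy_def chain_map_diff frag_extend_diff)

text \<open>The identity for \<open>subd\<close> on the identity simplex is transported along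
  \<open>\<sigma>\<close>, and naturality identifies the term that involves the boundary. In degree
  0 the truncated \<open>n - Suc 0\<close> is harmless, as the boundary vanishes there.\<close>

lemma subdivision_homotopy:
  assumes "c \<in> ch (sing simplex_I X n)"
  shows "chain_boundary (Suc n) (subdivision_homotopy n c) + subdivision_homotopy (n - Suc 0) (chain_boundary n c)
    = singular_subdivision n c - c"
  using assms
proof (induction c rule: ch_induct)
  case (one \<sigma>)
  have bid: "simplicial_chain (n - Suc 0) (standard_simplex n) (chain_boundary n (id_simplex n))"
    using simplicial_chain_boundary[OF id_simplex_chain(1)] by simp
  have "chain_boundary (Suc n) (subdivision_homotopy n (frag_of \<sigma>))
      = chain_map n \<sigma> (chain_boundary (Suc n) (subd n (id_simplex n)))"
    using chain_boundary_chain_map[OF subd_id_simplex, of n \<sigma>] by (simp add: subdivision_homotopy_def)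
  also have "chain_boundary (Suc n) (subd n (id_simplex n)) =
      simplicial_subdivision n (id_simplex n) - id_simplex n - subd (n - Suc 0) (chain_boundary n (id_simplex n))"
    by (rule chain_homotopic_simplicial_subdivision3[OF id_simplex_chain(1)])
  also have "chain_map n \<sigma> \<dots> = singular_subdivision n (frag_of \<sigma>) - frag_of \<sigma>
      - chain_map n \<sigma> (subd (n - Suc 0) (chain_boundary n (id_simplex n)))"
    using chain_map_id_simplex[OF one] by (simp add: chain_map_diff singular_subdivision_def)
  also have "chain_map n \<sigma> (subd (n - Suc 0) (chain_boundary n (id_simplex n)))
      = subdivision_homotopy (n - Suc 0) (chain_boundary n (frag_of \<sigma>))"
  proof (cases n)
    case 0
    then show ?thesis by (simp add: chain_boundary_def subdivision_homotopy_def)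
  next
    case (Suc k)
    have "chain_boundary n (frag_of \<sigma>) = chain_map k \<sigma> (chain_boundary n (id_simplex n))"
      using chain_boundary_chain_map[OF id_simplex_chain(2)[of n], of \<sigma>] chain_map_id_simplex[OF one] Suc by simp
    then show ?thesis using subdivision_homotopy_natural[OF bid, of \<sigma>] Suc by simp
  qed
  finally show ?case by simp
next
  case (diff a b)
  have "chain_boundary (Suc n) (subdivision_homotopy n (a - b)) + subdivision_homotopy (n - Suc 0) (chain_boundary n (a - b))
    = (chain_boundary (Suc n) (subdivision_homotopy n a) + subdivision_homotopy (n - Suc 0) (chain_boundary n a))
    - (chain_boundary (Suc n) (subdivision_homotopy n b) + subdivision_homotopy (n - Suc 0) (chain_boundary n b))"
    by (simp add: subdivision_homotopy_def frag_extend_diff chain_boundary_diff)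
  then show ?case by (simp only: diff.IH singular_subdivision_diff) simp
qed (simp add: subdivision_homotopy_def)

text \<open>Subdividing \<open>\<sigma>\<close> means composing it with the subdivided identity
  simplex, so only the standard simplex has to be covered. The preimages of \<open>A\<close> and
  \<open>B\<close> may fail to be open; their topological interiors are open, and by continuity
  every point lies in one of them.\<close>

lemma small_subdivision_simplex:
  assumes X: "closure_space X" and cov: "interior_cover X {A, B}" and \<sigma>: "\<sigma> \<in> sing simplex_I X n"
  shows "\<exists>m. (singular_subdivision n ^^ m) (frag_of \<sigma>) \<in>
    ch (sing simplex_I (subspace X A) n \<union> sing simplex_I (subspace X B) n)"
proof -
  interpret simplicial_prism simplex_I face_I J_I simplex_degeneracy simplex_height by (rule simplicial_prism_I)
  let ?int = "\<lambda>A. simplex_top n interior_of {z \<in> standard_simplex n. \<sigma> z \<in> A}"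
  have AB: "A \<subseteq> pts X" "B \<subseteq> pts X" using cov unfolding interior_cover_def by blast+
  have c: "\<forall>x\<in>pts (simplex_I n). \<forall>V. nbhd X (\<sigma> x) V \<longrightarrow> nbhd (simplex_I n) x {z \<in> pts (simplex_I n). \<sigma> z \<in> V}"
    using sing_cont[OF \<sigma>] unfolding cont_iff_nbhd[OF cs_M X] by (rule conjunct2)
  have "x \<in> ?int A \<union> ?int B" if "x \<in> standard_simplex n" for x
  proof -
    have "x \<in> ?int U" if "nbhd X (\<sigma> x) U" for U
      using c[rule_format, OF _ that] \<open>x \<in> standard_simplex n\<close> by (simp add: simplex_I_def nbhd_top_cspace)
    then show ?thesis using interior_cover_nbhd[OF cov sing_pts[OF \<sigma>]] that by auto
  qed
  then have cover: "topspace (simplex_top n) \<subseteq> \<Union>{?int A, ?int B}" by auto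
  have open_int: "\<And>U. U \<in> {?int A, ?int B} \<Longrightarrow> openin (simplex_top n) U" by auto
  obtain N where N: "\<And>m f. \<lbrakk>N \<le> m; f \<in> Poly_Mapping.keys ((singular_subdivision n ^^ m) (id_simplex n))\<rbrakk>
      \<Longrightarrow> \<exists>V \<in> {?int A, ?int B}. f \<in> standard_simplex n \<rightarrow> V"
  proof (rule sufficient_iterated_singular_subdivision_exists[OF _ cover id_simplex_chain(2)])
    show "openin (simplex_top n) U" if "U \<in> {?int A, ?int B}" for U using open_int[OF that] .
  qed (rule that)
  let ?b = "\<lambda>m. (singular_subdivision n ^^ m) (id_simplex n)"
  have b: "singular_chain n (simplex_top n) (?b m)" for m
  proof (induction m)
    case 0
    show ?case unfolding funpow_0 by (rule id_simplex_chain(2))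
  next
    case (Suc m)
    show ?case unfolding funpow.simps comp_apply by (rule singular_chain_singular_subdivision[OF Suc])
  qed
  have eq: "(singular_subdivision n ^^ m) (frag_of \<sigma>) = chain_map n \<sigma> (?b m)" for m
  proof (induction m)
    case 0
    show ?case unfolding funpow_0 by (rule chain_map_id_simplex[OF \<sigma>, symmetric])
  next
    case (Suc m)
    show ?case unfolding funpow.simps comp_apply Suc by (rule naturality_singular_subdivision[OF b[of m]])
  qed
  have "chain_map n \<sigma> (?b N) \<in> ch (sing simplex_I (subspace X A) n \<union> sing simplex_I (subspace X B) n)"
    unfolding chain_map_def
  proof (rule extend_ch)
    show "?b N \<in> ch (Poly_Mapping.keys (?b N))" by (simp add: ch_def)
    fix f assume f: "f \<in> Poly_Mapping.keys (?b N)"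
    then obtain V where "V \<in> {?int A, ?int B}" "f \<in> standard_simplex n \<rightarrow> V" using N[OF order_refl f] by blast
    moreover have "?int U \<subseteq> {z \<in> standard_simplex n. \<sigma> z \<in> U}" for U by (rule interior_of_subset)
    ultimately have "\<sigma> ` f ` standard_simplex n \<subseteq> A \<or> \<sigma> ` f ` standard_simplex n \<subseteq> B" by blast
    moreover have "singular_chain n (simplex_top n) (frag_of f)"
      using b[of N] f by (auto simp: singular_chain_def)
    then have "simplex_map n \<sigma> f \<in> sing simplex_I X n"
      using chain_map_in_S[OF \<sigma>] by fastforce
    ultimately show "(frag_of \<circ> simplex_map n \<sigma>) f \<in>
        ch (sing simplex_I (subspace X A) n \<union> sing simplex_I (subspace X B) n)"
      using sing_subspace_iff[OF AB(1)] sing_subspace_iff[OF AB(2)] by (auto simp: simplex_map_def image_subset_iff)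
  qed
  then show ?thesis using eq by metis
qed

lemma homology_theory_simplex_I:
  "homology_theory J_I (simp_H simplex_I face_I :: ('a, _) pair_groups) (simp_H simplex_I face_I :: ('b, _) pair_groups)
    (simp_H simplex_I face_I :: ('c, _) pair_groups)
    (simp_map simplex_I face_I) (simp_map simplex_I face_I) (simp_map simplex_I face_I)
    (simp_map simplex_I face_I) (simp_conn simplex_I face_I) (simp_conn simplex_I face_I)"
proof -
  interpret simplicial_prism simplex_I face_I J_I simplex_degeneracy simplex_height by (rule simplicial_prism_I)
  interpret chain_model "sing simplex_I" "\<lambda>_. {}" "simplex_bd simplex_I face_I" "simplicial_cx simplex_I face_I"
    "simplicial_map simplex_I :: ('a, _, 'a, _) cx_map" "\<lambda>X n c. c" by (rule chain_model)
  have Sd_S: "singular_subdivision n c \<in> ch (sing simplex_I X n)"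
    if "c \<in> ch (sing simplex_I X n)" for n c and X :: "'a cspace"
    unfolding singular_subdivision_def using that
    by (rule extend_ch) (rule chain_map_in_S, auto intro!: simplicial_imp_singular_chain simplicial_chain_simplicial_subdivision id_simplex_chain(1))
  have T_S: "subdivision_homotopy n c \<in> ch (sing simplex_I X (Suc n))"
    if "c \<in> ch (sing simplex_I X n)" for n c and X :: "'a cspace"
    unfolding subdivision_homotopy_def using that by (rule extend_ch) (rule chain_map_in_S[OF _ subd_id_simplex])
  show ?thesis
  proof (rule homology_theory_simplicial)
    fix n and X :: "'a cspace" and A B z
    assume X: "closure_space X" and cov: "interior_cover X {A, B}" and z: "z \<in> ch (sing simplex_I X n)"
      "\<And>k. n = Suc k \<Longrightarrow> simplex_bd simplex_I face_I n z
        \<in> ch (sing simplex_I (subspace X A) k \<union> sing simplex_I (subspace X B) k)"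
    have sp: "space_pair X A" "space_pair X B"
      using X cov unfolding interior_cover_def space_pair_def by blast+
    have "\<exists>w\<in>ch (sing simplex_I X (Suc n)). z - simplex_bd simplex_I face_I (Suc n) w
        \<in> ch (sing simplex_I (subspace X A) n \<union> sing simplex_I (subspace X B) n \<union> {})"
    proof (rule small_by_subdivision[OF sp, where Sd = singular_subdivision and T = subdivision_homotopy])
      show "simplex_bd simplex_I face_I n z \<in> ch (sing simplex_I (subspace X A) k \<union> sing simplex_I (subspace X B) k \<union> {})"
        if "n = Suc k" for k using z(2)[OF that] by simp
      fix n and c :: "((nat \<Rightarrow> real) \<Rightarrow> 'a) \<Rightarrow>\<^sub>0 int"
      show "simplex_bd simplex_I face_I (Suc n) (singular_subdivision (Suc n) c) -
          singular_subdivision n (simplex_bd simplex_I face_I (Suc n) c) \<in> ch {}"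
        if "c \<in> ch (sing simplex_I X (Suc n))"
        using chain_boundary_singular_subdivision[OF singular_chain_indiscrete[OF that]] by (simp add: simplex_bd_simplex_I)
      show "simplex_bd simplex_I face_I (Suc n) (subdivision_homotopy n c) +
          (case n of 0 \<Rightarrow> 0 | Suc k \<Rightarrow> subdivision_homotopy k (simplex_bd simplex_I face_I n c)) -
          (singular_subdivision n c - c) \<in> ch {}"
        if "c \<in> ch (sing simplex_I X n)"
        using subdivision_homotopy[OF that]
        by (cases n) (simp_all add: simplex_bd_simplex_I chain_boundary_def[of 0] subdivision_homotopy_def[of 0])
      show "\<exists>m. (singular_subdivision n ^^ m) (frag_of \<sigma>) \<in>
          ch (sing simplex_I (subspace X A) n \<union> sing simplex_I (subspace X B) n \<union> {})"
        if "\<sigma> \<in> sing simplex_I X n" for \<sigma>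
        using small_subdivision_simplex[OF X cov that] by simp
    qed (simp_all add: singular_subdivision_diff subdivision_homotopy_diff Sd_S T_S z ch_empty)
    then show "\<exists>w\<in>ch (sing simplex_I X (Suc n)). z - simplex_bd simplex_I face_I (Suc n) w
        \<in> ch (sing simplex_I (subspace X A) n \<union> sing simplex_I (subspace X B) n)"
      by simp
  qed
qed

section \<open>Singular cubes\<close>

type_synonym 'a cube_chain = "((nat \<Rightarrow> real) \<Rightarrow> 'a) \<Rightarrow>\<^sub>0 int"

abbreviation cubes :: "real cspace \<Rightarrow> 'a cspace \<Rightarrow> nat \<Rightarrow> ((nat \<Rightarrow> real) \<Rightarrow> 'a) set" where
  "cubes J \<equiv> sing (cpower J)"

abbreviation cube :: "real cspace \<Rightarrow> nat \<Rightarrow> (nat \<Rightarrow> real) set" where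
  "cube J n \<equiv> pts (cpower J n)"

lemma sing_cubes_eq: "sing_cubes J = cubes J"
  by (intro ext) (simp add: sing_cubes_def sing_simplices_def)

declare pts_cpower [simp del]

lemma pts_cpower_iff: "x \<in> cube J n \<longleftrightarrow> (\<forall>j. if 1 \<le> j \<and> j \<le> n then x j \<in> pts J else x j = undefined)"
  by (auto simp: pts_cpower PiE_iff extensional_def)

text \<open>Unlike \<open>degenerate_cubes\<close>, this refers to no space and imposes no
  continuity, so that it can serve as the parameter \<open>D\<close> of \<open>chain_model\<close>.
  Intersecting with the cubes of \<open>X\<close> recovers the degenerate cubes of
  \<open>X\<close>.\<close>

definition deg_cubes :: "real cspace \<Rightarrow> nat \<Rightarrow> ((nat \<Rightarrow> real) \<Rightarrow> 'a) set" where
  "deg_cubes J n = {\<sigma> \<in> extensional (cube J n). \<exists>i\<in>{1..n}. \<forall>x\<in>cube J n. \<forall>y\<in>cube J n.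
        (\<forall>j. j \<noteq> i \<longrightarrow> x j = y j) \<longrightarrow> \<sigma> x = \<sigma> y}"

lemma degI:
  "\<sigma> \<in> extensional (cube J n) \<Longrightarrow> i \<in> {1..n} \<Longrightarrow>
    (\<And>x y. x \<in> cube J n \<Longrightarrow> y \<in> cube J n \<Longrightarrow> \<forall>j. j \<noteq> i \<longrightarrow> x j = y j \<Longrightarrow> \<sigma> x = \<sigma> y) \<Longrightarrow> \<sigma> \<in> deg_cubes J n"
  unfolding deg_cubes_def by blast

lemma degE:
  assumes "\<sigma> \<in> deg_cubes J n"
  obtains i where "\<sigma> \<in> extensional (cube J n)" "i \<in> {1..n}"
    "\<forall>x\<in>cube J n. \<forall>y\<in>cube J n. (\<forall>j. j \<noteq> i \<longrightarrow> x j = y j) \<longrightarrow> \<sigma> x = \<sigma> y"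
  using assms unfolding deg_cubes_def by blast

lemma degenerate_cubes_eq: "degenerate_cubes J X n = cubes J X n \<inter> deg_cubes J n"
  by (auto simp: degenerate_cubes_def deg_cubes_def sing_cubes_def sing_simplices_def)

section \<open>Precomposition and the cubical boundary\<close>

definition pullc :: "real cspace \<Rightarrow> nat \<Rightarrow> ((nat \<Rightarrow> real) \<Rightarrow> (nat \<Rightarrow> real)) \<Rightarrow>
    'a cube_chain \<Rightarrow> 'a cube_chain" where
  "pullc J n \<phi> = frag_extend (\<lambda>\<sigma>. frag_of (compose (cube J n) \<sigma> \<phi>))"

lemma pullc_diff: "pullc J n \<phi> (x - y) = pullc J n \<phi> x - pullc J n \<phi> y"
  by (simp add: pullc_def frag_extend_diff)

lemma pullc_pullc:
  assumes "\<And>x. x \<in> cube J n \<Longrightarrow> \<phi> x \<in> cube J m \<and> \<psi> (\<phi> x) = \<theta> x"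
  shows "pullc J n \<phi> (pullc J m \<psi> c) = pullc J n \<theta> c"
proof -
  have "compose (cube J n) (compose (cube J m) \<sigma> \<psi>) \<phi> = compose (cube J n) \<sigma> \<theta>" for \<sigma> :: "_ \<Rightarrow> 'a"
    using assms by (intro compose_compose_eq) simp
  then show ?thesis
    using frag_extend_compose[of "\<lambda>\<sigma>. frag_of (compose (cube J n) \<sigma> \<phi>)" "\<lambda>\<sigma>. compose (cube J m) \<sigma> \<psi>" c]
    by (simp add: pullc_def comp_def)
qed

lemma pullc_comm:
  assumes "\<And>x. x \<in> cube J n \<Longrightarrow> \<phi> x \<in> cube J m \<and> \<phi>' x \<in> pts (cpower J m') \<and> \<psi> (\<phi> x) = \<psi>' (\<phi>' x)"
  shows "pullc J n \<phi> (pullc J m \<psi> c) = pullc J n \<phi>' (pullc J m' \<psi>' c)"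
  using pullc_pullc[of J n \<phi> m \<psi> "\<psi> \<circ> \<phi>" c] pullc_pullc[of J n \<phi>' m' \<psi>' "\<psi> \<circ> \<phi>" c] assms by simp

definition face_diff :: "real cspace \<Rightarrow> nat \<Rightarrow> nat \<Rightarrow> 'a cube_chain \<Rightarrow> 'a cube_chain" where
  "face_diff J n j c = pullc J (n - 1) (insert_coord j 0) c - pullc J (n - 1) (insert_coord j 1) c"

definition cube_bd :: "real cspace \<Rightarrow> nat \<Rightarrow> 'a cube_chain \<Rightarrow> 'a cube_chain" where
  "cube_bd J n c = (\<Sum>j=1..n. frag_cmul ((-1) ^ j) (face_diff J n j c))"

lemma face_diff_diff: "face_diff J n j (x - y) = face_diff J n j x - face_diff J n j y"
  by (simp add: face_diff_def pullc_diff)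

lemma frag_cmul_diff: "frag_cmul k (a - b) = frag_cmul k a - frag_cmul k b"
  by (rule poly_mapping_eqI) (simp add: lookup_minus right_diff_distrib)

lemma cube_bd_diff: "cube_bd J n (x - y) = cube_bd J n x - cube_bd J n y"
  by (simp add: cube_bd_def face_diff_diff frag_cmul_diff sum_subtractf)

lemma cube_bd_0 [simp]: "cube_bd J n 0 = 0"
  using cube_bd_diff[of J n 0 0] by simp

text \<open>The hypothesis on \<open>f\<close> is additivity, so coefficients pass through because
  they are signs.\<close>

lemma additive_signed_sum:
  assumes diff: "\<And>x y :: 'b \<Rightarrow>\<^sub>0 int. f (x - y) = f x - (f y :: 'c \<Rightarrow>\<^sub>0 int)"
  shows "f (\<Sum>i\<in>I. frag_cmul ((-1) ^ k i) (h i)) = (\<Sum>i\<in>I. frag_cmul ((-1) ^ k i) (f (h i)))"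
proof -
  have 0: "f 0 = 0" using diff[of 0 0] by simp
  then have minus: "f (- x) = - f x" for x using diff[of 0 x] by simp
  then have add: "f (x + y) = f x + f y" for x y using diff[of x "- y"] by simp
  have "f (frag_cmul ((-1) ^ m) x) = frag_cmul ((-1) ^ m) (f x)" for m x
    by (cases "even m") (simp_all add: minus)
  then show ?thesis by (induction I rule: infinite_finite_induct) (simp_all add: 0 add)
qed

text \<open>Links the boundary of the complex, given on generators, to the sum of face differences
  of whole chains. Identities between faces apply directly to the latter form.\<close>

lemma cube_bd_eq:
  "cube_bd J n = frag_extend (\<lambda>\<sigma>. \<Sum>i=1..n.
        frag_cmul ((-1) ^ i) (frag_of (cube_face J n i 0 \<sigma>) - frag_of (cube_face J n i 1 \<sigma>)))"
proof
  fix c :: "'a cube_chain"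
  have "c \<in> ch UNIV" by (simp add: ch_def)
  then show "cube_bd J n c = frag_extend (\<lambda>\<sigma>. \<Sum>i=1..n.
        frag_cmul ((-1) ^ i) (frag_of (cube_face J n i 0 \<sigma>) - frag_of (cube_face J n i 1 \<sigma>))) c"
  proof (induction c rule: ch_induct)
    case zero
    then show ?case using cube_bd_diff[of J n 0 0] by simp
  next
    case (one \<sigma>)
    then show ?case by (simp add: cube_bd_def face_diff_def pullc_def cube_face_def)
  next
    case (diff a b)
    then show ?case by (simp add: cube_bd_diff frag_extend_diff)
  qed
qed

lemma insert_coord_insert_coord:
  "i \<le> j \<Longrightarrow> insert_coord (Suc j) t (insert_coord i u x) = insert_coord i u (insert_coord j t x)"
  by (auto simp: insert_coord_def fun_eq_iff)

text \<open>The condition on \<open>\<phi>\<close> says that source coordinate \<open>i'\<close>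
  influences no target coordinate but \<open>i\<close>. A cube constant in direction
  \<open>i\<close> then pulls back to one constant in direction \<open>i'\<close>.\<close>

lemma deg_pull:
  assumes \<sigma>: "\<sigma> \<in> deg_cubes J m" and \<phi>: "\<phi> ` cube J n \<subseteq> cube J m"
    and i: "\<And>i. i \<in> {1..m} \<Longrightarrow> \<exists>i'\<in>{1..n}. \<forall>x y. (\<forall>j. j \<noteq> i' \<longrightarrow> x j = y j) \<longrightarrow> (\<forall>j. j \<noteq> i \<longrightarrow> \<phi> x j = \<phi> y j)"
  shows "compose (cube J n) \<sigma> \<phi> \<in> deg_cubes J n"
proof -
  obtain k where k: "k \<in> {1..m}" "\<And>x y. x \<in> cube J m \<Longrightarrow> y \<in> cube J m \<Longrightarrow>
      (\<forall>j. j \<noteq> k \<longrightarrow> x j = y j) \<Longrightarrow> \<sigma> x = \<sigma> y"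
    using \<sigma> by (elim degE) metis
  obtain k' where k': "k' \<in> {1..n}" "\<And>x y. (\<forall>j. j \<noteq> k' \<longrightarrow> x j = y j) \<Longrightarrow> (\<forall>j. j \<noteq> k \<longrightarrow> \<phi> x j = \<phi> y j)"
    using i[OF k(1)] by blast
  have "compose (cube J n) \<sigma> \<phi> x = compose (cube J n) \<sigma> \<phi> y"
    if "x \<in> cube J n" "y \<in> cube J n" "\<forall>j. j \<noteq> k' \<longrightarrow> x j = y j" for x y
    using k(2)[of "\<phi> x" "\<phi> y"] k'(2)[OF that(3)] \<phi> that(1,2) by (simp add: compose_def image_subset_iff)
  then show ?thesis by (intro degI[OF compose_extensional k'(1)])
qed

locale cube_model =
  fixes J :: "real cspace"
  assumes cs_J: "closure_space J" and J01: "0 \<in> pts J" "1 \<in> pts J"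

sublocale cube_model \<subseteq> singular_model "cpower J"
proof
  fix n
  have "restrict (\<lambda>_. 0) {1..n} \<in> cube J n" using J01 by (simp add: pts_cpower)
  then show "cube J n \<noteq> {}" by blast
qed (rule closure_space_cpower[OF cs_J])

context cube_model
begin

lemma insert_coord_in:
  assumes x: "x \<in> cube J n" and i: "i \<in> {1..Suc n}" and t: "t \<in> pts J"
  shows "insert_coord i t x \<in> cube J (Suc n)"
  unfolding pts_cpower_iff
proof
  fix j
  have "if 1 \<le> j \<and> j \<le> n then x j \<in> pts J else x j = undefined"
    "if 1 \<le> j - 1 \<and> j - 1 \<le> n then x (j - 1) \<in> pts J else x (j - 1) = undefined"
    using x unfolding pts_cpower_iff by blast+
  then show "if 1 \<le> j \<and> j \<le> Suc n then insert_coord i t x j \<in> pts J else insert_coord i t x j = undefined"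
    using i t by (auto simp: insert_coord_def split: if_split_asm)
qed

lemma cont_insert_coord:
  assumes i: "i \<in> {1..Suc n}" and t: "t \<in> pts J"
  shows "cont (cpower J n) (cpower J (Suc n)) (insert_coord i t)"
proof (rule cont_cpower[OF cs_M cs_J])
  fix j assume j: "j \<in> {1..Suc n}"
  consider "j < i" | "j = i" | "i < j" by linarith
  then show "cont (cpower J n) J (\<lambda>x. insert_coord i t x j)"
  proof cases
    case 1
    then have "j \<in> {1..n}" using i j by auto
    from cont_coord[OF cs_J this] show ?thesis using 1 by (simp add: insert_coord_def)
  next
    case 2
    then show ?thesis using cont_const[OF cs_M cs_J t] by (simp add: insert_coord_def)
  next
    case 3
    then have "j - 1 \<in> {1..n}" using i j by auto
    from cont_coord[OF cs_J this] show ?thesis using 3 by (simp add: insert_coord_def)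
  qed
next
  fix x assume "x \<in> cube J n"
  then show "insert_coord i t x \<in> extensional {1..Suc n}"
    using insert_coord_in[OF _ i t] by (auto simp: pts_cpower PiE_iff)
qed

lemma face_diff_face_diff:
  assumes "1 \<le> i" "i \<le> j" "j \<le> Suc n"
  shows "face_diff J (Suc n) i (face_diff J (Suc (Suc n)) (Suc j) c) = face_diff J (Suc n) j (face_diff J (Suc (Suc n)) i c)"
proof -
  have "pullc J n (insert_coord i u) (pullc J (Suc n) (insert_coord (Suc j) t) c)
      = pullc J n (insert_coord j t) (pullc J (Suc n) (insert_coord i u) c)" if "t \<in> {0, 1}" "u \<in> {0, 1}" for t u
    using assms that J01 insert_coord_in by (intro pullc_comm) (auto simp: insert_coord_insert_coord)
  then show ?thesis by (simp add: face_diff_def pullc_diff)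
qed

lemma cube_bd_cube_bd: "cube_bd J (Suc n) (cube_bd J (Suc (Suc n)) c) = 0"
proof -
  have "cube_bd J (Suc n) (cube_bd J (Suc (Suc n)) c) =
      (\<Sum>j\<in>{1..Suc (Suc n)}. \<Sum>i\<in>{1..Suc n}. frag_cmul ((-1) ^ (j + i)) (face_diff J (Suc n) i (face_diff J (Suc (Suc n)) j c)))"
    unfolding cube_bd_def[of J "Suc (Suc n)"]
    by (simp only: additive_signed_sum[where f = "cube_bd J (Suc n)", OF cube_bd_diff])
       (simp only: cube_bd_def frag_cmul_sum frag_cmul_cmul power_add)
  also have "\<dots> = 0" by (rule boundary_sum_zero) (auto intro: face_diff_face_diff)
  finally show ?thesis .
qed

lemma pullc_S: "cont (cpower J n) (cpower J m) \<phi> \<Longrightarrow> c \<in> ch (cubes J X m) \<Longrightarrow>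
    pullc J n \<phi> c \<in> ch (cubes J X n)"
  unfolding pullc_def by (erule extend_ch) (simp add: sing_pull)

lemma face_diff_S: "c \<in> ch (cubes J X (Suc n)) \<Longrightarrow> j \<in> {1..Suc n} \<Longrightarrow>
    face_diff J (Suc n) j c \<in> ch (cubes J X n)"
  unfolding face_diff_def by (intro diff_ch) (auto intro!: pullc_S[of n "Suc n"] cont_insert_coord J01)

lemma cube_bd_S: "c \<in> ch (cubes J X (Suc n)) \<Longrightarrow> cube_bd J (Suc n) c \<in> ch (cubes J X n)"
  unfolding cube_bd_def by (intro sum_ch cmul_ch face_diff_S)

text \<open>In its constant direction a degenerate cube may have nondegenerate faces, but the two
  opposite ones coincide and cancel in the difference. In any other direction each face inherits the
  constant coordinate, shifted down by one if it lies beyond \<open>k\<close>.\<close>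

lemma face_diff_deg:
  assumes c: "c \<in> ch (deg_cubes J (Suc n))" and k: "k \<in> {1..Suc n}"
  shows "face_diff J (Suc n) k c \<in> ch (deg_cubes J n)"
  using c
proof (induction c rule: ch_induct)
  case (one \<sigma>)
  then obtain i where i: "i \<in> {1..Suc n}" "\<And>x y. x \<in> cube J (Suc n) \<Longrightarrow> y \<in> cube J (Suc n) \<Longrightarrow>
      (\<forall>j. j \<noteq> i \<longrightarrow> x j = y j) \<Longrightarrow> \<sigma> x = \<sigma> y"
    by (elim degE) metis
  let ?f = "\<lambda>t. compose (cube J n) \<sigma> (insert_coord k t)"
  show ?case
  proof (cases "i = k")
    case True
    have "?f 0 = ?f 1"
      unfolding compose_def using i(2) k J01 insert_coord_in True
      by (intro restrict_ext i(2)) (auto simp: insert_coord_def)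
    then show ?thesis by (simp add: face_diff_def pullc_def)
  next
    case False
    have "?f t \<in> deg_cubes J n" if t: "t \<in> {0, 1}" for t
    proof -
      define i' where "i' = (if i < k then i else i - 1)"
      have i': "i' \<in> {1..n}" using i(1) k False by (auto simp: i'_def)
      have "?f t x = ?f t y" if "x \<in> cube J n" "y \<in> cube J n" "\<forall>j. j \<noteq> i' \<longrightarrow> x j = y j" for x y
      proof -
        have "\<sigma> (insert_coord k t x) = \<sigma> (insert_coord k t y)"
        proof (rule i(2))
          show "insert_coord k t x \<in> cube J (Suc n)" "insert_coord k t y \<in> cube J (Suc n)"
            using insert_coord_in that k t J01 by auto
          show "\<forall>j. j \<noteq> i \<longrightarrow> insert_coord k t x j = insert_coord k t y j"
            using that(3) False by (auto simp: insert_coord_def i'_def split: if_splits)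
        qed
        then show ?thesis using that by (simp add: compose_def)
      qed
      then show ?thesis by (intro degI[OF compose_extensional i'])
    qed
    then show ?thesis by (auto simp: face_diff_def pullc_def intro!: diff_ch)
  qed
qed (auto simp: face_diff_diff intro: diff_ch, simp add: face_diff_def pullc_def)

lemma cube_bd_deg: "c \<in> ch (deg_cubes J (Suc n)) \<Longrightarrow> cube_bd J (Suc n) c \<in> ch (deg_cubes J n)"
  unfolding cube_bd_def by (intro sum_ch cmul_ch face_diff_deg)

text \<open>A subgroup generated by basis elements of a free group consists of the chains supported
  on them, so \<open>generate\<close> disappears from all later arguments.\<close>

lemma degenerate_chains_eq: "degenerate_chains J X n = ch (cubes J X n \<inter> deg_cubes J n)"
proof -
  let ?U = "cubes J X n \<inter> deg_cubes J n" and ?G = "free_Abelian_group (cubes J X n)"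
  interpret group ?G by simp
  have fU: "frag_of ` ?U \<subseteq> carrier ?G" by auto
  have "subgroup (ch ?U) ?G"
    using pres_subgroup[OF pres_free _ add_subgroup_ch, of ?U "cubes J X n"]
    by (simp add: image_ident ch_def subset_iff)
  then have "generate ?G (frag_of ` ?U) \<subseteq> ch ?U" by (intro generate_subgroup_incl) auto
  moreover have "c \<in> generate ?G (frag_of ` ?U)" if "c \<in> ch ?U" for c
    using that
  proof (induction c rule: ch_induct)
    case zero
    then show ?case using generate.one[of ?G] by simp
  next
    case (one \<sigma>)
    then show ?case by (intro generate.incl) blast
  next
    case (diff a b)
    have "b \<in> carrier ?G" using generate_incl[OF fU] diff by blast
    then have "a - b = a \<otimes>\<^bsub>?G\<^esub> inv\<^bsub>?G\<^esub> b" by simp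
    then show ?case using generate.eng[OF diff(1) generate_m_inv_closed[OF fU diff(2)]] by metis
  qed
  ultimately show ?thesis
    by (auto simp: degenerate_chains_def degenerate_cubes_eq cube_cx_def sing_cubes_eq)
qed

section \<open>The normalized cubical complex and its presentation by chains\<close>

definition cubical_class :: "'a cspace \<Rightarrow> nat \<Rightarrow> 'a cube_chain \<Rightarrow> 'a cube_chain set" where
  "cubical_class X n c = degenerate_chains J X n #>\<^bsub>grp (cube_cx J X) n\<^esub> c"

lemma grp_cube_cx: "grp (cube_cx J X) n = free_Abelian_group (cubes J X n)"
  by (simp add: cube_cx_def sing_cubes_eq)

lemma ch_sub: "ch (cubes J X n \<inter> deg_cubes J n) \<subseteq> ch (cubes J X n)"
  by (auto elim: ch_mono[rotated])

lemma pres_cong: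
  assumes "pres G Q K p" "\<And>x. x \<in> Q \<Longrightarrow> x \<in> K \<longleftrightarrow> x \<in> K'" shows "pres G Q K' p"
  using assms(1) assms(2)[OF add_subgroup_diff[OF presD(2)[OF assms(1)]]] by (simp add: pres_def)

text \<open>For chains of \<open>X\<close>, being supported on degenerate cubes of \<open>X\<close>
  and being supported on \<open>deg_cubes\<close> agree, which allows a kernel set independent of
  \<open>X\<close>.\<close>

lemma pres_cubical: "pres (grp (cubical_cx J X) n) (ch (cubes J X n)) (ch (deg_cubes J n)) (cubical_class X n)"
proof -
  let ?Q = "cubes J X n"
  have "pres (grp (cubical_cx J X) n) (ch ?Q) {x. \<exists>w\<in>ch (?Q \<inter> deg_cubes J n). x - w \<in> ch {}} (cubical_class X n)"
    using pres_Mod[OF pres_free ch_sub add_subgroup_ch, of X n]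
    by (simp add: cubical_cx_def quot_cx_def cubical_class_def[abs_def] degenerate_chains_eq grp_cube_cx image_ident)
  moreover have "x \<in> {x. \<exists>w\<in>ch (?Q \<inter> deg_cubes J n). x - w \<in> ch {}} \<longleftrightarrow> x \<in> ch (deg_cubes J n)" if "x \<in> ch ?Q" for x
    using that by (auto simp: ch_empty elim: ch_mono[rotated] intro: ch_Int)
  ultimately show ?thesis
    by (rule pres_cong)
qed

lemma push_deg:
  fixes f :: "'b \<Rightarrow> 'c"
  assumes c: "c \<in> ch (deg_cubes J n)" shows "push (cpower J) n f c \<in> ch (deg_cubes J n)"
  unfolding push_def using c
proof (rule extend_ch)
  fix \<sigma> :: "(nat \<Rightarrow> real) \<Rightarrow> 'b" assume \<sigma>: "\<sigma> \<in> deg_cubes J n"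
  then obtain i where i: "i \<in> {1..n}" "\<And>x y. x \<in> cube J n \<Longrightarrow> y \<in> cube J n \<Longrightarrow>
      (\<forall>j. j \<noteq> i \<longrightarrow> x j = y j) \<Longrightarrow> \<sigma> x = \<sigma> y"
    by (elim degE) metis
  have "compose (cube J n) f \<sigma> x = compose (cube J n) f \<sigma> y"
    if "x \<in> cube J n" "y \<in> cube J n" "\<forall>j. j \<noteq> i \<longrightarrow> x j = y j" for x y
    using i(2)[OF that] that by (simp add: compose_def)
  then have "compose (cube J n) f \<sigma> \<in> deg_cubes J n" by (intro degI[OF compose_extensional i(1)])
  then show "frag_of (compose (cube J n) f \<sigma>) \<in> ch (deg_cubes J n)" by simp
qed

lemma push_pullc:
  assumes "\<phi> ` cube J n \<subseteq> cube J m"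
  shows "pullc J n \<phi> (push (cpower J) m f c) = push (cpower J) n f (pullc J n \<phi> c)"
proof -
  have "pullc J n \<phi> (push (cpower J) m f c)
      = frag_extend (\<lambda>\<sigma>. frag_of (compose (cube J n) (compose (cube J m) f \<sigma>) \<phi>)) c"
    using frag_extend_compose[of "\<lambda>\<sigma>. frag_of (compose (cube J n) \<sigma> \<phi>)" "compose (cube J m) f" c]
    by (simp add: pullc_def push_def comp_def)
  also have "\<dots> = frag_extend (\<lambda>\<sigma>. frag_of (compose (cube J n) f (compose (cube J n) \<sigma> \<phi>))) c"
    by (simp only: push_pull[OF assms])
  also have "\<dots> = push (cpower J) n f (pullc J n \<phi> c)"
    using frag_extend_compose[of "\<lambda>\<sigma>. frag_of (compose (cube J n) f \<sigma>)" "\<lambda>\<sigma>. compose (cube J n) \<sigma> \<phi>" c]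
    by (simp add: pullc_def push_def comp_def)
  finally show ?thesis .
qed

lemma push_cube_bd: "cube_bd J (Suc n) (push (cpower J) (Suc n) f c) = push (cpower J) n f (cube_bd J (Suc n) c)"
proof -
  have "face_diff J (Suc n) j (push (cpower J) (Suc n) f c) = push (cpower J) n f (face_diff J (Suc n) j c)" if "j \<in> {1..Suc n}" for j
    using that J01 insert_coord_in by (simp add: face_diff_def push_diff push_pullc image_subset_iff)
  then show ?thesis 
    unfolding cube_bd_def by (simp only: additive_signed_sum[where f = "push (cpower J) n f", OF push_diff] cong: sum.cong)
qed

lemma cubical_map_cubical_class:
  assumes f: "cont X Y f" and c: "c \<in> ch (cubes J X n)"
  shows "cubical_map J n Y f (cubical_class X n c) = cubical_class Y n (push (cpower J) n f c)"
proof -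
  let ?W = "\<lambda>X. ch (cubes J X n \<inter> deg_cubes J n)"
  have W: "push (cpower J) n f x \<in> ?W Y" if "x \<in> ?W X" for x
  proof (rule ch_Int)
    show "push (cpower J) n f x \<in> ch (cubes J Y n)"
      using ch_mono[OF _ that] by (intro push_S[OF f]) auto
    show "push (cpower J) n f x \<in> ch (deg_cubes J n)"
      using ch_mono[OF _ that] by (intro push_deg) auto
  qed
  have "quot_map (free_Abelian_group (cubes J Y n)) ((\<lambda>c. c) ` ?W Y) (push (cpower J) n f)
      ((\<lambda>c. c) ` ?W X #>\<^bsub>free_Abelian_group (cubes J X n)\<^esub> c) =
      (\<lambda>c. c) ` ?W Y #>\<^bsub>free_Abelian_group (cubes J Y n)\<^esub> push (cpower J) n f c"
    by (rule quot_map_coset[OF pres_free pres_free ch_sub add_subgroup_ch ch_sub add_subgroup_ch, where h' = "push (cpower J) n f"])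
       (simp_all add: push_add push_S[OF f] W c)
  then show ?thesis
    by (simp add: cubical_map_def cubical_class_def degenerate_chains_eq push_def[symmetric] grp_cube_cx image_ident)
qed

lemma bdry_cubical_class:
  assumes c: "c \<in> ch (cubes J X (Suc n))"
  shows "bdry (cubical_cx J X) (Suc n) (cubical_class X (Suc n) c) = cubical_class X n (cube_bd J (Suc n) c)"
proof -
  let ?W = "\<lambda>n. ch (cubes J X n \<inter> deg_cubes J n)"
  have W: "cube_bd J (Suc n) x \<in> ?W n" if "x \<in> ?W (Suc n)" for x
  proof (rule ch_Int)
    show "cube_bd J (Suc n) x \<in> ch (cubes J X n)"
      using ch_mono[OF _ that] by (intro cube_bd_S) auto
    show "cube_bd J (Suc n) x \<in> ch (deg_cubes J n)"
      using ch_mono[OF _ that] by (intro cube_bd_deg) auto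
  qed
  have add: "cube_bd J (Suc n) (x + y) = cube_bd J (Suc n) x + cube_bd J (Suc n) y" for x y :: "'a cube_chain"
    unfolding cube_bd_eq by (rule frag_extend_add)
  have "quot_map (free_Abelian_group (cubes J X n)) ((\<lambda>c. c) ` ?W n) (cube_bd J (Suc n))
      ((\<lambda>c. c) ` ?W (Suc n) #>\<^bsub>free_Abelian_group (cubes J X (Suc n))\<^esub> c) =
      (\<lambda>c. c) ` ?W n #>\<^bsub>free_Abelian_group (cubes J X n)\<^esub> cube_bd J (Suc n) c"
    by (rule quot_map_coset[OF pres_free pres_free ch_sub add_subgroup_ch ch_sub add_subgroup_ch, where h' = "cube_bd J (Suc n)"])
       (simp_all add: add cube_bd_S W c)
  moreover have "bdry (cube_cx J X) (Suc n) = cube_bd J (Suc n)" unfolding cube_bd_eq cube_cx_def by simp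
  ultimately show ?thesis
    by (simp add: cubical_cx_def quot_cx_def cubical_class_def degenerate_chains_eq grp_cube_cx image_ident)
qed

lemma chain_model: "chain_model (cubes J) (deg_cubes J) (cube_bd J) (cubical_cx J) (cubical_map J) cubical_class"
proof
  fix X :: "'a cspace" and n assume X: "closure_space X"
  show "cubes J (subspace X {}) n = {}"
    using sing_subspace_simps(3)[of X "{}"] X by (simp add: space_pair_def)
next
  fix X :: "'a cspace" and A c n assume X: "space_pair X A" and c: "c \<in> ch (cubes J (subspace X A) n)"
  have "A \<subseteq> pts X" using X by (simp add: space_pair_def)
  from cubical_map_cubical_class[OF cont_inclusion[OF this] c]
  show "cubical_map J n X id (cubical_class (subspace X A) n c) = cubical_class X n c" using push_id[OF c] by simp
qed (simp_all add: sing_subspace_simps(1,2) cube_bd_diff cube_bd_S cube_bd_deg cube_bd_cube_bd pres_cubical bdry_cubical_class)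

lemma chain_model_map:
  "chain_model_map (cubes J) (deg_cubes J) (cube_bd J) (cubical_cx J) (cubical_map J) cubical_class
    (cubes J) (deg_cubes J) (cube_bd J) (cubical_cx J) (cubical_map J) cubical_class (push (cpower J)) (cubical_map J)"
  by (intro chain_model_map.intro chain_model chain_model_map_axioms.intro)
     (auto simp: push_diff push_S push_deg push_cube_bd cubical_map_cubical_class intro: push_cong)

lemma chain_model_self:
  "chain_model_self (cubes J) (deg_cubes J) (cube_bd J) (cubical_cx J) (cubical_map J) cubical_class (push (cpower J))"
  by (intro chain_model_self.intro chain_model_map chain_model_self_axioms.intro push_id)

lemma dimension:
  fixes X :: "'a cspace"
  assumes X: "closure_space X" "pts X = {x}" and n: "n \<ge> 1"
  shows "chain_model.rel_cyc (cubes J) (deg_cubes J) (cube_bd J) X {} n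
    \<subseteq> chain_model.rel_bdry (cubes J) (deg_cubes J) (cube_bd J) X {} n"
proof
  interpret chain_model "cubes J" "deg_cubes J" "cube_bd J" "cubical_cx J"
    "cubical_map J :: ('a, _, 'a, _) cx_map" cubical_class by (rule chain_model)
  fix c assume c: "c \<in> rel_cyc X {} n"
  have "\<sigma> \<in> deg_cubes J n" if "\<sigma> \<in> cubes J X n" for \<sigma>
    using sing_pts[OF that] X(2) n by (intro degI[OF sing_ext[OF that], of 1]) auto
  then have "c \<in> ch (deg_cubes J n)" using c by (auto simp: rel_cyc_def elim: ch_mono[rotated])
  then show "c \<in> rel_bdry X {} n" by (intro rel_null_in_rel_bdry D_rel_null)
qed

text \<open>The homotopy parameter becomes the last coordinate, so the faces in the other directions
  keep their indices and signs.\<close>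

definition cyl :: "('a \<times> real \<Rightarrow> 'b) \<Rightarrow> nat \<Rightarrow> 'a cube_chain \<Rightarrow> 'b cube_chain" where
  "cyl H n = frag_extend (\<lambda>\<sigma>. frag_of (compose (cube J (Suc n)) (\<lambda>x. H (\<sigma> (restrict x {1..n}), x (Suc n))) id))"

lemma cyl_diff: "cyl H n (x - y) = cyl H n x - cyl H n y"
  by (simp add: cyl_def frag_extend_diff)

lemma restrict_in: "x \<in> cube J (Suc n) \<Longrightarrow> restrict x {1..n} \<in> cube J n"
  by (auto simp: pts_cpower PiE_iff)

lemma cyl_S:
  assumes X: "closure_space X" and H: "cont (cprod X J) Y H" and c: "c \<in> ch (cubes J X n)"
  shows "cyl H n c \<in> ch (cubes J Y (Suc n))"
  unfolding cyl_def using c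
proof (rule extend_ch)
  fix \<sigma> assume \<sigma>: "\<sigma> \<in> cubes J X n"
  have r: "cont (cpower J (Suc n)) (cpower J n) (\<lambda>x. restrict x {1..n})"
  proof (rule cont_cpower[OF cs_M cs_J])
    fix i assume i: "i \<in> {1..n}"
    then have "i \<in> {1..Suc n}" by auto
    from cont_coord[OF cs_J this] show "cont (cpower J (Suc n)) J (\<lambda>x. restrict x {1..n} i)" using i by simp
  qed simp
  have "cont (cpower J (Suc n)) (cprod X J) (\<lambda>x. ((\<sigma> \<circ> (\<lambda>x. restrict x {1..n})) x, x (Suc n)))"
    by (rule cont_Pair[OF cs_M X cs_J cont_compose[OF r sing_cont[OF \<sigma>]] cont_coord[OF cs_J]]) simp
  from sing_restrict[OF cont_compose[OF this H]]
  show "frag_of (compose (cube J (Suc n)) (\<lambda>x. H (\<sigma> (restrict x {1..n}), x (Suc n))) id)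
      \<in> ch (cubes J Y (Suc n))"
    by (simp add: compose_def comp_def)
qed

lemma cyl_deg: 
  fixes H :: "'b \<times> real \<Rightarrow> 'c"
  assumes "c \<in> ch (deg_cubes J n)" shows "cyl H n c \<in> ch (deg_cubes J (Suc n))"
  unfolding cyl_def using assms
proof (rule extend_ch)
  fix \<sigma> :: "(nat \<Rightarrow> real) \<Rightarrow> 'b" assume "\<sigma> \<in> deg_cubes J n"
  then obtain i where i: "i \<in> {1..n}" "\<And>x y. x \<in> cube J n \<Longrightarrow> y \<in> cube J n \<Longrightarrow>
      (\<forall>j. j \<noteq> i \<longrightarrow> x j = y j) \<Longrightarrow> \<sigma> x = \<sigma> y"
    by (elim degE) metis
  have i': "i \<in> {1..Suc n}" using i(1) by auto
  have "compose (cube J (Suc n)) (\<lambda>x. H (\<sigma> (restrict x {1..n}), x (Suc n))) id \<in> deg_cubes J (Suc n)"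
  proof (rule degI[OF compose_extensional i'])
    fix x y assume xy: "x \<in> cube J (Suc n)" "y \<in> cube J (Suc n)" "\<forall>j. j \<noteq> i \<longrightarrow> x j = y j"
    have "\<sigma> (restrict x {1..n}) = \<sigma> (restrict y {1..n})"
      using xy by (intro i(2) restrict_in) (auto simp: restrict_def)
    moreover have "x (Suc n) = y (Suc n)" using xy(3) i(1) by auto
    ultimately show "compose (cube J (Suc n)) (\<lambda>x. H (\<sigma> (restrict x {1..n}), x (Suc n))) id x =
        compose (cube J (Suc n)) (\<lambda>x. H (\<sigma> (restrict x {1..n}), x (Suc n))) id y"
      using xy by (simp add: compose_def)
  qed
  then show "frag_of (compose (cube J (Suc n)) (\<lambda>x. H (\<sigma> (restrict x {1..n}), x (Suc n))) id) \<in> ch (deg_cubes J (Suc n))"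
    by simp
qed

text \<open>In the first \<open>n\<close> directions the face differences of the cylinder are
  cylinders over those of \<open>c\<close>; in the last direction one gets the end at 0 minus the
  end at 1. The latter carries the sign of index \<open>Suc n\<close>, which accounts for the power
  of -1.\<close>

lemma cube_bd_cyl:
  assumes c: "c \<in> ch (cubes J X n)"
    and fg: "\<And>x. x \<in> pts X \<Longrightarrow> H (x, 0) = f x \<and> H (x, 1) = g x"
  shows "cube_bd J (Suc n) (cyl H n c) - (case n of 0 \<Rightarrow> 0 | Suc k \<Rightarrow> cyl H k (cube_bd J n c))
    = frag_cmul ((-1) ^ Suc n) (push (cpower J) n f c - push (cpower J) n g c)"
proof -
  have face: "face_diff J (Suc n) j (cyl H n c) = cyl H k (face_diff J n j c)" if n: "n = Suc k" and j: "j \<in> {1..n}" for k j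
  proof -
    have "compose (cube J n) (compose (cube J (Suc n)) (\<lambda>x. H (\<sigma> (restrict x {1..n}), x (Suc n))) id) (insert_coord j t)
      = compose (cube J n) (\<lambda>x. H (compose (cube J k) \<sigma> (insert_coord j t) (restrict x {1..k}), x n)) id"
      if t: "t \<in> pts J" for t \<sigma>
    proof (rule compose_compose_eq)
      fix x assume x: "x \<in> cube J n"
      have jn: "j \<in> {1..Suc n}" "j \<in> {1..Suc k}" using j n by auto
      have "restrict (insert_coord j t x) {1..n} = insert_coord j t (restrict x {1..k})"
        using j n by (auto simp: insert_coord_def restrict_def fun_eq_iff)
      moreover have "insert_coord j t x (Suc n) = x n" using j by (auto simp: insert_coord_def)
      ultimately show "insert_coord j t x \<in> cube J (Suc n) \<and>
          H (\<sigma> (restrict (id (insert_coord j t x)) {1..n}), id (insert_coord j t x) (Suc n)) =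
          H (compose (cube J k) \<sigma> (insert_coord j t) (restrict (id x) {1..k}), id x n)"
        using insert_coord_in[OF x jn(1) t] restrict_in[of x k] x n by (simp add: compose_def)
    qed
    note eq = this
    have "pullc J n (insert_coord j t) (cyl H n c) = cyl H k (pullc J k (insert_coord j t) c)" if t: "t \<in> pts J" for t
    proof -
      have "pullc J n (insert_coord j t) (cyl H n c) = frag_extend (\<lambda>\<sigma>. frag_of (compose (cube J n)
          (compose (cube J (Suc n)) (\<lambda>x. H (\<sigma> (restrict x {1..n}), x (Suc n))) id) (insert_coord j t))) c"
        using frag_extend_compose[of "\<lambda>\<sigma>. frag_of (compose (cube J n) \<sigma> (insert_coord j t))"
            "\<lambda>\<sigma>. compose (cube J (Suc n)) (\<lambda>x. H (\<sigma> (restrict x {1..n}), x (Suc n))) id" c]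
        by (simp only: pullc_def cyl_def comp_def)
      also have "\<dots> = frag_extend (\<lambda>\<sigma>. frag_of (compose (cube J n)
          (\<lambda>x. H (compose (cube J k) \<sigma> (insert_coord j t) (restrict x {1..k}), x n)) id)) c"
        by (simp only: eq[OF t])
      also have "\<dots> = cyl H k (pullc J k (insert_coord j t) c)"
        using frag_extend_compose[of "\<lambda>\<sigma>. frag_of (compose (cube J n) (\<lambda>x. H (\<sigma> (restrict x {1..k}), x n)) id)"
            "\<lambda>\<sigma>. compose (cube J k) \<sigma> (insert_coord j t)" c]
        by (simp only: pullc_def cyl_def comp_def n)
      finally show ?thesis .
    qed
    then show ?thesis using J01 n by (simp add: face_diff_def cyl_diff)
  qed
  have top: "face_diff J (Suc n) (Suc n) (cyl H n c) = push (cpower J) n f c - push (cpower J) n g c"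
  proof -
    have "pullc J n (insert_coord (Suc n) t) (cyl H n c) = push (cpower J) n h c"
      if t: "t \<in> pts J" and h: "\<And>x. x \<in> pts X \<Longrightarrow> H (x, t) = h x" for t h
      using c
    proof (induction c rule: ch_induct)
      case (one \<sigma>)
      have "compose (cube J n) (compose (cube J (Suc n)) (\<lambda>x. H (\<sigma> (restrict x {1..n}), x (Suc n))) id) (insert_coord (Suc n) t)
        = compose (cube J n) h \<sigma>"
      proof (rule compose_compose_eq)
        fix x assume x: "x \<in> cube J n"
        have "restrict (insert_coord (Suc n) t x) {1..n} = x"
          using x by (auto simp: insert_coord_def restrict_def fun_eq_iff pts_cpower_iff)
        then show "insert_coord (Suc n) t x \<in> cube J (Suc n) \<and>
          H (\<sigma> (restrict (id (insert_coord (Suc n) t x)) {1..n}), id (insert_coord (Suc n) t x) (Suc n)) = h (\<sigma> x)"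
          using insert_coord_in[OF x _ t] h sing_pts[OF one x] by (simp add: insert_coord_def)
      qed
      then show ?case by (simp only: pullc_def cyl_def push_def frag_extend_of)
    qed (simp_all add: pullc_diff cyl_diff push_diff, simp add: pullc_def cyl_def push_def)
    from this[OF J01(1), of f] this[OF J01(2), of g] show ?thesis using fg by (simp add: face_diff_def)
  qed
  have "cube_bd J (Suc n) (cyl H n c) = (\<Sum>j=1..n. frag_cmul ((-1) ^ j) (face_diff J (Suc n) j (cyl H n c)))
      + frag_cmul ((-1) ^ Suc n) (face_diff J (Suc n) (Suc n) (cyl H n c))"
    by (simp add: cube_bd_def)
  moreover have "(\<Sum>j=1..n. frag_cmul ((-1) ^ j) (face_diff J (Suc n) j (cyl H n c))) = (case n of 0 \<Rightarrow> 0 | Suc k \<Rightarrow> cyl H k (cube_bd J n c))"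
  proof (cases n)
    case (Suc k)
    have "(\<Sum>j=1..n. frag_cmul ((-1) ^ j) (face_diff J (Suc n) j (cyl H n c))) = (\<Sum>j=1..n. frag_cmul ((-1) ^ j) (cyl H k (face_diff J n j c)))"
      using face[OF Suc] by (intro sum.cong refl) simp
    also have "\<dots> = cyl H k (cube_bd J n c)"
      unfolding cube_bd_def by (simp only: additive_signed_sum[where f = "cyl H k", OF cyl_diff])
    finally show ?thesis using Suc by simp
  qed simp
  ultimately show ?thesis using top by simp
qed

lemma homotopy:
  fixes X :: "'a cspace" and Y :: "'b cspace"
  assumes X: "closure_space X" and Y: "closure_space Y" and h: "one_step_homotopic J X Y f g"
    and z: "z \<in> chain_model.rel_cyc (cubes J) (deg_cubes J) (cube_bd J) X {} n"
  shows "push (cpower J) n f z - push (cpower J) n g z \<in> chain_model.rel_bdry (cubes J) (deg_cubes J) (cube_bd J) Y {} n"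
proof -
  interpret A: chain_model "cubes J" "deg_cubes J" "cube_bd J" "cubical_cx J"
    "cubical_map J :: ('a, _, 'a, _) cx_map" cubical_class by (rule chain_model)
  interpret B: chain_model "cubes J" "deg_cubes J" "cube_bd J" "cubical_cx J"
    "cubical_map J :: ('b, _, 'b, _) cx_map" cubical_class by (rule chain_model)
  obtain H where H: "cont (cprod X J) Y H" "\<And>x. x \<in> pts X \<Longrightarrow> H (x, 0) = f x \<and> H (x, 1) = g x"
    using h unfolding one_step_homotopic_def by blast
  have zS: "z \<in> ch (cubes J X n)" using z by (simp add: A.rel_cyc_def)
  let ?t = "case n of 0 \<Rightarrow> 0 | Suc k \<Rightarrow> cyl H k (cube_bd J n z)"
  let ?s = "(-1) ^ Suc n :: int" and ?w = "cyl H n z"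
  have t: "?t \<in> ch (deg_cubes J n)"
    using z A.rel_null_empty[OF X] cyl_deg by (cases n) (auto simp: A.rel_cyc_def)
  \<comment> \<open>The square of the sign is 1; inserting it cancels the sign in
    \<open>cube_bd_cyl\<close>.\<close>
  have "push (cpower J) n f z - push (cpower J) n g z = frag_cmul (?s * ?s) (push (cpower J) n f z - push (cpower J) n g z)"
    by (simp flip: power_add)
  also have "\<dots> = frag_cmul ?s (cube_bd J (Suc n) ?w - ?t)"
    by (simp only: cube_bd_cyl[where f = f and g = g, OF zS H(2)] frag_cmul_cmul)
  also have "\<dots> = cube_bd J (Suc n) (frag_cmul ?s ?w) - frag_cmul ?s ?t"
    unfolding frag_cmul_diff cube_bd_eq frag_extend_cmul ..
  finally have "push (cpower J) n f z - push (cpower J) n g z - cube_bd J (Suc n) (frag_cmul ?s ?w) = - frag_cmul ?s ?t" by simp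
  also have "\<dots> \<in> B.rel_null Y {} n" by (intro B.D_rel_null minus_ch cmul_ch t)
  finally show ?thesis using B.in_rel_bdry[OF cmul_ch[OF cyl_S[OF X H(1) zS]]] by blast
qed

lemma homology_theory_cubical:
  assumes small: "\<And>n (X :: 'a cspace) A B z. closure_space X \<Longrightarrow> interior_cover X {A, B} \<Longrightarrow> z \<in> ch (cubes J X n) \<Longrightarrow>
      (\<And>k. n = Suc k \<Longrightarrow> cube_bd J n z \<in> ch (cubes J (subspace X A) k \<union> cubes J (subspace X B) k \<union> deg_cubes J k)) \<Longrightarrow>
      \<exists>w\<in>ch (cubes J X (Suc n)). z - cube_bd J (Suc n) w \<in> ch (cubes J (subspace X A) n \<union> cubes J (subspace X B) n \<union> deg_cubes J n)"
  shows "homology_theory J (cub_H J :: ('a, _) pair_groups) (cub_H J :: ('b, _) pair_groups)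
    (cub_H J :: ('c, _) pair_groups) (cub_map J) (cub_map J) (cub_map J) (cub_map J) (cub_conn J) (cub_conn J)"
proof -
  have cm: "cub_map J = (\<lambda>n X A Y B f. rel_hom_map (cubical_cx J) (cubical_map J) (cubical_map J) n Y B f)"
    by (intro ext) (simp add: cub_map_def)
  show ?thesis
    unfolding cub_H_def cub_conn_def cm
  proof (rule homology_theory_chain_model[OF chain_model_self chain_model_map chain_model_map chain_model_map])
    show "\<And>n X f g c. push (cpower J) n (g \<circ> f) c = push (cpower J) n g (push (cpower J) n f c)" by (rule push_compose)
  qed (use homotopy dimension small in simp_all)
qed

lemma homology_theory_cubical_of_point:
  assumes J: "\<And>V. nbhd J 1 V \<Longrightarrow> V = pts J"
  shows "homology_theory J (cub_H J :: ('a, _) pair_groups) (cub_H J :: ('b, _) pair_groups)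
    (cub_H J :: ('c, _) pair_groups) (cub_map J) (cub_map J) (cub_map J) (cub_map J) (cub_conn J) (cub_conn J)"
proof (rule homology_theory_cubical)
  fix n and X :: "'a cspace" and A B z
  assume X: "closure_space X" "interior_cover X {A, B}" and z: "z \<in> ch (cubes J X n)"
  \<comment> \<open>All coordinates are 1: a box of neighborhoods around this point is the whole
    cube, because each factor is all of \<open>J\<close>.\<close>
  let ?x = "restrict (\<lambda>_. 1) {1..n} :: nat \<Rightarrow> real"
  have "V = cube J n" if V: "nbhd (cpower J n) ?x V" for V
  proof -
    obtain U where U: "\<forall>i\<in>{1..n}. nbhd J (?x i) (U i)" "Pi\<^sub>E {1..n} U \<subseteq> V" and Vs: "V \<subseteq> cube J n"
      using V[unfolded nbhd_cpower[OF cs_J]] by blast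
    have "\<forall>i\<in>{1..n}. U i = pts J" using U(1) J by simp
    then have "Pi\<^sub>E {1..n} U = cube J n" unfolding pts_cpower by (intro PiE_cong) simp
    then show ?thesis using U(2) Vs by blast
  qed
  moreover have "?x \<in> cube J n" using J01 by (simp add: pts_cpower)
  ultimately have "cubes J X n \<subseteq>
      cubes J (subspace X A) n \<union> cubes J (subspace X B) n"
    using sing_small_of_point[OF X] by blast
  then show "\<exists>w\<in>ch (cubes J X (Suc n)). z - cube_bd J (Suc n) w
      \<in> ch (cubes J (subspace X A) n \<union> cubes J (subspace X B) n \<union> deg_cubes J n)"
    using ch_mono[OF le_supI1 z] by (intro bexI[of _ 0]) simp_all
qed

end

lemma homology_theory_cubical_1:
  "homology_theory J_1 (cub_H J_1 :: ('a, _) pair_groups) (cub_H J_1 :: ('b, _) pair_groups)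
    (cub_H J_1 :: ('c, _) pair_groups) (cub_map J_1) (cub_map J_1) (cub_map J_1) (cub_map J_1) (cub_conn J_1) (cub_conn J_1)"
proof -
  interpret cube_model J_1 by unfold_locales (simp_all add: J_1_def closure_space_indiscrete_cspace)
  show ?thesis by (rule homology_theory_cubical_of_point) (simp add: J_1_def nbhd_indiscrete_cspace)
qed

lemma homology_theory_cubical_plus:
  "homology_theory J_plus (cub_H J_plus :: ('a, _) pair_groups) (cub_H J_plus :: ('b, _) pair_groups)
    (cub_H J_plus :: ('c, _) pair_groups) (cub_map J_plus) (cub_map J_plus) (cub_map J_plus) (cub_map J_plus)
    (cub_conn J_plus) (cub_conn J_plus)"
proof -
  interpret cube_model J_plus by unfold_locales (simp_all add: J_plus_def closure_space_up_cspace)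
  show ?thesis by (rule homology_theory_cubical_of_point) (auto simp: J_plus_def nbhd_up_cspace)
qed

section \<open>Subdivision of topological cubes\<close>

lemma pts_J_I [simp]: "pts J_I = {0..1}"
  by (simp add: J_I_def)

lemma cube_model_I: "cube_model J_I"
  by unfold_locales (simp_all add: J_I_def closure_space_top_cspace)

interpretation I: cube_model J_I by (rule cube_model_I)

section \<open>Metric neighborhoods and Lebesgue numbers in the unit cube\<close>

lemma nbhd_J_I: "nbhd J_I x V \<longleftrightarrow> V \<subseteq> {0..1} \<and> x \<in> {0..1} \<and> (\<exists>e>0. \<forall>y\<in>{0..1}. \<bar>y - x\<bar> < e \<longrightarrow> y \<in> V)"
proof -
  have "x \<in> top_of_set {0..1} interior_of V \<longleftrightarrow> x \<in> {0..1} \<and> (\<exists>e>0. \<forall>y\<in>{0..1}. \<bar>y - x\<bar> < e \<longrightarrow> y \<in> V)"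
  proof
    assume "x \<in> top_of_set {0..1} interior_of V"
    then obtain T where "openin (top_of_set {0..1}) T" "x \<in> T" "T \<subseteq> V" by (auto simp: interior_of_def)
    then show "x \<in> {0..1} \<and> (\<exists>e>0. \<forall>y\<in>{0..1}. \<bar>y - x\<bar> < e \<longrightarrow> y \<in> V)"
      unfolding openin_euclidean_subtopology_iff dist_real_def by blast
  next
    assume R: "x \<in> {0..1} \<and> (\<exists>e>0. \<forall>y\<in>{0..1}. \<bar>y - x\<bar> < e \<longrightarrow> y \<in> V)"
    then obtain e where e: "e > 0" "\<forall>y\<in>{0..1}. \<bar>y - x\<bar> < e \<longrightarrow> y \<in> V" by blast
    have "openin (top_of_set {0..1}) ({0..1} \<inter> ball x e)" by (simp add: openin_open_Int)
    moreover have "x \<in> {0..1} \<inter> ball x e" using R e(1) by simp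
    moreover have "{0..1} \<inter> ball x e \<subseteq> V" using e(2) by (auto simp: dist_real_def abs_minus_commute)
    ultimately show "x \<in> top_of_set {0..1} interior_of V" unfolding interior_of_def by blast
  qed
  then show ?thesis by (auto simp: J_I_def nbhd_top_cspace)
qed

lemma nbhd_cube_iff:
  assumes x: "x \<in> cube J_I n" and W: "W \<subseteq> cube J_I n"
  shows "nbhd (cpower J_I n) x W \<longleftrightarrow>
    (\<exists>r>0. \<forall>y\<in>cube J_I n. (\<forall>j\<in>{1..n}. \<bar>y j - x j\<bar> < r) \<longrightarrow> y \<in> W)" (is "?L \<longleftrightarrow> ?R")
proof
  assume ?L
  then obtain U where U: "\<forall>j\<in>{1..n}. nbhd J_I (x j) (U j)" "Pi\<^sub>E {1..n} U \<subseteq> W"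
    unfolding nbhd_cpower[OF I.cs_J] by blast
  have "\<forall>j\<in>{1..n}. \<exists>e>0. \<forall>y\<in>{0..1}. \<bar>y - x j\<bar> < e \<longrightarrow> y \<in> U j"
    using U(1) unfolding nbhd_J_I by blast
  then obtain e where e: "\<And>j. j \<in> {1..n} \<Longrightarrow> e j > 0"
    "\<And>j y. j \<in> {1..n} \<Longrightarrow> y \<in> {0..1} \<Longrightarrow> \<bar>y - x j\<bar> < e j \<Longrightarrow> y \<in> U j" by metis
  \<comment> \<open>The smallest of finitely many radii; the extra 1 keeps the set nonempty when
    \<open>n = 0\<close>.\<close>
  define r where "r = Min (insert 1 (e ` {1..n}))"
  have r: "r > 0" "\<And>j. j \<in> {1..n} \<Longrightarrow> r \<le> e j"
    using e(1) unfolding r_def by (auto simp del: Min_insert intro!: Min_le)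
  have "y \<in> W" if y: "y \<in> cube J_I n" and d: "\<forall>j\<in>{1..n}. \<bar>y j - x j\<bar> < r" for y
  proof -
    have "y j \<in> U j" if "j \<in> {1..n}" for j
    proof (rule e(2)[OF that])
      show "y j \<in> {0..1}" using y that by (auto simp: pts_cpower PiE_iff)
      show "\<bar>y j - x j\<bar> < e j" using d that r(2)[OF that] by force
    qed
    moreover have "y \<in> extensional {1..n}" using y by (simp add: pts_cpower PiE_iff)
    ultimately have "y \<in> Pi\<^sub>E {1..n} U" unfolding PiE_iff by blast
    then show ?thesis using U(2) by blast
  qed
  then show ?R using r(1) by blast
next
  assume ?R
  then obtain r where r: "r > 0" "\<And>y. y \<in> cube J_I n \<Longrightarrow> (\<forall>j\<in>{1..n}. \<bar>y j - x j\<bar> < r) \<Longrightarrow> y \<in> W" by blast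
  let ?U = "\<lambda>j. {y \<in> {0..1}. \<bar>y - x j\<bar> < r}"
  have "\<forall>j\<in>{1..n}. nbhd J_I (x j) (?U j)"
    using x r(1) unfolding nbhd_J_I pts_cpower PiE_iff by auto
  moreover have "Pi\<^sub>E {1..n} ?U \<subseteq> W"
    using r(2) by (auto simp: pts_cpower PiE_iff)
  ultimately show ?L using x W unfolding nbhd_cpower[OF I.cs_J] by (intro conjI exI[of _ ?U])
qed

text \<open>A Lipschitz condition for the maximum norm, phrased through strict coordinate bounds.
  The constant 2 is generous enough for the product in \<open>shear\<close>, and the radius
  \<open>e / 2\<close> compensates for it.\<close>

lemma cont_cube_lipschitz:
  assumes im: "\<And>x. x \<in> cube J_I m \<Longrightarrow> h x \<in> {0..1}"
    and lip: "\<And>x y e. x \<in> cube J_I m \<Longrightarrow> y \<in> cube J_I m \<Longrightarrow> 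
      (\<forall>j\<in>{1..m}. \<bar>y j - x j\<bar> < e) \<Longrightarrow> \<bar>h y - h x\<bar> < 2 * e"
  shows "cont (cpower J_I m) J_I h"
  unfolding cont_iff_nbhd[OF I.cs_M I.cs_J]
proof (intro conjI ballI allI impI)
  show "h ` cube J_I m \<subseteq> pts J_I" using im by auto
  fix x V assume x: "x \<in> cube J_I m" and "nbhd J_I (h x) V"
  then obtain e where e: "e > 0" "\<And>y. y \<in> {0..1} \<Longrightarrow> \<bar>y - h x\<bar> < e \<Longrightarrow> y \<in> V" unfolding nbhd_J_I by blast
  have "h y \<in> V" if y: "y \<in> cube J_I m" "\<forall>j\<in>{1..m}. \<bar>y j - x j\<bar> < e / 2" for y
    using e(2)[OF im[OF y(1)]] lip[OF x y] by simp
  then show "nbhd (cpower J_I m) x {z \<in> cube J_I m. h z \<in> V}"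
    using e(1) by (subst nbhd_cube_iff[OF x]) (auto intro!: exI[of _ "e / 2"])
qed

text \<open>The Lebesgue number lemma for the preimages of \<open>A\<close> and \<open>B\<close>.
  They may fail to be open, so radii are chosen pointwise from neighborhoods, and compactness is
  applied to open boxes around the points.\<close>

lemma lebesgue_cube:
  assumes X: "closure_space X" and cov: "interior_cover X {A, B}" and \<sigma>: "cont (cpower J_I n) X \<sigma>"
  shows "\<exists>e>0. \<forall>x\<in>cube J_I n. \<exists>U\<in>{A, B}. \<forall>y\<in>cube J_I n.
    (\<forall>j\<in>{1..n}. \<bar>y j - x j\<bar> < e) \<longrightarrow> \<sigma> y \<in> U"
proof -
  let ?P = "cube J_I n"
  \<comment> \<open>The factor 2 leaves room for the triangle inequality: a point within
    \<open>r x\<close> of \<open>x\<close>, moved by less than \<open>r x\<close>, still stays in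
    the good region.\<close>
  let ?Q = "\<lambda>x r. r > 0 \<and> (\<exists>U\<in>{A, B}. \<forall>y\<in>?P. (\<forall>j\<in>{1..n}. \<bar>y j - x j\<bar> < 2 * r) \<longrightarrow> \<sigma> y \<in> U)"
  have "\<forall>x\<in>?P. \<exists>r. ?Q x r"
  proof
    fix x assume x: "x \<in> ?P"
    have "\<sigma> x \<in> pts X" using cont_image[OF \<sigma>] x by blast
    then obtain U where U: "U \<in> {A, B}" "nbhd X (\<sigma> x) U" using interior_cover_nbhd[OF cov] by blast
    have "\<forall>x\<in>?P. \<forall>V. nbhd X (\<sigma> x) V \<longrightarrow> nbhd (cpower J_I n) x {z \<in> ?P. \<sigma> z \<in> V}"
      using \<sigma> unfolding cont_iff_nbhd[OF I.cs_M X] by (rule conjunct2)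
    then have "nbhd (cpower J_I n) x {z \<in> ?P. \<sigma> z \<in> U}" using x U(2) by simp
    then obtain r where r: "r > 0" "\<forall>y\<in>?P. (\<forall>j\<in>{1..n}. \<bar>y j - x j\<bar> < r) \<longrightarrow> y \<in> {z \<in> ?P. \<sigma> z \<in> U}"
      using nbhd_cube_iff[OF x, of "{z \<in> ?P. \<sigma> z \<in> U}"] by auto
    then show "\<exists>r. ?Q x r" using U(1) by (intro exI[of _ "r / 2"] conjI bexI[of _ U]) auto
  qed
  from bchoice[OF this] obtain r where r: "\<forall>x\<in>?P. ?Q x (r x)" by (rule exE)
  let ?T = "product_topology (\<lambda>_. euclideanreal) {1..n}"
  let ?O = "\<lambda>x. Pi\<^sub>E {1..n} (\<lambda>j. {x j - r x <..< x j + r x})"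
  have comp: "compactin ?T ?P" by (simp add: pts_cpower compactin_PiE)
  have op: "openin ?T (?O x)" for x by (simp add: openin_PiE_gen)
  have self: "x \<in> ?O x" if "x \<in> ?P" for x using that bspec[OF r that] by (auto simp: pts_cpower PiE_iff)
  have "?P \<subseteq> \<Union>(?O ` ?P)" using self by blast
  moreover have "openin ?T U" if "U \<in> ?O ` ?P" for U using that op by auto
  ultimately obtain \<F> where \<F>: "finite \<F>" "\<F> \<subseteq> ?O ` ?P" "?P \<subseteq> \<Union>\<F>"
    using compactinD[OF comp, of "?O ` ?P"] by auto
  obtain F where F: "F \<subseteq> ?P" "finite F" "?P \<subseteq> \<Union>(?O ` F)"
    using finite_subset_image[OF \<F>(1,2)] \<F>(3) by auto
  define e where "e = Min (insert 1 (r ` F))"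
  have e: "e > 0" "\<And>x. x \<in> F \<Longrightarrow> e \<le> r x"
    using F r unfolding e_def by (auto simp del: Min_insert intro!: Min_le)
  have "\<exists>U\<in>{A, B}. \<forall>y\<in>?P. (\<forall>j\<in>{1..n}. \<bar>y j - x j\<bar> < e) \<longrightarrow> \<sigma> y \<in> U" if "x \<in> ?P" for x
  proof -
    obtain x0 where x0: "x0 \<in> F" "x \<in> ?O x0" using F(3) \<open>x \<in> ?P\<close> by blast
    obtain U where U: "U \<in> {A, B}" "\<forall>y\<in>?P. (\<forall>j\<in>{1..n}. \<bar>y j - x0 j\<bar> < 2 * r x0) \<longrightarrow> \<sigma> y \<in> U"
      using bspec[OF r subsetD[OF F(1) x0(1)]] by blast
    have "\<bar>y j - x0 j\<bar> < 2 * r x0" if "\<forall>j\<in>{1..n}. \<bar>y j - x j\<bar> < e" "j \<in> {1..n}" for y j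
    proof -
      have "x j \<in> {x0 j - r x0 <..< x0 j + r x0}" using x0(2) that(2) by (rule PiE_mem)
      then have "x0 j - r x0 < x j" "x j < x0 j + r x0" by simp_all
      moreover have "\<bar>y j - x j\<bar> < e" using that(1) by (rule bspec) (rule that(2))
      ultimately show ?thesis using e(2)[OF x0(1)] by linarith
    qed
    then have "\<sigma> y \<in> U" if "y \<in> ?P" "\<forall>j\<in>{1..n}. \<bar>y j - x j\<bar> < e" for y
      using bspec[OF U(2) that(1)] that(2) by simp
    then show ?thesis using U(1) by (intro bexI[of _ U]) simp_all
  qed
  then show ?thesis using e(1) by blast
qed

text \<open>The square \<open>(a, b) \<mapsto> a (1 + b) / 2\<close> has the faces \<open>0\<close>, \<open>(1 + b) / 2\<close>, \<open>a / 2\<close> and \<open>a\<close>, so modulo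
  degenerate cubes its boundary is the subdivided interval minus the interval. Applied to one
  coordinate at a time, it yields the chain homotopy from the identity to the subdivision.\<close>

definition coord_map :: "nat \<Rightarrow> (real \<Rightarrow> real) \<Rightarrow> (nat \<Rightarrow> real) \<Rightarrow> nat \<Rightarrow> real" where
  "coord_map i h x = x(i := h (x i))"

definition shear :: "nat \<Rightarrow> (nat \<Rightarrow> real) \<Rightarrow> nat \<Rightarrow> real" where
  "shear i x = (\<lambda>j. if j < i then x j else if j = i then x i * (1 + x (Suc i)) / 2 else x (Suc j))"

abbreviation lower :: "real \<Rightarrow> real" where "lower a \<equiv> a / 2"
abbreviation upper :: "real \<Rightarrow> real" where "upper a \<equiv> (1 + a) / 2"

lemma coord_map_insert_coord:
  "i < j \<Longrightarrow> coord_map i h (insert_coord j t x) = insert_coord j t (coord_map i h x)"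
  "j \<le> i \<Longrightarrow> coord_map (Suc i) h (insert_coord j t x) = insert_coord j t (coord_map i h x)"
  "coord_map i h (insert_coord i t x) = insert_coord i (h t) x"
  by (auto simp: coord_map_def insert_coord_def fun_eq_iff)

lemma shear_insert_coord:
  "j \<le> i \<Longrightarrow> shear (Suc i) (insert_coord j t x) = insert_coord j t (shear i x)"
  "i < j \<Longrightarrow> shear i (insert_coord (Suc j) t x) = insert_coord j t (shear i x)"
  "shear i (insert_coord i 0 x) = coord_map i (\<lambda>_. 0) x"
  "shear i (insert_coord i 1 x) = coord_map i upper x"
  "shear i (insert_coord (Suc i) 0 x) = coord_map i lower x"
  "shear i (insert_coord (Suc i) 1 x) = x"
  by (auto simp: coord_map_def shear_def insert_coord_def fun_eq_iff)

lemma coord_map_in: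
  "x \<in> cube J_I n \<Longrightarrow> i \<in> {1..n} \<Longrightarrow> (\<And>a. a \<in> {0..1} \<Longrightarrow> h a \<in> {0..1}) \<Longrightarrow> coord_map i h x \<in> cube J_I n"
  by (auto simp: pts_cpower PiE_iff extensional_def coord_map_def)

lemma shear_in:
  assumes x: "x \<in> cube J_I (Suc n)" and i: "i \<in> {1..n}"
  shows "shear i x \<in> cube J_I n"
proof -
  have a: "0 \<le> x j" "x j \<le> 1" if "j \<in> {1..Suc n}" for j using x that by (auto simp: pts_cpower PiE_iff)
  have "0 \<le> x i * (1 + x (Suc i)) / 2" using a(1)[of i] a(1)[of "Suc i"] i by simp
  moreover have "x i * (1 + x (Suc i)) \<le> 1 * 2"
    using a[of i] a[of "Suc i"] i by (intro mult_mono) auto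
  ultimately show ?thesis
    using x i by (auto simp: pts_cpower PiE_iff extensional_def shear_def)
qed

lemma cont_coord_map:
  assumes i: "i \<in> {1..n}" and h: "\<And>a. a \<in> {0..1} \<Longrightarrow> h a \<in> {0..1}" "\<And>a b. \<bar>h a - h b\<bar> \<le> \<bar>a - b\<bar> / 2"
  shows "cont (cpower J_I n) (cpower J_I n) (coord_map i h)"
proof (rule cont_cpower[OF I.cs_M I.cs_J])
  fix j assume j: "j \<in> {1..n}"
  show "cont (cpower J_I n) J_I (\<lambda>x. coord_map i h x j)"
  proof (cases "j = i")
    case True
    show ?thesis
    proof (rule cont_cube_lipschitz)
      show "coord_map i h x j \<in> {0..1}" if "x \<in> cube J_I n" for x
        using that True j h(1) by (auto simp: coord_map_def pts_cpower PiE_iff)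
      show "\<bar>coord_map i h y j - coord_map i h x j\<bar> < 2 * e" if "\<forall>j\<in>{1..n}. \<bar>y j - x j\<bar> < e" for x y e
      proof -
        have "\<bar>y i - x i\<bar> < e" using that i by blast
        moreover have "b < 2 * e" if "a < e" "0 \<le> a" "b \<le> a / 2" for a b :: real using that by linarith
        ultimately have "\<bar>h (y i) - h (x i)\<bar> < 2 * e" using h(2)[of "y i" "x i"] abs_ge_zero by blast
        then show ?thesis using True by (simp add: coord_map_def)
      qed
    qed
  qed (use cont_coord[OF I.cs_J j] in \<open>simp add: coord_map_def\<close>)
qed (use coord_map_in[OF _ i h(1)] in \<open>auto simp: pts_cpower PiE_iff\<close>)

lemma cont_shear:
  assumes i: "i \<in> {1..n}"
  shows "cont (cpower J_I (Suc n)) (cpower J_I n) (shear i)"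
proof (rule cont_cpower[OF I.cs_M I.cs_J])
  fix j assume j: "j \<in> {1..n}"
  then have j': "j \<in> {1..Suc n}" "Suc j \<in> {1..Suc n}" by auto
  consider "j < i" | "j = i" | "i < j" by linarith
  then show "cont (cpower J_I (Suc n)) J_I (\<lambda>x. shear i x j)"
  proof cases
    case 2
    show ?thesis
    proof (rule cont_cube_lipschitz)
      show "shear i x j \<in> {0..1}" if "x \<in> cube J_I (Suc n)" for x
        using shear_in[OF that i] j by (auto simp: pts_cpower PiE_iff)
      fix x y e assume x: "x \<in> cube J_I (Suc n)" and y: "y \<in> cube J_I (Suc n)"
        and e: "\<forall>j\<in>{1..Suc n}. \<bar>y j - x j\<bar> < e"
      let ?a = "x i" and ?b = "x (Suc i)" and ?c = "y i" and ?d = "y (Suc i)"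
      have ab: "0 \<le> ?a" "?a \<le> 1" "0 \<le> ?d" "?d \<le> 1" "\<bar>?c - ?a\<bar> < e" "\<bar>?d - ?b\<bar> < e"
        using x y e j' 2 by (auto simp: pts_cpower PiE_iff)
      \<comment> \<open>The factor \<open>1 + ?d\<close> is at most 2 and \<open>?a\<close> at most
        1, so the numerators differ by less than \<open>4 * e\<close>; halving gives the Lipschitz
        constant 2.\<close>
      have "?c * (1 + ?d) - ?a * (1 + ?b) = (?c - ?a) * (1 + ?d) + ?a * (?d - ?b)" by (simp add: algebra_simps)
      also have "\<bar>\<dots>\<bar> \<le> \<bar>?c - ?a\<bar> * (1 + ?d) + ?a * \<bar>?d - ?b\<bar>"
        using abs_triangle_ineq[of "(?c - ?a) * (1 + ?d)" "?a * (?d - ?b)"] ab by (simp add: abs_mult)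
      also have "\<dots> \<le> \<bar>?c - ?a\<bar> * 2 + 1 * \<bar>?d - ?b\<bar>"
        using ab by (intro add_mono mult_left_mono mult_right_mono) auto
      also have "\<dots> < 4 * e"
      proof -
        have "a * 2 + 1 * b < 4 * e" if "a < e" "b < e" "0 \<le> a" for a b :: real using that by linarith
        then show ?thesis using ab(5,6) abs_ge_zero by blast
      qed
      finally show "\<bar>shear i y j - shear i x j\<bar> < 2 * e"
        using 2 by (simp add: shear_def diff_divide_distrib[symmetric])
    qed
  qed (use cont_coord[OF I.cs_J j'(1)] cont_coord[OF I.cs_J j'(2)] in \<open>simp_all add: shear_def\<close>)
qed (use shear_in[OF _ i] in \<open>auto simp: pts_cpower PiE_iff\<close>)

section \<open>Halving operators and the homotopy built from shears\<close>

definition halve :: "nat \<Rightarrow> nat \<Rightarrow> 'a cube_chain \<Rightarrow> 'a cube_chain" where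
  "halve n i c = pullc J_I n (coord_map i lower) c + pullc J_I n (coord_map i upper) c"

text \<open>Coordinates are halved from \<open>i\<close> down to 1, which suits the induction over
  faces. With \<open>i = n\<close> a cube is replaced by its \<open>2 ^ n\<close> subcubes.\<close>

primrec halve_upto :: "nat \<Rightarrow> nat \<Rightarrow> 'a cube_chain \<Rightarrow> 'a cube_chain" where
  "halve_upto n 0 c = c"
| "halve_upto n (Suc i) c = halve_upto n i (halve n (Suc i) c)"

text \<open>Connects halving the coordinates below \<open>i\<close> with halving those up to
  \<open>i\<close>: coordinate \<open>i\<close> is spread over the two coordinates \<open>i\<close>
  and \<open>Suc i\<close> of the shear, and the coordinates below, whose indices are unaffected,
  are halved.\<close>

definition shear_homotopy :: "nat \<Rightarrow> nat \<Rightarrow> 'a cube_chain \<Rightarrow> 'a cube_chain" where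
  "shear_homotopy n i c = halve_upto (Suc n) (i - 1) (pullc J_I (Suc n) (shear i) c)"

text \<open>The boundaries of the signed shears telescope to the identity minus the full
  subdivision; the leading minus turns this around.\<close>

definition cube_homotopy :: "nat \<Rightarrow> 'a cube_chain \<Rightarrow> 'a cube_chain" where
  "cube_homotopy n c = - (\<Sum>i=1..n. frag_cmul ((-1) ^ i) (shear_homotopy n i c))"

lemma halve_diff: "halve n i (x - y) = halve n i x - halve n i y"
  by (simp add: halve_def pullc_diff)

lemma halve_upto_diff: "halve_upto n i (x - y) = halve_upto n i x - halve_upto n i y"
  by (induction i arbitrary: x y) (simp_all add: halve_diff)

lemma halve_upto_add: "halve_upto n i (x + y) = halve_upto n i x + halve_upto n i y"
  using halve_upto_diff[of n i x "- y"] halve_upto_diff[of n i 0 y] halve_upto_diff[of n i 0 0] by simp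

lemma shear_homotopy_diff: "shear_homotopy n i (x - y) = shear_homotopy n i x - shear_homotopy n i y"
  by (simp add: shear_homotopy_def pullc_diff halve_upto_diff)

lemma cube_homotopy_diff: "cube_homotopy n (x - y) = cube_homotopy n x - cube_homotopy n y"
  by (simp add: cube_homotopy_def shear_homotopy_diff frag_cmul_diff sum_subtractf)

lemma half_in: "a \<in> {0..1} \<Longrightarrow> lower a \<in> {0..1}" "a \<in> {0..1} \<Longrightarrow> upper a \<in> {0..1}"
  by auto

text \<open>Inserting a coordinate after position \<open>i\<close> leaves that position in place;
  inserting one at or before it moves it to \<open>Suc i\<close>. Hence the two index
  patterns.\<close>

lemma face_diff_pullc_coord_map:
  assumes h: "\<And>a. a \<in> {0..1} \<Longrightarrow> h a \<in> {0..1}"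
  shows "1 \<le> i \<Longrightarrow> i < j \<Longrightarrow> j \<le> Suc n \<Longrightarrow>
      face_diff J_I (Suc n) j (pullc J_I (Suc n) (coord_map i h) c) = pullc J_I n (coord_map i h) (face_diff J_I (Suc n) j c)"
    and "1 \<le> j \<Longrightarrow> j \<le> i \<Longrightarrow> i \<le> n \<Longrightarrow>
      face_diff J_I (Suc n) j (pullc J_I (Suc n) (coord_map (Suc i) h) c) = pullc J_I n (coord_map i h) (face_diff J_I (Suc n) j c)"
proof -
  assume ij: "1 \<le> i" "i < j" "j \<le> Suc n"
  have "pullc J_I n (insert_coord j t) (pullc J_I (Suc n) (coord_map i h) c) = pullc J_I n (coord_map i h) (pullc J_I n (insert_coord j t) c)"
    if "t \<in> pts J_I" for t
    using ij that I.insert_coord_in[of _ n j t] coord_map_in[of _ n i h] h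
    by (intro pullc_comm) (simp add: coord_map_insert_coord)
  then show "face_diff J_I (Suc n) j (pullc J_I (Suc n) (coord_map i h) c) = pullc J_I n (coord_map i h) (face_diff J_I (Suc n) j c)"
    by (simp add: face_diff_def pullc_diff)
next
  assume ij: "1 \<le> j" "j \<le> i" "i \<le> n"
  have "pullc J_I n (insert_coord j t) (pullc J_I (Suc n) (coord_map (Suc i) h) c) = pullc J_I n (coord_map i h) (pullc J_I n (insert_coord j t) c)"
    if "t \<in> pts J_I" for t
    using ij that I.insert_coord_in[of _ n j t] coord_map_in[of _ n i h] h
    by (intro pullc_comm) (simp add: coord_map_insert_coord)
  then show "face_diff J_I (Suc n) j (pullc J_I (Suc n) (coord_map (Suc i) h) c) = pullc J_I n (coord_map i h) (face_diff J_I (Suc n) j c)"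
    by (simp add: face_diff_def pullc_diff)
qed

lemma face_diff_add: "face_diff J n j (x + y) = face_diff J n j x + face_diff J n j y"
  by (simp add: face_diff_def pullc_def frag_extend_add)

lemma face_diff_halve_lt:
  assumes "1 \<le> i" "i < j" "j \<le> Suc n"
  shows "face_diff J_I (Suc n) j (halve (Suc n) i c) = halve n i (face_diff J_I (Suc n) j c)"
  unfolding halve_def face_diff_add
  by (intro arg_cong2[where f = "(+)"]; rule face_diff_pullc_coord_map(1)) (use assms in auto)

lemma face_diff_halve_le:
  assumes "1 \<le> j" "j \<le> i" "i \<le> n"
  shows "face_diff J_I (Suc n) j (halve (Suc n) (Suc i) c) = halve n i (face_diff J_I (Suc n) j c)"
  unfolding halve_def face_diff_add
  by (intro arg_cong2[where f = "(+)"]; rule face_diff_pullc_coord_map(2)) (use assms in auto)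

text \<open>The two middle faces of the halves cancel.\<close>

lemma face_diff_halve_same:
  assumes i: "1 \<le> i" "i \<le> Suc n"
  shows "face_diff J_I (Suc n) i (halve (Suc n) i c) = face_diff J_I (Suc n) i c"
proof -
  have "pullc J_I n (insert_coord i t) (pullc J_I (Suc n) (coord_map i h) c) = pullc J_I n (insert_coord i (h t)) c"
    if "t \<in> pts J_I" for t h
    using that i I.insert_coord_in[of _ n i t] by (intro pullc_pullc) (simp add: coord_map_insert_coord)
  then show ?thesis by (simp add: face_diff_def halve_def pullc_def[of J_I n] frag_extend_add)
qed

lemma face_diff_halve_upto_gt: "i < j \<Longrightarrow> j \<le> Suc n \<Longrightarrow> face_diff J_I (Suc n) j (halve_upto (Suc n) i c) = halve_upto n i (face_diff J_I (Suc n) j c)"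
  by (induction i arbitrary: c) (simp_all add: face_diff_halve_lt)

text \<open>Halving in the direction \<open>j\<close> of the face disappears because the middle
  faces cancel, while the other halvings commute with the face after renumbering. One halving fewer
  remains, so \<open>Suc i\<close> becomes \<open>i\<close>.\<close>

lemma face_diff_halve_upto_le:
  "1 \<le> j \<Longrightarrow> j \<le> Suc i \<Longrightarrow> i \<le> n \<Longrightarrow> face_diff J_I (Suc n) j (halve_upto (Suc n) (Suc i) c) = halve_upto n i (face_diff J_I (Suc n) j c)"
proof (induction i arbitrary: c)
  case 0
  then have "j = 1" by simp
  then show ?case using face_diff_halve_same[of 1 n c] by simp
next
  case (Suc i)
  show ?case
  proof (cases "j = Suc (Suc i)")
    case True
    have "face_diff J_I (Suc n) j (halve_upto (Suc n) (Suc i) (halve (Suc n) j c)) = halve_upto n (Suc i) (face_diff J_I (Suc n) j (halve (Suc n) j c))"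
      using True Suc.prems by (intro face_diff_halve_upto_gt) auto
    then show ?thesis using face_diff_halve_same[of j n c] True Suc.prems by simp
  next
    case False
    then have "j \<le> Suc i" using Suc.prems by simp
    then show ?thesis using Suc.IH[of "halve (Suc n) (Suc (Suc i)) c"] Suc.prems face_diff_halve_le[of j "Suc i" n c] by simp
  qed
qed

text \<open>A face taken before the sheared pair of coordinates moves the shear down by one
  position.\<close>

lemma face_diff_shear:
  assumes "1 \<le> j" "j \<le> i" "i \<le> n"
  shows "face_diff J_I (Suc (Suc n)) j (pullc J_I (Suc (Suc n)) (shear (Suc i)) c) = pullc J_I (Suc n) (shear i) (face_diff J_I (Suc n) j c)"
proof -
  have "pullc J_I (Suc n) (insert_coord j t) (pullc J_I (Suc (Suc n)) (shear (Suc i)) c)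
      = pullc J_I (Suc n) (shear i) (pullc J_I n (insert_coord j t) c)" if "t \<in> pts J_I" for t
    using assms that I.insert_coord_in[of _ "Suc n" j t] shear_in[of _ n i]
    by (intro pullc_comm) (simp add: shear_insert_coord)
  then show ?thesis by (simp add: face_diff_def pullc_diff)
qed

text \<open>Here the face lies beyond the sheared pair. The shear spends two source coordinates on
  one target coordinate, so the face index drops from \<open>Suc j\<close> to
  \<open>j\<close>.\<close>

lemma face_diff_shear':
  assumes "1 \<le> i" "i < j" "j \<le> Suc n"
  shows "face_diff J_I (Suc (Suc n)) (Suc j) (pullc J_I (Suc (Suc n)) (shear i) c) = pullc J_I (Suc n) (shear i) (face_diff J_I (Suc n) j c)"
proof -
  have "pullc J_I (Suc n) (insert_coord (Suc j) t) (pullc J_I (Suc (Suc n)) (shear i) c)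
      = pullc J_I (Suc n) (shear i) (pullc J_I n (insert_coord j t) c)" if "t \<in> pts J_I" for t
    using assms that I.insert_coord_in[of _ "Suc n" "Suc j" t] shear_in[of _ n i]
    by (intro pullc_comm) (simp add: shear_insert_coord)
  then show ?thesis by (simp add: face_diff_def pullc_diff)
qed

lemma face_diff_shear_middle:
  assumes i: "i \<in> {1..n}"
  shows "face_diff J_I (Suc n) i (pullc J_I (Suc n) (shear i) c) = pullc J_I n (coord_map i (\<lambda>_. 0)) c - pullc J_I n (coord_map i upper) c"
    and "face_diff J_I (Suc n) (Suc i) (pullc J_I (Suc n) (shear i) c) = pullc J_I n (coord_map i lower) c - pullc J_I n (\<lambda>x. x) c"
proof -
  have "pullc J_I n (insert_coord j t) (pullc J_I (Suc n) (shear i) c) = pullc J_I n (\<lambda>x. shear i (insert_coord j t x)) c"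
    if "t \<in> pts J_I" "j \<in> {1..Suc n}" for t j
    using that I.insert_coord_in[of _ n j t] by (intro pullc_pullc) simp
  then show "face_diff J_I (Suc n) i (pullc J_I (Suc n) (shear i) c) = pullc J_I n (coord_map i (\<lambda>_. 0)) c - pullc J_I n (coord_map i upper) c"
    "face_diff J_I (Suc n) (Suc i) (pullc J_I (Suc n) (shear i) c) = pullc J_I n (coord_map i lower) c - pullc J_I n (\<lambda>x. x) c"
    using i by (simp_all add: face_diff_def shear_insert_coord)
qed

lemma pullc_id: "c \<in> ch (cubes J_I X n) \<Longrightarrow> pullc J_I n (\<lambda>x. x) c = c"
proof (induction c rule: ch_induct)
  case (one \<sigma>)
  have "compose (cube J_I n) \<sigma> (\<lambda>x. x) = \<sigma>"
    using I.sing_ext[OF one] by (auto simp: compose_def restrict_def fun_eq_iff extensional_def)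
  then show ?case unfolding pullc_def frag_extend_of by (rule arg_cong)
qed (simp_all add: pullc_diff, simp add: pullc_def)

lemma pullc_deg:
  assumes c: "c \<in> ch (deg_cubes J m)" and \<phi>: "\<phi> ` cube J n \<subseteq> cube J m"
    and i: "\<And>i. i \<in> {1..m} \<Longrightarrow> \<exists>i'\<in>{1..n}. \<forall>x y. (\<forall>j. j \<noteq> i' \<longrightarrow> x j = y j) \<longrightarrow> (\<forall>j. j \<noteq> i \<longrightarrow> \<phi> x j = \<phi> y j)"
  shows "pullc J n \<phi> c \<in> ch (deg_cubes J n)"
  unfolding pullc_def using c by (rule extend_ch) (simp only: frag_of_ch, erule deg_pull[OF _ \<phi>], rule i)

lemma pullc_coord_map_deg:
  assumes "c \<in> ch (deg_cubes J_I n)" "i \<in> {1..n}" "\<And>a. a \<in> {0..1} \<Longrightarrow> h a \<in> {0..1}"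
  shows "pullc J_I n (coord_map i h) c \<in> ch (deg_cubes J_I n)"
  using assms(1)
proof (rule pullc_deg)
  show "coord_map i h ` cube J_I n \<subseteq> cube J_I n" using coord_map_in assms by blast
  show "\<exists>i'\<in>{1..n}. \<forall>x y. (\<forall>j. j \<noteq> i' \<longrightarrow> x j = y j) \<longrightarrow> (\<forall>j. j \<noteq> k \<longrightarrow> coord_map i h x j = coord_map i h y j)" if "k \<in> {1..n}" for k
    using that by (intro bexI[of _ k]) (auto simp: coord_map_def)
qed

lemma pullc_shear_deg:
  assumes "c \<in> ch (deg_cubes J_I n)" "i \<in> {1..n}"
  shows "pullc J_I (Suc n) (shear i) c \<in> ch (deg_cubes J_I (Suc n))"
  using assms(1)
proof (rule pullc_deg)
  show "shear i ` cube J_I (Suc n) \<subseteq> cube J_I n" using shear_in assms(2) by blast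
  show "\<exists>i'\<in>{1..Suc n}. \<forall>x y. (\<forall>j. j \<noteq> i' \<longrightarrow> x j = y j) \<longrightarrow> (\<forall>j. j \<noteq> k \<longrightarrow> shear i x j = shear i y j)" if "k \<in> {1..n}" for k
    \<comment> \<open>Target coordinate \<open>k\<close> corresponds to source coordinate
      \<open>k\<close> up to \<open>i\<close> and to \<open>Suc k\<close> beyond; for
      \<open>k = i\<close> either of the two sheared coordinates would serve.\<close>
    using that by (intro bexI[of _ "if k \<le> i then k else Suc k"]) (auto simp: shear_def)
qed

text \<open>A constant coordinate map ignores its input, so each pulled back cube is independent of
  coordinate \<open>i\<close>. This disposes of the face 0 of the square in the shear.\<close>

lemma pullc_constant_deg: "i \<in> {1..n} \<Longrightarrow> pullc J_I n (coord_map i (\<lambda>_. 0)) c \<in> ch (deg_cubes J_I n)"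
proof -
  assume i: "i \<in> {1..n}"
  have "compose (cube J_I n) \<sigma> (coord_map i (\<lambda>_. 0)) \<in> deg_cubes J_I n" for \<sigma> :: "(nat \<Rightarrow> real) \<Rightarrow> 'a"
  proof (rule degI[OF compose_extensional i])
    fix x y assume xy: "x \<in> cube J_I n" "y \<in> cube J_I n" "\<forall>j. j \<noteq> i \<longrightarrow> x j = y j"
    have "coord_map i (\<lambda>_. 0) x = coord_map i (\<lambda>_. 0) y" using xy(3) by (auto simp: coord_map_def fun_eq_iff)
    then show "compose (cube J_I n) \<sigma> (coord_map i (\<lambda>_. 0)) x = compose (cube J_I n) \<sigma> (coord_map i (\<lambda>_. 0)) y"
      using xy by (simp add: compose_def)
  qed
  then show ?thesis unfolding pullc_def by (intro extend_ch[of c UNIV]) (simp_all add: ch_def)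
qed

lemma halve_deg: "c \<in> ch (deg_cubes J_I n) \<Longrightarrow> i \<in> {1..n} \<Longrightarrow> halve n i c \<in> ch (deg_cubes J_I n)"
  unfolding halve_def by (intro add_ch pullc_coord_map_deg half_in)

lemma halve_upto_deg: "i \<le> n \<Longrightarrow> c \<in> ch (deg_cubes J_I n) \<Longrightarrow> halve_upto n i c \<in> ch (deg_cubes J_I n)"
  by (induction i arbitrary: c) (simp_all add: halve_deg)

lemma halve_S: "c \<in> ch (cubes J_I X n) \<Longrightarrow> i \<in> {1..n} \<Longrightarrow> halve n i c \<in> ch (cubes J_I X n)"
  unfolding halve_def
  by (intro add_ch I.pullc_S[of n n] cont_coord_map half_in) (auto simp: diff_divide_distrib[symmetric])

lemma halve_upto_S: "i \<le> n \<Longrightarrow> c \<in> ch (cubes J_I X n) \<Longrightarrow> halve_upto n i c \<in> ch (cubes J_I X n)"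
  by (induction i arbitrary: c) (simp_all add: halve_S)

lemma cube_homotopy_S:
  "c \<in> ch (cubes J_I X n) \<Longrightarrow> cube_homotopy n c \<in> ch (cubes J_I X (Suc n))"
  unfolding cube_homotopy_def shear_homotopy_def
  by (intro minus_ch sum_ch cmul_ch halve_upto_S I.pullc_S[of "Suc n" n] cont_shear) auto

lemma cube_homotopy_deg:
  "c \<in> ch (deg_cubes J_I n) \<Longrightarrow> cube_homotopy n c \<in> ch (deg_cubes J_I (Suc n))"
  unfolding cube_homotopy_def shear_homotopy_def
  by (intro minus_ch sum_ch cmul_ch halve_upto_deg pullc_shear_deg) auto

text \<open>When all coordinates are halved, \<open>face_diff_halve_upto_le\<close> covers every
  face, so subdivision commutes with the boundary exactly and not only modulo degenerate
  chains.\<close>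

lemma cube_bd_halve_upto: "cube_bd J_I (Suc n) (halve_upto (Suc n) (Suc n) c) = halve_upto n n (cube_bd J_I (Suc n) c)"
proof -
  have "cube_bd J_I (Suc n) (halve_upto (Suc n) (Suc n) c) = (\<Sum>j=1..Suc n. frag_cmul ((-1) ^ j) (halve_upto n n (face_diff J_I (Suc n) j c)))"
    unfolding cube_bd_def by (intro sum.cong refl arg_cong[of _ _ "frag_cmul _"] face_diff_halve_upto_le) auto
  also have "\<dots> = halve_upto n n (cube_bd J_I (Suc n) c)"
    unfolding cube_bd_def by (simp only: additive_signed_sum[where f = "halve_upto n n", OF halve_upto_diff])
  finally show ?thesis .
qed

lemma cube_bd_minus: "cube_bd J n (- c) = - cube_bd J n c"
  using cube_bd_diff[of J n 0 c] by simp

text \<open>By \<open>homotopy_sum\<close> only the faces \<open>i\<close> and \<open>Suc i\<close>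
  of the \<open>i\<close>-th shear survive. They contribute the halving up to \<open>i - 1\<close>
  minus the halving up to \<open>i\<close>, plus a term in which coordinate \<open>i\<close> is
  constant. The differences telescope, and the extra terms are degenerate.\<close>

lemma cube_bd_cube_homotopy:
  assumes c: "c \<in> ch (cubes J_I X n)"
  shows "cube_bd J_I (Suc n) (cube_homotopy n c) + (case n of 0 \<Rightarrow> 0 | Suc k \<Rightarrow> cube_homotopy k (cube_bd J_I n c))
    - (halve_upto n n c - c) \<in> ch (deg_cubes J_I n)"
proof -
  let ?F = "\<lambda>i j. face_diff J_I (Suc n) j (shear_homotopy n i c)" and ?G = "\<lambda>i j. shear_homotopy (n - 1) i (face_diff J_I n j c)"
  have 1: "cube_bd J_I (Suc n) (cube_homotopy n c) = - (\<Sum>i\<in>{1..n}. \<Sum>j\<in>{1..Suc n}. frag_cmul ((-1) ^ (i + j)) (?F i j))"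
    unfolding cube_homotopy_def cube_bd_minus
    by (simp only: additive_signed_sum[where f = "cube_bd J_I (Suc n)", OF cube_bd_diff])
       (simp only: cube_bd_def frag_cmul_sum frag_cmul_cmul power_add)
  have 2: "(case n of 0 \<Rightarrow> 0 | Suc k \<Rightarrow> cube_homotopy k (cube_bd J_I n c)) =
      - (\<Sum>i\<in>{1..<n}. \<Sum>j\<in>{1..n}. frag_cmul ((-1) ^ (i + j)) (?G i j))"
  proof (cases n)
    case (Suc k)
    have "shear_homotopy k i (cube_bd J_I n c) = (\<Sum>j\<in>{1..n}. frag_cmul ((-1) ^ j) (?G i j))" for i
      unfolding cube_bd_def by (simp only: additive_signed_sum[where f = "shear_homotopy k i", OF shear_homotopy_diff] Suc diff_Suc_1)
    then show ?thesis
      using Suc by (simp add: cube_homotopy_def frag_cmul_sum power_add atLeastLessThanSuc_atLeastAtMost del: sum.cl_ivl_Suc)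
  qed simp
  have 3: "(\<Sum>i\<in>{1..n}. \<Sum>j\<in>{1..Suc n}. frag_cmul ((-1) ^ (i + j)) (?F i j)) +
      (\<Sum>i\<in>{1..<n}. \<Sum>j\<in>{1..n}. frag_cmul ((-1) ^ (i + j)) (?G i j)) = (\<Sum>i\<in>{1..n}. ?F i i - ?F i (Suc i))"
  proof (rule homotopy_sum)
    fix i j assume ij: "1 \<le> j" "j \<le> i" "i < n"
    obtain k where k: "n = Suc k" using ij by (cases n) auto
    obtain l where l: "i = Suc l" using ij by (cases i) auto
    \<comment> \<open>\<open>shear_homotopy\<close> at \<open>Suc i\<close> halves
      \<open>i = Suc l\<close> coordinates; a face in one of these directions leaves
      \<open>l\<close>, the number belonging to \<open>shear_homotopy\<close> at
      \<open>i\<close>.\<close>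
    have "?F (Suc i) j = halve_upto n l (face_diff J_I (Suc n) j (pullc J_I (Suc n) (shear (Suc i)) c))"
      using face_diff_halve_upto_le[of j l n] ij l by (simp add: shear_homotopy_def)
    also have "face_diff J_I (Suc n) j (pullc J_I (Suc n) (shear (Suc i)) c) = pullc J_I n (shear i) (face_diff J_I n j c)"
      using face_diff_shear[of j i k c] ij k by simp
    finally show "?G i j = ?F (Suc i) j" using k l by (simp add: shear_homotopy_def)
  next
    fix i j assume ij: "1 \<le> i" "i < j" "j \<le> n"
    obtain k where k: "n = Suc k" using ij by (cases n) auto
    have "?F i (Suc j) = halve_upto n (i - 1) (face_diff J_I (Suc n) (Suc j) (pullc J_I (Suc n) (shear i) c))"
      unfolding shear_homotopy_def using ij by (intro face_diff_halve_upto_gt) auto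
    also have "face_diff J_I (Suc n) (Suc j) (pullc J_I (Suc n) (shear i) c) = pullc J_I n (shear i) (face_diff J_I n j c)"
      using face_diff_shear'[of i j k c] ij k by simp
    finally show "?G i j = ?F i (Suc j)" using k by (simp add: shear_homotopy_def)
  qed
  let ?z = "\<lambda>i. halve_upto n (i - 1) (pullc J_I n (coord_map i (\<lambda>_. 0)) c)"
  have 4: "?F i i - ?F i (Suc i) = ?z i + (halve_upto n (i - 1) c - halve_upto n i c)" if i: "i \<in> {1..n}" for i
  proof -
    obtain l where l: "i = Suc l" using i by (cases i) auto
    have "?F i i = halve_upto n l (face_diff J_I (Suc n) i (pullc J_I (Suc n) (shear i) c))"
      "?F i (Suc i) = halve_upto n l (face_diff J_I (Suc n) (Suc i) (pullc J_I (Suc n) (shear i) c))"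
      using face_diff_halve_upto_gt[of l i n] face_diff_halve_upto_gt[of l "Suc i" n] i l by (simp_all add: shear_homotopy_def)
    then have "?F i i - ?F i (Suc i) = halve_upto n l (pullc J_I n (coord_map i (\<lambda>_. 0)) c - pullc J_I n (coord_map i upper) c
        - (pullc J_I n (coord_map i lower) c - c))"
      by (simp only: face_diff_shear_middle[OF i] pullc_id[OF c] halve_upto_diff)
    \<comment> \<open>The upper half comes from direction \<open>i\<close> and the lower half from
      direction \<open>Suc i\<close>; they enter with the same sign and combine to
      \<open>halve\<close>.\<close>
    also have "\<dots> = halve_upto n l (pullc J_I n (coord_map i (\<lambda>_. 0)) c - halve n i c - (0 - c))"
      by (rule arg_cong[of _ _ "halve_upto n l"]) (simp add: halve_def)
    also have "\<dots> = halve_upto n l (pullc J_I n (coord_map i (\<lambda>_. 0)) c) - halve_upto n i c + halve_upto n l c"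
      using l by (simp add: halve_upto_diff halve_upto_add)
    finally show ?thesis using l by simp
  qed
  have "(\<Sum>i\<in>{1..m}. halve_upto n (i - 1) c - halve_upto n i c) = c - halve_upto n m c" for m
    by (induction m) auto
  then have "(\<Sum>i\<in>{1..n}. ?F i i - ?F i (Suc i)) = (\<Sum>i\<in>{1..n}. ?z i) + (c - halve_upto n n c)"
    using 4 by (simp add: sum.distrib)
  then have "cube_bd J_I (Suc n) (cube_homotopy n c) + (case n of 0 \<Rightarrow> 0 | Suc k \<Rightarrow> cube_homotopy k (cube_bd J_I n c))
    - (halve_upto n n c - c) = - (\<Sum>i\<in>{1..n}. ?z i)"
    unfolding 1 2 using 3 by (simp add: algebra_simps)
  also have "\<dots> \<in> ch (deg_cubes J_I n)"
    by (intro minus_ch sum_ch halve_upto_deg pullc_constant_deg) auto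
  finally show ?thesis .
qed

text \<open>A separate factor \<open>d j\<close> per coordinate is recorded because halving treats
  one coordinate at a time. Shrinking is measured on the reparametrization \<open>\<psi>\<close>,
  since the target of \<open>\<sigma>\<close> carries no metric.\<close>

definition contr :: "nat \<Rightarrow> ((nat \<Rightarrow> real) \<Rightarrow> 'a) \<Rightarrow> (nat \<Rightarrow> real) \<Rightarrow> ((nat \<Rightarrow> real) \<Rightarrow> 'a) set" where
  "contr n \<sigma> d = {compose (cube J_I n) \<sigma> \<psi> |\<psi>. \<psi> ` cube J_I n \<subseteq> cube J_I n \<and>
     (\<forall>x\<in>cube J_I n. \<forall>y\<in>cube J_I n. \<forall>j\<in>{1..n}. \<bar>\<psi> x j - \<psi> y j\<bar> \<le> d j * \<bar>x j - y j\<bar>)}"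

lemma contrE:
  assumes "\<rho> \<in> contr n \<sigma> d"
  obtains \<psi> where "\<rho> = compose (cube J_I n) \<sigma> \<psi>" "\<psi> ` cube J_I n \<subseteq> cube J_I n"
    "\<forall>x\<in>cube J_I n. \<forall>y\<in>cube J_I n. \<forall>j\<in>{1..n}. \<bar>\<psi> x j - \<psi> y j\<bar> \<le> d j * \<bar>x j - y j\<bar>"
  using assms unfolding contr_def mem_Collect_eq by (elim exE conjE)

lemma contr_cong: "(\<And>j. j \<in> {1..n} \<Longrightarrow> d j = d' j) \<Longrightarrow> contr n \<sigma> d = contr n \<sigma> d'"
  by (simp add: contr_def)

text \<open>The map \<open>h\<close> acts before the reparametrization, and the estimate in
  \<open>contr\<close> compares equal coordinates, so only coordinate \<open>i\<close> gains a
  factor 1/2.\<close>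

lemma pullc_coord_map_contr:
  assumes c: "c \<in> ch (contr n \<sigma> d)" and i: "i \<in> {1..n}" and d: "\<And>j. 0 \<le> d j"
    and h: "\<And>a. a \<in> {0..1} \<Longrightarrow> h a \<in> {0..1}" "\<And>a b. \<bar>h a - h b\<bar> \<le> \<bar>a - b\<bar> / 2"
  shows "pullc J_I n (coord_map i h) c \<in> ch (contr n \<sigma> (d(i := d i / 2)))"
  unfolding pullc_def using c
proof (rule extend_ch)
  let ?P = "cube J_I n"
  fix \<tau> assume "\<tau> \<in> contr n \<sigma> d"
  then obtain \<psi> where \<psi>: "\<tau> = compose ?P \<sigma> \<psi>" "\<psi> ` ?P \<subseteq> ?P"
    "\<forall>x\<in>?P. \<forall>y\<in>?P. \<forall>j\<in>{1..n}. \<bar>\<psi> x j - \<psi> y j\<bar> \<le> d j * \<bar>x j - y j\<bar>"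
    by (rule contrE)
  have u: "coord_map i h x \<in> ?P" if "x \<in> ?P" for x by (rule coord_map_in[OF that i h(1)])
  have "compose ?P \<tau> (coord_map i h) = compose ?P \<sigma> (\<psi> \<circ> coord_map i h)"
    unfolding \<psi>(1) using u by (intro compose_compose_eq) simp
  moreover have "(\<psi> \<circ> coord_map i h) ` ?P \<subseteq> ?P" using u \<psi>(2) by auto
  moreover have "\<bar>(\<psi> \<circ> coord_map i h) x j - (\<psi> \<circ> coord_map i h) y j\<bar> \<le> (d(i := d i / 2)) j * \<bar>x j - y j\<bar>"
    if xy: "x \<in> ?P" "y \<in> ?P" "j \<in> {1..n}" for x y j
  proof -
    have "\<bar>\<psi> (coord_map i h x) j - \<psi> (coord_map i h y) j\<bar> \<le> d j * \<bar>coord_map i h x j - coord_map i h y j\<bar>"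
      using bspec[OF bspec[OF bspec[OF \<psi>(3) u[OF xy(1)]] u[OF xy(2)]] xy(3)] .
    also have "\<dots> \<le> (d(i := d i / 2)) j * \<bar>x j - y j\<bar>"
      using mult_left_mono[OF h(2)[of "x i" "y i"] d[of i]] by (auto simp: coord_map_def)
    finally show ?thesis by simp
  qed
  ultimately have "compose ?P \<tau> (coord_map i h) \<in> contr n \<sigma> (d(i := d i / 2))"
    unfolding contr_def by (intro CollectI exI[of _ "\<psi> \<circ> coord_map i h"] conjI ballI)
  then show "frag_of (compose ?P \<tau> (coord_map i h)) \<in> ch (contr n \<sigma> (d(i := d i / 2)))" by simp
qed

lemma halve_upto_contr:
  assumes "i \<le> n" "c \<in> ch (contr n \<sigma> d)" "\<And>j. 0 \<le> d j"
  shows "halve_upto n i c \<in> ch (contr n \<sigma> (\<lambda>j. if j \<in> {1..i} then d j / 2 else d j))"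
  using assms
proof (induction i arbitrary: c d)
  case (Suc i)
  let ?d = "d(Suc i := d (Suc i) / 2)"
  have i: "Suc i \<in> {1..n}" using Suc.prems by auto
  have sd: "halve n (Suc i) c \<in> ch (contr n \<sigma> ?d)"
    unfolding halve_def
    by (intro add_ch pullc_coord_map_contr Suc.prems i half_in) (auto simp: diff_divide_distrib[symmetric])
  have "halve_upto n i (halve n (Suc i) c) \<in> ch (contr n \<sigma> (\<lambda>j. if j \<in> {1..i} then ?d j / 2 else ?d j))"
  proof (rule Suc.IH)
    show "i \<le> n" "\<And>j. 0 \<le> ?d j" using Suc.prems by simp_all
  qed (rule sd)
  also have "(\<lambda>j. if j \<in> {1..i} then ?d j / 2 else ?d j) = (\<lambda>j. if j \<in> {1..Suc i} then d j / 2 else d j)"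
    by (auto simp: fun_eq_iff)
  finally show ?case by simp
qed simp

text \<open>Each full subdivision halves all coordinates \<open>1, ..., n\<close>, and only these
  enter \<open>contr\<close>, so the factors may be replaced by one constant.\<close>

lemma halve_upto_pow_contr:
  assumes "\<sigma> \<in> extensional (cube J_I n)"
  shows "(halve_upto n n ^^ m) (frag_of \<sigma>) \<in> ch (contr n \<sigma> (\<lambda>_. (1 / 2) ^ m))"
proof (induction m)
  case 0
  have "compose (cube J_I n) \<sigma> (\<lambda>x. x) = \<sigma>"
    using assms by (auto simp: compose_def restrict_def fun_eq_iff extensional_def)
  then have "\<sigma> \<in> contr n \<sigma> (\<lambda>_. 1)" unfolding contr_def by force
  then show ?case by simp
next
  case (Suc m)
  have "halve_upto n n ((halve_upto n n ^^ m) (frag_of \<sigma>)) \<in> ch (contr n \<sigma> (\<lambda>j. if j \<in> {1..n} then (1 / 2) ^ m / 2 else (1 / 2) ^ m))"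
    by (rule halve_upto_contr[OF order_refl Suc]) simp
  also have "contr n \<sigma> (\<lambda>j. if j \<in> {1..n} then (1 / 2) ^ m / 2 else (1 / 2) ^ m) = contr n \<sigma> (\<lambda>_. (1 / 2) ^ Suc m)"
    by (rule contr_cong) simp
  finally show ?case by simp
qed

lemma small_subdivision_cube:
  assumes X: "closure_space X" and cov: "interior_cover X {A, B}" and \<sigma>: "\<sigma> \<in> cubes J_I X n"
  shows "\<exists>m. (halve_upto n n ^^ m) (frag_of \<sigma>) \<in>
    ch (cubes J_I (subspace X A) n \<union> cubes J_I (subspace X B) n)"
proof -
  let ?P = "cube J_I n"
  have AB: "A \<subseteq> pts X" "B \<subseteq> pts X" using cov unfolding interior_cover_def by blast+
  obtain e where e: "e > 0" "\<And>x. x \<in> ?P \<Longrightarrow> \<exists>U\<in>{A, B}. \<forall>y\<in>?P. (\<forall>j\<in>{1..n}. \<bar>y j - x j\<bar> < e) \<longrightarrow> \<sigma> y \<in> U"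
    using lebesgue_cube[OF X cov I.sing_cont[OF \<sigma>]] by blast
  \<comment> \<open>After \<open>m\<close> subdivisions each subcube has side at most
    \<open>(1 / 2) ^ m\<close>, which is made smaller than the Lebesgue number
    \<open>e\<close>.\<close>
  obtain m where m: "(1 / 2) ^ m < e" using real_arch_pow_inv[OF e(1), of "1 / 2"] by auto
  let ?c = "(halve_upto n n ^^ m) (frag_of \<sigma>)"
  have "?c \<in> ch (cubes J_I X n)"
    using \<sigma> by (induction m) (simp_all add: halve_upto_S)
  then have c: "?c \<in> ch (contr n \<sigma> (\<lambda>_. (1 / 2) ^ m) \<inter> cubes J_I X n)"
    using halve_upto_pow_contr[OF I.sing_ext[OF \<sigma>]] by (intro ch_Int)
  have "contr n \<sigma> (\<lambda>_. (1 / 2) ^ m) \<inter> cubes J_I X n \<subseteq>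
      cubes J_I (subspace X A) n \<union> cubes J_I (subspace X B) n"
  proof
    fix \<tau> assume \<tau>: "\<tau> \<in> contr n \<sigma> (\<lambda>_. (1 / 2) ^ m) \<inter> cubes J_I X n"
    then have "\<tau> \<in> contr n \<sigma> (\<lambda>_. (1 / 2) ^ m)" by blast
    then obtain \<psi> where \<psi>: "\<tau> = compose ?P \<sigma> \<psi>" "\<psi> ` ?P \<subseteq> ?P"
      "\<forall>x\<in>?P. \<forall>y\<in>?P. \<forall>j\<in>{1..n}. \<bar>\<psi> x j - \<psi> y j\<bar> \<le> (1 / 2) ^ m * \<bar>x j - y j\<bar>"
      by (rule contrE)
    \<comment> \<open>Any point serves as center, since the coordinates of two points of the cube
      differ by at most 1.\<close>
    obtain p where p: "p \<in> ?P" using I.ne_M by blast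
    then have "\<psi> p \<in> ?P" using \<psi>(2) by blast
    from e(2)[OF this] obtain U where U: "U \<in> {A, B}"
      "\<forall>y\<in>?P. (\<forall>j\<in>{1..n}. \<bar>y j - \<psi> p j\<bar> < e) \<longrightarrow> \<sigma> y \<in> U" by (rule bexE)
    have "\<tau> x \<in> U" if x: "x \<in> ?P" for x
    proof -
      have "\<bar>\<psi> x j - \<psi> p j\<bar> < e" if j: "j \<in> {1..n}" for j
      proof -
        have "x j \<in> {0..1}" "p j \<in> {0..1}" using x p j by (auto simp: pts_cpower PiE_iff)
        then have "\<bar>x j - p j\<bar> \<le> 1" by auto
        then have "(1 / 2) ^ m * \<bar>x j - p j\<bar> \<le> (1 / 2) ^ m" by (simp add: mult_left_le)
        then show ?thesis using bspec[OF bspec[OF bspec[OF \<psi>(3) x] p] j] m by linarith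
      qed
      moreover have "\<psi> x \<in> ?P" using \<psi>(2) x by blast
      ultimately have "\<sigma> (\<psi> x) \<in> U" using U(2) by simp
      then show ?thesis using x by (simp add: \<psi>(1) compose_def)
    qed
    then have "\<tau> ` ?P \<subseteq> A \<or> \<tau> ` ?P \<subseteq> B" using U(1) by auto
    then show "\<tau> \<in> cubes J_I (subspace X A) n \<union> cubes J_I (subspace X B) n"
      using \<tau> by (simp add: I.sing_subspace_iff AB)
  qed
  then show ?thesis using ch_mono[OF _ c] by blast
qed

lemma homology_theory_cubical_I:
  "homology_theory J_I (cub_H J_I :: ('a, _) pair_groups) (cub_H J_I :: ('b, _) pair_groups)
    (cub_H J_I :: ('c, _) pair_groups) (cub_map J_I) (cub_map J_I) (cub_map J_I) (cub_map J_I) (cub_conn J_I) (cub_conn J_I)"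
proof (rule I.homology_theory_cubical)
  interpret chain_model "cubes J_I" "deg_cubes J_I" "cube_bd J_I" "cubical_cx J_I"
    "cubical_map J_I :: ('a, _, 'a, _) cx_map" I.cubical_class by (rule I.chain_model)
  fix n and X :: "'a cspace" and A B z
  assume X: "closure_space X" and cov: "interior_cover X {A, B}" and z: "z \<in> ch (cubes J_I X n)"
    "\<And>k. n = Suc k \<Longrightarrow> cube_bd J_I n z \<in> ch (cubes J_I (subspace X A) k
      \<union> cubes J_I (subspace X B) k \<union> deg_cubes J_I k)"
  have sp: "space_pair X A" "space_pair X B"
    using X cov unfolding interior_cover_def space_pair_def by blast+
  show "\<exists>w\<in>ch (cubes J_I X (Suc n)). z - cube_bd J_I (Suc n) w
      \<in> ch (cubes J_I (subspace X A) n \<union> cubes J_I (subspace X B) n \<union> deg_cubes J_I n)"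
  proof (rule small_by_subdivision[OF sp, where Sd = "\<lambda>n. halve_upto n n" and T = cube_homotopy])
    show "cube_bd J_I n z \<in> ch (cubes J_I (subspace X A) k
      \<union> cubes J_I (subspace X B) k \<union> deg_cubes J_I k)" if "n = Suc k" for k
      using z(2)[OF that] .
    fix n
    show "\<exists>m. (halve_upto n n ^^ m) (frag_of \<sigma>) \<in> ch (cubes J_I (subspace X A) n
      \<union> cubes J_I (subspace X B) n \<union> deg_cubes J_I n)"
      if "\<sigma> \<in> cubes J_I X n" for \<sigma>
      using small_subdivision_cube[OF X cov that] by (meson ch_mono sup_ge1)
    show "cube_bd J_I (Suc n) (cube_homotopy n c) + (case n of 0 \<Rightarrow> 0 | Suc k \<Rightarrow> cube_homotopy k (cube_bd J_I n c))
      - (halve_upto n n c - c) \<in> ch (deg_cubes J_I n)" if "c \<in> ch (cubes J_I X n)" for c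
      using cube_bd_cube_homotopy[OF that] .
  qed (simp_all add: halve_upto_diff cube_homotopy_diff halve_upto_S cube_homotopy_S halve_upto_deg cube_homotopy_deg cube_bd_halve_upto z del: halve_upto.simps)
qed

theorem theorem5p19:
  shows
   "homology_theory J_I
      (simp_H simplex_I face_I :: ('a, _) pair_groups) (simp_H simplex_I face_I :: ('b, _) pair_groups)
      (simp_H simplex_I face_I :: ('c, _) pair_groups)
      (simp_map simplex_I face_I) (simp_map simplex_I face_I) (simp_map simplex_I face_I) (simp_map simplex_I face_I)
      (simp_conn simplex_I face_I) (simp_conn simplex_I face_I) \<and>
    homology_theory J_1
      (simp_H simplex_1 face_vertex :: ('a, _) pair_groups) (simp_H simplex_1 face_vertex :: ('b, _) pair_groups)
      (simp_H simplex_1 face_vertex :: ('c, _) pair_groups)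
      (simp_map simplex_1 face_vertex) (simp_map simplex_1 face_vertex) (simp_map simplex_1 face_vertex) (simp_map simplex_1 face_vertex)
      (simp_conn simplex_1 face_vertex) (simp_conn simplex_1 face_vertex) \<and>
    homology_theory J_plus
      (simp_H simplex_plus face_vertex :: ('a, _) pair_groups) (simp_H simplex_plus face_vertex :: ('b, _) pair_groups)
      (simp_H simplex_plus face_vertex :: ('c, _) pair_groups)
      (simp_map simplex_plus face_vertex) (simp_map simplex_plus face_vertex) (simp_map simplex_plus face_vertex) (simp_map simplex_plus face_vertex)
      (simp_conn simplex_plus face_vertex) (simp_conn simplex_plus face_vertex) \<and>
    homology_theory J_I
      (cub_H J_I :: ('a, _) pair_groups) (cub_H J_I :: ('b, _) pair_groups)
      (cub_H J_I :: ('c, _) pair_groups)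
      (cub_map J_I) (cub_map J_I) (cub_map J_I) (cub_map J_I)
      (cub_conn J_I) (cub_conn J_I) \<and>
    homology_theory J_1
      (cub_H J_1 :: ('a, _) pair_groups) (cub_H J_1 :: ('b, _) pair_groups)
      (cub_H J_1 :: ('c, _) pair_groups)
      (cub_map J_1) (cub_map J_1) (cub_map J_1) (cub_map J_1)
      (cub_conn J_1) (cub_conn J_1) \<and>
    homology_theory J_plus
      (cub_H J_plus :: ('a, _) pair_groups) (cub_H J_plus :: ('b, _) pair_groups)
      (cub_H J_plus :: ('c, _) pair_groups)
      (cub_map J_plus) (cub_map J_plus) (cub_map J_plus) (cub_map J_plus)
      (cub_conn J_plus) (cub_conn J_plus)"
  by (intro conjI homology_theory_simplex_I homology_theory_simplex_1 homology_theory_simplex_plus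
      homology_theory_cubical_I homology_theory_cubical_1 homology_theory_cubical_plus)

end
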